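(* Let $d\geq 3$ and let $(M,g)$ be the Kasner spacetime $M=(0,\infty)\times\mathbb{R}^d$ with metric $g=-dt^2+\sum_{i=1}^d t^{2p_i}\,dx_i^2$, where the Kasner exponents $p_1,\dots,p_d\in\mathbb{R}$ satisfy $\sum_{i=1}^d p_i=1$ and $\sum_{i=1}^d p_i^2=1$, and where at least one $p_i$ is negative. Then $(M,g)$ is $C^0$-inextendible.
   Context: $(M,g)$ is time-oriented by declaring $\partial_t$ future directed. A $C^0$-extension of a time-oriented Lorentzian manifold $(M,g)$ with smooth metric is a smooth isometric embedding $\iota:M\hookrightarrow\tilde M$ into a Lorentzian manifold $(\tilde M,\tilde g)$ of the same dimension with a continuous Lorentzian metric $\tilde g$, such that the topological boundary $\partial\iota(M)$ of $\iota(M)$ in $\tilde M$ is non-empty. $(M,g)$ is $C^0$-inextendible if no $C^0$-extension exists. Manifolds are Hausdorff, second countable, smooth and connected. *)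

theory Defs
  imports "HOL-Analysis.Analysis"
begin

type_synonym 'n spt = "real \<times> (real ^ 'n)"

fun Ck_on :: "nat \<Rightarrow> 'a::euclidean_space set \<Rightarrow> ('a \<Rightarrow> 'b::euclidean_space) \<Rightarrow> bool" where
  "Ck_on 0 S f = continuous_on S f"
| "Ck_on (Suc k) S f =
     ((\<forall>x\<in>S. f differentiable (at x)) \<and>
      (\<forall>v. Ck_on k S (\<lambda>x. frechet_derivative f (at x) v)))"

definition smooth_on :: "'a::euclidean_space set \<Rightarrow> ('a \<Rightarrow> 'b::euclidean_space) \<Rightarrow> bool" where
  "smooth_on S f \<longleftrightarrow> (\<forall>k. Ck_on k S f)"

definition lorentz_form :: "('v::euclidean_space \<Rightarrow> 'v \<Rightarrow> real) \<Rightarrow> bool" where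
  "lorentz_form B \<longleftrightarrow> bilinear B \<and> (\<forall>u v. B u v = B v u) \<and>
     (\<exists>e. B e e < 0) \<and>
     (\<exists>W. subspace W \<and> dim W = DIM('v) - 1 \<and> (\<forall>w\<in>W. w \<noteq> 0 \<longrightarrow> B w w > 0))"

definition smooth_manifold :: "'a topology \<Rightarrow> ('a set \<times> ('a \<Rightarrow> 'v::euclidean_space)) set \<Rightarrow> bool" where
  "smooth_manifold T A \<longleftrightarrow>
     Hausdorff_space T \<and> second_countable T \<and> connected_space T \<and>
     (\<forall>(U,\<phi>)\<in>A. openin T U \<and> open (\<phi> ` U) \<and>
        homeomorphic_map (subtopology T U) (top_of_set (\<phi> ` U)) \<phi>) \<and>
     \<Union>(fst ` A) = topspace T \<and>
     (\<forall>(U,\<phi>)\<in>A. \<forall>(V,\<psi>)\<in>A. smooth_on (\<phi> ` (U \<inter> V)) (\<psi> \<circ> inv_into U \<phi>))"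

text \<open>A continuous Lorentzian metric on (T, A): in each chart (U, \<phi>) its coordinate
  expression G (U,\<phi>) y u v (at y \<in> \<phi> ` U, on coordinate vectors u, v), continuous,
  Lorentzian, and transforming as a (0,2)-tensor under chart changes.\<close>
definition continuous_lorentzian_metric ::
  "'a topology \<Rightarrow> ('a set \<times> ('a \<Rightarrow> 'v::euclidean_space)) set \<Rightarrow>
   ('a set \<times> ('a \<Rightarrow> 'v) \<Rightarrow> 'v \<Rightarrow> 'v \<Rightarrow> 'v \<Rightarrow> real) \<Rightarrow> bool" where
  "continuous_lorentzian_metric T A G \<longleftrightarrow>
     (\<forall>(U,\<phi>)\<in>A.
        (\<forall>y\<in>\<phi> ` U. lorentz_form (G (U,\<phi>) y)) \<and>
        (\<forall>u v. continuous_on (\<phi> ` U) (\<lambda>y. G (U,\<phi>) y u v))) \<and>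
     (\<forall>(U,\<phi>)\<in>A. \<forall>(V,\<psi>)\<in>A. \<forall>y\<in>\<phi> ` (U \<inter> V). \<forall>u v.
        G (U,\<phi>) y u v =
        G (V,\<psi>) ((\<psi> \<circ> inv_into U \<phi>) y)
          (frechet_derivative (\<psi> \<circ> inv_into U \<phi>) (at y) u)
          (frechet_derivative (\<psi> \<circ> inv_into U \<phi>) (at y) v))"

text \<open>C^0-extension of a spacetime given globally in coordinates: an open set
  M \<subseteq> 'v with (smooth) coordinate metric g.  The extension is (T, A, G) and the
  map \<iota> is a smooth isometric embedding with nonempty topological boundary of \<iota>(M).\<close>
definition is_C0_extension ::
  "'v::euclidean_space set \<Rightarrow> ('v \<Rightarrow> 'v \<Rightarrow> 'v \<Rightarrow> real) \<Rightarrow>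
   'a topology \<Rightarrow> ('a set \<times> ('a \<Rightarrow> 'v)) set \<Rightarrow>
   ('a set \<times> ('a \<Rightarrow> 'v) \<Rightarrow> 'v \<Rightarrow> 'v \<Rightarrow> 'v \<Rightarrow> real) \<Rightarrow> ('v \<Rightarrow> 'a) \<Rightarrow> bool" where
  "is_C0_extension M g T A G \<iota> \<longleftrightarrow>
     smooth_manifold T A \<and> continuous_lorentzian_metric T A G \<and>
     embedding_map (top_of_set M) T \<iota> \<and>
     (\<forall>(U,\<phi>)\<in>A. smooth_on (M \<inter> \<iota> -` U) (\<phi> \<circ> \<iota>) \<and>
        (\<forall>z\<in>M \<inter> \<iota> -` U. inj (frechet_derivative (\<phi> \<circ> \<iota>) (at z)) \<and>
           (\<forall>u v. g z u v =
              G (U,\<phi>) (\<phi> (\<iota> z)) (frechet_derivative (\<phi> \<circ> \<iota>) (at z) u)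
                                 (frechet_derivative (\<phi> \<circ> \<iota>) (at z) v)))) \<and>
     T frontier_of (\<iota> ` M) \<noteq> {}"

definition kasner_M :: "'n::finite spt set" where
  "kasner_M = {z. fst z > 0}"

definition kasner_g :: "('n::finite \<Rightarrow> real) \<Rightarrow> 'n spt \<Rightarrow> 'n spt \<Rightarrow> 'n spt \<Rightarrow> real" where
  "kasner_g p z u v =
     - (fst u * fst v) + (\<Sum>i\<in>UNIV. fst z powr (2 * p i) * (snd u $ i) * (snd v $ i))"

end

theory Submission
  imports Defs
begin

text \<open>Suppose an extension exists. A straight segment in a chart of the extension, timelike for the
  extended metric, leaves the image of the Kasner spacetime through a boundary point q. Near q the
  continuous metric is pinched between two constant cones, and Kasner time is monotone along the
  segment. Two homotopy arguments link the chart with Kasner coordinates: timelike curves with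
  common endpoints can be deformed into one another, in the chart without leaving the image of the
  spacetime (because causal diamonds of Kasner are compact) and in Kasner coordinates without
  leaving the chart (because truncated wide cones in the chart are compact).

  If t increases towards q, then t tends to infinity. Starting the segment slightly earlier gives
  enough slack to slow down the curve by a constant factor in the time variable t powr (1 + m),
  where all exponents are at least -m > -1; this produces timelike curves of arbitrarily large
  length between points of the chart whose coordinate distance is bounded, a contradiction.

  If t decreases towards q, then t tends to 0. The slices of constant t are graphs of uniformly
  bounded slope in the chart, so their spatial diameter is bounded. Comoving lines starting close to
  q stay in the chart all the way to t = 0: otherwise another boundary point, causally but not
  trivially related to q, would have the same endpoint on t = 0. Hence two comoving lines that differ
  in a direction x_j with p_j < 0 remain in the chart, although their distance grows like
  t powr p_j.\<close>

section \<open>Curves with prescribed right-hand velocities\<close>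

definition velocity_in :: "(real \<Rightarrow> 'b set) \<Rightarrow> real \<Rightarrow> real \<Rightarrow> (real \<Rightarrow> 'b::real_normed_vector) \<Rightarrow> bool" where
  "velocity_in V a b c \<longleftrightarrow> continuous_on {a..b} c \<and>
     (\<forall>t\<in>{a..<b}. \<exists>v\<in>V t. (c has_vector_derivative v) (at t within {t..}))"

lemma velocity_in_continuous_on: "velocity_in V a b c \<Longrightarrow> continuous_on {a..b} c"
  by (simp add: velocity_in_def)

lemma velocity_inE:
  assumes "velocity_in V a b c" "t \<in> {a..<b}"
  obtains v where "v \<in> V t" "(c has_vector_derivative v) (at t within {t..})"
  using assms unfolding velocity_in_def by blast

lemma velocity_inI_differentiable:
  assumes "\<And>t. t \<in> {a..b} \<Longrightarrow> \<exists>v\<in>V t. (c has_vector_derivative v) (at t)"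
  shows "velocity_in V a b c"
  unfolding velocity_in_def
proof (intro conjI ballI)
  show "continuous_on {a..b} c"
    by (meson assms continuous_at_imp_continuous_on has_vector_derivative_continuous)
  show "\<exists>v\<in>V t. (c has_vector_derivative v) (at t within {t..})" if "t \<in> {a..<b}" for t
    using assms[of t] that by (auto intro: has_vector_derivative_at_within)
qed

lemma velocity_in_subinterval:
  "velocity_in V a b c \<Longrightarrow> a \<le> a' \<Longrightarrow> b' \<le> b \<Longrightarrow> velocity_in V a' b' c"
  by (auto simp: velocity_in_def intro: continuous_on_subset)

lemma velocity_in_mono:
  "velocity_in V a b c \<Longrightarrow> (\<And>t. t \<in> {a..<b} \<Longrightarrow> V t \<subseteq> V' t) \<Longrightarrow> velocity_in V' a b c"
  unfolding velocity_in_def by (meson subsetD)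

lemma velocity_in_const: "(\<And>t. 0 \<in> V t) \<Longrightarrow> velocity_in V a b (\<lambda>_. x)"
  by (auto simp: velocity_in_def intro!: bexI[of _ 0])

lemma velocity_in_diff_const: "velocity_in V a b c \<Longrightarrow> velocity_in V a b (\<lambda>t. c t - x)"
  by (simp add: velocity_in_def has_vector_derivative_diff_const continuous_on_diff)

lemma velocity_in_convex_combination:
  assumes c: "velocity_in V a b c" and c': "velocity_in V a b c'" and "\<And>t. convex (V t)"
    and r: "0 \<le> r" "r \<le> 1"
  shows "velocity_in V a b (\<lambda>t. (1 - r) *\<^sub>R c t + r *\<^sub>R c' t)"
  unfolding velocity_in_def
proof (intro conjI ballI)
  show "continuous_on {a..b} (\<lambda>t. (1 - r) *\<^sub>R c t + r *\<^sub>R c' t)"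
    by (intro continuous_intros velocity_in_continuous_on[OF c] velocity_in_continuous_on[OF c'])
  fix t assume t: "t \<in> {a..<b}"
  obtain v where v: "v \<in> V t" "(c has_vector_derivative v) (at t within {t..})"
    by (rule velocity_inE[OF c t])
  obtain v' where v': "v' \<in> V t" "(c' has_vector_derivative v') (at t within {t..})"
    by (rule velocity_inE[OF c' t])
  have "((\<lambda>t. (1 - r) *\<^sub>R c t + r *\<^sub>R c' t)
      has_vector_derivative (1 - r) *\<^sub>R v + r *\<^sub>R v') (at t within {t..})"
    by (intro has_vector_derivative_add v v'
        bounded_linear.has_vector_derivative[OF bounded_linear_scaleR_right])
  moreover have "(1 - r) *\<^sub>R v + r *\<^sub>R v' \<in> V t"
    by (rule convexD[OF assms(3)]) (use v v' r in auto)
  ultimately show "\<exists>v\<in>V t. ((\<lambda>t. (1 - r) *\<^sub>R c t + r *\<^sub>R c' t)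
      has_vector_derivative v) (at t within {t..})"
    by blast
qed

lemma velocity_in_join:
  assumes c: "velocity_in V a b c" and c': "velocity_in V b d c'"
    and "c b = c' b" "a \<le> b" "b \<le> d"
  shows "velocity_in V a d (\<lambda>t. if t < b then c t else c' t)"
  unfolding velocity_in_def
proof (intro conjI ballI)
  have "continuous_on ({a..b} \<union> {b..d}) (\<lambda>t. if t < b then c t else c' t)"
    by (rule continuous_on_cases) (use assms in \<open>auto simp: velocity_in_def\<close>)
  moreover have "{a..b} \<union> {b..d} = {a..d}" using assms by auto
  ultimately show "continuous_on {a..d} (\<lambda>t. if t < b then c t else c' t)" by simp
next
  fix t assume t: "t \<in> {a..<d}"
  show "\<exists>v\<in>V t. ((\<lambda>t. if t < b then c t else c' t) has_vector_derivative v) (at t within {t..})"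
  proof (cases "t < b")
    case True
    with t obtain v where v: "v \<in> V t" "(c has_vector_derivative v) (at t within {t..})"
      by (auto intro: velocity_inE[OF c, of t])
    have "((\<lambda>t. if t < b then c t else c' t) has_vector_derivative v) (at t within {t..})"
      by (rule has_vector_derivative_transform_within[OF v(2), of "b - t"])
        (use True in \<open>auto simp: dist_real_def\<close>)
    with v show ?thesis by blast
  next
    case False
    with t obtain v where v: "v \<in> V t" "(c' has_vector_derivative v) (at t within {t..})"
      by (auto intro: velocity_inE[OF c', of t])
    have "((\<lambda>t. if t < b then c t else c' t) has_vector_derivative v) (at t within {t..})"
      by (rule has_vector_derivative_transform_within[OF v(2), of 1])
        (use False in \<open>auto simp: dist_real_def\<close>)
    with v show ?thesis by blast
  qed
qed

lemma velocity_in_compose: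
  assumes c: "velocity_in V a b c"
    and f: "\<And>t. t \<in> {a..b} \<Longrightarrow> (f has_derivative f' (c t)) (at (c t))"
  shows "velocity_in (\<lambda>t. f' (c t) ` V t) a b (\<lambda>t. f (c t))"
  unfolding velocity_in_def
proof (intro conjI ballI)
  have "continuous_on (c ` {a..b}) f"
    using has_derivative_continuous[OF f] by (intro continuous_at_imp_continuous_on) auto
  then show "continuous_on {a..b} (\<lambda>t. f (c t))"
    by (rule continuous_on_compose2[OF _ velocity_in_continuous_on[OF c]]) simp
  fix t assume t: "t \<in> {a..<b}"
  then obtain v where v: "v \<in> V t" "(c has_vector_derivative v) (at t within {t..})"
    by (rule velocity_inE[OF c])
  have "(f has_derivative f' (c t)) (at (c t) within c ` {t..})"
    by (rule has_derivative_at_withinI[OF f]) (use t in simp)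
  from vector_derivative_diff_chain_within[OF v(2) this] v(1)
  show "\<exists>v\<in>f' (c t) ` V t. ((\<lambda>t. f (c t)) has_vector_derivative v) (at t within {t..})"
    by (auto simp: o_def)
qed

lemma velocity_in_reparametrize:
  assumes c: "velocity_in V a b c"
    and \<theta>: "\<And>t. t \<in> {a'..b'} \<Longrightarrow> \<theta> t \<in> {a..b}" "\<And>t. t \<in> {a'..<b'} \<Longrightarrow> \<theta> t < b" "mono_on {a'..} \<theta>"
      "\<And>t. t \<in> {a'..b'} \<Longrightarrow> (\<theta> has_real_derivative d t) (at t)"
  shows "velocity_in (\<lambda>t. (*\<^sub>R) (d t) ` V (\<theta> t)) a' b' (\<lambda>t. c (\<theta> t))"
  unfolding velocity_in_def
proof (intro conjI ballI)
  have "continuous_on {a'..b'} \<theta>"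
    using \<theta>(4) by (meson DERIV_isCont continuous_at_imp_continuous_on)
  then show "continuous_on {a'..b'} (\<lambda>t. c (\<theta> t))"
    by (rule continuous_on_compose2[OF velocity_in_continuous_on[OF c]]) (use \<theta>(1) in blast)
  fix t assume t: "t \<in> {a'..<b'}"
  then have "\<theta> t \<in> {a..<b}" using \<theta>(1)[of t] \<theta>(2)[of t] by simp
  then obtain v where v: "v \<in> V (\<theta> t)" "(c has_vector_derivative v) (at (\<theta> t) within {\<theta> t..})"
    by (rule velocity_inE[OF c])
  have "\<theta> ` {t..} \<subseteq> {\<theta> t..}" using \<theta>(3) t by (auto intro: mono_onD)
  then have "(c has_vector_derivative v) (at (\<theta> t) within \<theta> ` {t..})"
    by (rule has_vector_derivative_within_subset[OF v(2)])
  moreover have "(\<theta> has_vector_derivative d t) (at t within {t..})"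
    using \<theta>(4)[of t] t
    by (simp add: has_real_derivative_iff_has_vector_derivative has_vector_derivative_at_within)
  ultimately have "(c \<circ> \<theta> has_vector_derivative d t *\<^sub>R v) (at t within {t..})"
    by (intro vector_diff_chain_within)
  with v(1) show "\<exists>v\<in>(*\<^sub>R) (d t) ` V (\<theta> t). ((\<lambda>t. c (\<theta> t)) has_vector_derivative v) (at t within {t..})"
    by (auto simp: o_def)
qed

lemma velocity_in_graph:
  assumes "velocity_in V a b y"
  shows "velocity_in (\<lambda>t. Pair 1 ` V t) a b (\<lambda>t. (t, y t))"
  unfolding velocity_in_def
proof (intro conjI ballI)
  show "continuous_on {a..b} (\<lambda>t. (t, y t))"
    by (intro continuous_intros velocity_in_continuous_on[OF assms])
  fix t assume "t \<in> {a..<b}"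
  then obtain v where v: "v \<in> V t" "(y has_vector_derivative v) (at t within {t..})"
    by (rule velocity_inE[OF assms])
  then show "\<exists>v\<in>Pair 1 ` V t. ((\<lambda>t. (t, y t)) has_vector_derivative v) (at t within {t..})"
    by (intro bexI[of _ "(1, v)"] has_vector_derivative_Pair has_vector_derivative_id) auto
qed

lemma right_difference_quotient_tendsto:
  fixes f :: "real \<Rightarrow> 'b::real_normed_vector"
  assumes "(f has_vector_derivative v) (at t within {t..})"
  shows "((\<lambda>x. (f x - f t) /\<^sub>R (x - t)) \<longlongrightarrow> v) (at_right t)"
proof -
  have "((\<lambda>y. (1 / norm (y - t)) *\<^sub>R (f y - (f t + (y - t) *\<^sub>R v))) \<longlongrightarrow> 0) (at_right t)"
    using assms unfolding has_vector_derivative_def has_derivative_within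
    by (simp add: at_within_Ici_at_right)
  then have "((\<lambda>y. (1 / norm (y - t)) *\<^sub>R (f y - (f t + (y - t) *\<^sub>R v)) + v) \<longlongrightarrow> 0 + v) (at_right t)"
    by (intro tendsto_intros)
  moreover have "\<forall>\<^sub>F y in at_right t. (1 / norm (y - t)) *\<^sub>R (f y - (f t + (y - t) *\<^sub>R v)) + v
      = (f y - f t) /\<^sub>R (y - t)"
    using eventually_at_right_less[of t]
    by eventually_elim (simp add: diff_diff_eq[symmetric] scaleR_diff_right divide_inverse)
  ultimately show ?thesis using tendsto_cong by fastforce
qed

lemma velocity_in_cone_eventually:
  assumes C: "convex_cone C" and c: "velocity_in V a b c" and t: "t \<in> {a..<b}" "V t \<subseteq> interior C"
  shows "\<forall>\<^sub>F t' in at_right t. c t' - c t \<in> C"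
proof -
  obtain v where v: "v \<in> V t" "(c has_vector_derivative v) (at t within {t..})"
    by (rule velocity_inE[OF c t(1)])
  have "\<forall>\<^sub>F t' in at_right t. (c t' - c t) /\<^sub>R (t' - t) \<in> interior C"
    using right_difference_quotient_tendsto[OF v(2)] open_interior
    by (rule topological_tendstoD) (use v t in blast)
  with eventually_at_right_less[of t] show ?thesis
  proof eventually_elim
    case (elim t')
    have "(t' - t) *\<^sub>R ((c t' - c t) /\<^sub>R (t' - t)) \<in> C"
      by (rule convex_cone_scaleR[OF C]) (use elim interior_subset in auto)
    then show ?case using elim by simp
  qed
qed

lemma velocity_in_cone_increment:
  assumes C: "closed C" "convex_cone C" and ab: "a \<le> b"
    and c: "velocity_in V a b c" and V: "\<And>t. t \<in> {a..<b} \<Longrightarrow> V t \<subseteq> interior C"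
  shows "c b - c a \<in> C"
proof -
  define S where "S = {t \<in> {a..b}. c t - c a \<in> C}"
  have "closed S"
    unfolding S_def
    using continuous_closed_preimage[of "{a..b}" "\<lambda>t. c t - c a" C] velocity_in_continuous_on[OF c] C(1)
    by (simp add: continuous_on_diff vimage_def Int_def)
  moreover have "bounded S" unfolding S_def by (rule bounded_subset[of "{a..b}"]) auto
  ultimately have "compact S" by (simp add: compact_eq_bounded_closed)
  moreover have "a \<in> S" using ab C(2) by (simp add: S_def convex_cone_iff)
  ultimately obtain m where m: "m \<in> S" "\<And>t. t \<in> S \<Longrightarrow> t \<le> m"
    using compact_attains_sup[of S] by blast
  have "m = b"
  proof (rule ccontr)
    assume "m \<noteq> b"
    with m have mb: "m \<in> {a..<b}" by (auto simp: S_def)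
    obtain d where d: "d > m" "\<And>t. m < t \<Longrightarrow> t < d \<Longrightarrow> c t - c m \<in> C"
      using velocity_in_cone_eventually[OF C(2) c mb V[OF mb]] by (auto simp: eventually_at_right_field)
    define t where "t = (m + min b d) / 2"
    have t: "m < t" "t < d" "t \<le> b" using mb d by (auto simp: t_def)
    have "(c t - c m) + (c m - c a) \<in> C"
      using m(1) by (intro convex_cone_add[OF C(2)] d t) (simp add: S_def)
    then have "t \<in> S" using t mb by (auto simp: S_def)
    with m(2) t show False by force
  qed
  with m show ?thesis by (simp add: S_def)
qed

lemma velocity_in_positive_mono:
  fixes f :: "real \<Rightarrow> real"
  assumes "a \<le> b" "velocity_in V a b f" "\<And>t. t \<in> {a..<b} \<Longrightarrow> V t \<subseteq> {0<..}"
  shows "f a \<le> f b"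
proof -
  have "f b - f a \<in> {0..}"
    by (rule velocity_in_cone_increment[OF _ _ assms(1,2)])
      (use assms(3) in \<open>auto simp: convex_cone_iff\<close>)
  then show ?thesis by simp
qed

lemma strict_mono_on_if_derivative_pos:
  fixes f :: "real \<Rightarrow> real"
  assumes S: "is_interval S"
    and f: "\<And>s. s \<in> S \<Longrightarrow> (f has_real_derivative f' s) (at s)" "\<And>s. s \<in> S \<Longrightarrow> 0 < f' s"
  shows "strict_mono_on S f"
proof (rule strict_mono_onI)
  fix s t assume st: "s \<in> S" "t \<in> S" "s < t"
  show "f s < f t"
  proof (rule DERIV_pos_imp_increasing[OF st(3)])
    fix x assume "s \<le> x" "x \<le> t"
    then have "x \<in> S" using mem_is_interval_1_I[OF S st(1,2)] by simp
    with f show "\<exists>d. (f has_real_derivative d) (at x) \<and> 0 < d" by blast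
  qed
qed

lemma reparametrize_by_first_component:
  fixes c c' :: "real \<Rightarrow> real \<times> 'b::real_normed_vector"
  assumes S: "open S" "is_interval S"
    and c: "\<And>s. s \<in> S \<Longrightarrow> (c has_vector_derivative c' s) (at s)"
    and pos: "\<And>s. s \<in> S \<Longrightarrow> fst (c' s) > 0"
  obtains y where "strict_mono_on S (\<lambda>s. fst (c s))" "\<And>s. s \<in> S \<Longrightarrow> y (fst (c s)) = snd (c s)"
    "\<And>s. s \<in> S \<Longrightarrow> (y has_vector_derivative snd (c' s) /\<^sub>R fst (c' s)) (at (fst (c s)))"
proof -
  define f where "f s = fst (c s)" for s
  define g where "g = inv_into S f"
  have f: "(f has_real_derivative fst (c' s)) (at s)" if "s \<in> S" for s
    using bounded_linear.has_vector_derivative[OF bounded_linear_fst c[OF that]]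
    unfolding has_real_derivative_iff_has_vector_derivative f_def .
  have mono: "strict_mono_on S f"
    by (rule strict_mono_on_if_derivative_pos[OF S(2) f pos])
  have "inj_on f S" by (rule strict_mono_on_imp_inj_on[OF mono])
  then have gf: "g (f s) = s" if "s \<in> S" for s using that by (simp add: g_def)
  have cont: "continuous_on S f" using f by (meson DERIV_isCont continuous_at_imp_continuous_on)
  have g: "(g has_vector_derivative 1 / fst (c' s)) (at (f s))" if s: "s \<in> S" for s
  proof -
    have "(g has_derivative (\<lambda>x. x / fst (c' s))) (at (f s))"
      by (rule has_derivative_inverse_strong[OF S(1) s cont gf])
        (use f[OF s] pos[OF s] in \<open>auto simp: has_field_derivative_def o_def\<close>)
    then show ?thesis by (simp add: has_vector_derivative_def)
  qed
  show thesis
  proof (rule that[of "\<lambda>t. snd (c (g t))", OF mono[unfolded f_def]])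
    show "snd (c (g (fst (c s)))) = snd (c s)" if "s \<in> S" for s
      using gf[OF that] by (simp add: f_def)
    fix s assume s: "s \<in> S"
    have "((\<lambda>s. snd (c s)) has_vector_derivative snd (c' s)) (at (g (f s)))"
      using bounded_linear.has_vector_derivative[OF bounded_linear_snd c[OF s]] gf[OF s] by simp
    from vector_diff_chain_at[OF g[OF s] this]
    show "((\<lambda>t. snd (c (g t))) has_vector_derivative snd (c' s) /\<^sub>R fst (c' s)) (at (fst (c s)))"
      by (simp add: o_def f_def divide_inverse_commute)
  qed
qed

section \<open>Exit times, deformations and local inverses\<close>

lemma first_exit_time:
  fixes c :: "real \<Rightarrow> 'a::topological_space"
  assumes c: "continuous_on {a..b} c" and V: "open V" "c a \<in> V" "c b \<notin> V" and "a \<le> b"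
  obtains s where "a < s" "s \<le> b" "c s \<notin> V" "\<And>t. a \<le> t \<Longrightarrow> t < s \<Longrightarrow> c t \<in> V"
proof -
  define S where "S = {a..b} \<inter> c -` (- V)"
  have "closed S" unfolding S_def
    by (rule continuous_closed_preimage[OF c]) (use V in auto)
  moreover have "bounded S" unfolding S_def by (rule bounded_subset[of "{a..b}"]) auto
  ultimately have "compact S" by (simp add: compact_eq_bounded_closed)
  moreover have "b \<in> S" using assms by (simp add: S_def)
  ultimately obtain s where s: "s \<in> S" "\<And>t. t \<in> S \<Longrightarrow> s \<le> t"
    using compact_attains_inf[of S] by blast
  show thesis
  proof (rule that[of s])
    have "s \<noteq> a" using s(1) V by (auto simp: S_def)
    then show "a < s" "s \<le> b" "c s \<notin> V" using s(1) by (auto simp: S_def)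
    show "c t \<in> V" if "a \<le> t" "t < s" for t using s(2)[of t] s(1) that by (fastforce simp: S_def)
  qed
qed

lemma open_Collect_Ball_compact:
  fixes H :: "'a::topological_space \<Rightarrow> 'b::topological_space \<Rightarrow> 'c::topological_space"
  assumes C: "compact C" and V: "open V" and H: "continuous_on (UNIV \<times> C) (\<lambda>(x, s). H x s)"
  shows "open {x. \<forall>s\<in>C. H x s \<in> V}"
  unfolding open_subopen[of "{x. \<forall>s\<in>C. H x s \<in> V}"]
proof
  fix x assume x: "x \<in> {x. \<forall>s\<in>C. H x s \<in> V}"
  obtain U where U: "open U" "U \<inter> UNIV \<times> C = (\<lambda>(x, s). H x s) -` V \<inter> UNIV \<times> C"
    using H V unfolding continuous_on_open_invariant by metis
  with x have "{x} \<times> C \<subseteq> U" by auto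
  from Elementary_Topology.tube_lemma[OF C U(1) this] obtain Y where Y: "x \<in> Y" "open Y" "Y \<times> C \<subseteq> U"
    by blast
  then have "Y \<times> C \<subseteq> (\<lambda>(x, s). H x s) -` V" using U(2) by blast
  then have "Y \<subseteq> {x. \<forall>s\<in>C. H x s \<in> V}" by auto
  with Y show "\<exists>T. open T \<and> x \<in> T \<and> T \<subseteq> {x. \<forall>s\<in>C. H x s \<in> V}" by blast
qed

lemma homotopy_remains_in_open:
  fixes H :: "real \<Rightarrow> 'b::topological_space \<Rightarrow> 'c::topological_space"
  assumes C: "compact C" and V: "open V" and H: "continuous_on (UNIV \<times> C) (\<lambda>(r, s). H r s)"
    and start: "\<And>s. s \<in> C \<Longrightarrow> H 0 s \<in> V"
    and limit: "\<And>X r s. (\<And>n::nat. X n \<in> {0..1}) \<Longrightarrow> (\<And>n s. s \<in> C \<Longrightarrow> H (X n) s \<in> V) \<Longrightarrow>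
        X \<longlonglongrightarrow> r \<Longrightarrow> r \<in> {0..1} \<Longrightarrow> s \<in> C \<Longrightarrow> H r s \<in> V"
    and s: "s \<in> C"
  shows "H 1 s \<in> V"
proof -
  define S where "S = {0..1} \<inter> {r. \<forall>s\<in>C. H r s \<in> V}"
  have "closed S" unfolding closed_sequential_limits
  proof (intro allI impI, elim conjE)
    fix X r assume X: "\<forall>n. X n \<in> S" and lim: "X \<longlonglongrightarrow> r"
    have r: "r \<in> {0..1}"
      by (rule closed_sequentially[OF closed_atLeastAtMost _ lim]) (use X in \<open>auto simp: S_def\<close>)
    moreover have "H r s \<in> V" if "s \<in> C" for s
      by (rule limit[OF _ _ lim r that]) (use X in \<open>auto simp: S_def\<close>)
    ultimately show "r \<in> S" by (simp add: S_def)
  qed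
  then have "closedin (top_of_set {0..1}) S" by (simp add: closed_subset S_def)
  moreover have "openin (top_of_set {0..1}) S"
    unfolding S_def by (rule openin_open_Int[OF open_Collect_Ball_compact[OF C V H]])
  ultimately have "S = {} \<or> S = {0..1}"
    using connected_clopen[of "{0..1::real}"] by (meson connected_Icc)
  moreover have "0 \<in> S" using start by (simp add: S_def)
  ultimately have "1 \<in> S" by force
  then show ?thesis using s by (simp add: S_def)
qed

lemma inv_into_has_derivative:
  fixes f :: "'a::euclidean_space \<Rightarrow> 'a"
  assumes S: "open S" "inj_on f S" and f: "\<And>x. x \<in> S \<Longrightarrow> (f has_derivative f' x) (at x)"
    and x: "x \<in> S" "inj (f' x)"
  shows "(inv_into S f has_derivative inv (f' x)) (at (f x))"
proof (rule has_derivative_inverse_strong[OF S(1) x(1)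
    has_derivative_continuous_on[OF has_derivative_at_withinI[OF f]] _ f[OF x(1)]])
  have "surj (f' x)"
    by (rule linear_inj_imp_surj[OF has_derivative_linear[OF f[OF x(1)]] x(2)])
  then show "f' x \<circ> inv (f' x) = id" by (simp add: surj_iff)
qed (use S in simp_all)

section \<open>Kasner geometry\<close>

definition spatial_norm :: "('n::finite \<Rightarrow> real) \<Rightarrow> real \<Rightarrow> real ^ 'n \<Rightarrow> real" where
  "spatial_norm p t v = norm (\<chi> i. t powr p i * v $ i)"

lemma kasner_g_diag: "kasner_g p z a a = (spatial_norm p (fst z) (snd a))\<^sup>2 - (fst a)\<^sup>2"
proof -
  have "fst z powr (2 * p i) = (fst z powr p i)\<^sup>2" for i
    by (simp add: power2_eq_square flip: powr_add)
  then have "(spatial_norm p (fst z) (snd a))\<^sup>2 = (\<Sum>i\<in>UNIV. fst z powr (2 * p i) * (snd a $ i)\<^sup>2)"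
    by (simp add: spatial_norm_def norm_vec_def L2_set_def sum_nonneg power_mult_distrib)
  then show ?thesis by (simp add: kasner_g_def power2_eq_square mult.assoc)
qed

lemma spatial_norm_nonneg [simp]: "0 \<le> spatial_norm p t v"
  by (simp add: spatial_norm_def)

lemma spatial_norm_zero [simp]: "spatial_norm p t 0 = 0"
  by (simp add: spatial_norm_def vec_eq_iff)

lemma spatial_norm_add: "spatial_norm p t (u + v) \<le> spatial_norm p t u + spatial_norm p t v"
proof -
  have "(\<chi> i. t powr p i * (u + v) $ i) = (\<chi> i. t powr p i * u $ i) + (\<chi> i. t powr p i * v $ i)"
    by (simp add: vec_eq_iff distrib_left)
  then show ?thesis by (simp add: spatial_norm_def norm_triangle_ineq)
qed

lemma spatial_norm_scaleR: "spatial_norm p t (c *\<^sub>R v) = \<bar>c\<bar> * spatial_norm p t v"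
proof -
  have "(\<chi> i. t powr p i * (c *\<^sub>R v) $ i) = c *\<^sub>R (\<chi> i. t powr p i * v $ i)"
    by (simp add: vec_eq_iff)
  then show ?thesis by (simp add: spatial_norm_def)
qed

lemma component_le_spatial_norm: "t powr p i * \<bar>v $ i\<bar> \<le> spatial_norm p t v"
  using component_le_norm_cart[of "\<chi> i. t powr p i * v $ i" i]
  by (simp add: spatial_norm_def abs_mult)

lemma spatial_norm_mono:
  "(\<And>i. t powr p i * \<bar>v $ i\<bar> \<le> t' powr p i * \<bar>v' $ i\<bar>) \<Longrightarrow> spatial_norm p t v \<le> spatial_norm p t' v'"
  unfolding spatial_norm_def by (rule norm_le_componentwise_cart) (simp add: abs_mult)

definition future_cone :: "('n::finite \<Rightarrow> real) \<Rightarrow> real \<Rightarrow> 'n spt set" where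
  "future_cone p t = {a. spatial_norm p t (snd a) < fst a}"

lemma future_cone_fst_pos: "a \<in> future_cone p t \<Longrightarrow> 0 < fst a"
  by (simp add: future_cone_def order_le_less_trans[OF spatial_norm_nonneg])

lemma kasner_g_neg_iff: "kasner_g p z a a < 0 \<longleftrightarrow> a \<in> future_cone p (fst z) \<or> - a \<in> future_cone p (fst z)"
proof -
  have "kasner_g p z a a < 0 \<longleftrightarrow> \<not> \<bar>fst a\<bar> \<le> \<bar>spatial_norm p (fst z) (snd a)\<bar>"
    unfolding abs_le_square_iff by (simp add: kasner_g_diag not_le)
  then show ?thesis
    using spatial_norm_scaleR[of p "fst z" "-1" "snd a"] by (auto simp: future_cone_def)
qed

lemma future_cone_add: "a \<in> future_cone p t \<Longrightarrow> b \<in> future_cone p t \<Longrightarrow> a + b \<in> future_cone p t"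
  using spatial_norm_add[of p t "snd a" "snd b"] by (simp add: future_cone_def)

lemma future_cone_scaleR: "0 < c \<Longrightarrow> a \<in> future_cone p t \<Longrightarrow> c *\<^sub>R a \<in> future_cone p t"
  by (simp add: future_cone_def spatial_norm_scaleR)

definition subluminal :: "('n::finite \<Rightarrow> real) \<Rightarrow> real \<Rightarrow> (real ^ 'n) set" where
  "subluminal p t = {v. spatial_norm p t v < 1}"

lemma zero_mem_subluminal [simp]: "0 \<in> subluminal p t"
  by (simp add: subluminal_def)

lemma Pair_1_mem_future_cone [simp]: "(1, v) \<in> future_cone p t \<longleftrightarrow> v \<in> subluminal p t"
  by (simp add: future_cone_def subluminal_def)

lemma future_cone_direction_subluminal:
  assumes "a \<in> future_cone p t"
  shows "snd a /\<^sub>R fst a \<in> subluminal p t"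
proof -
  have "0 < fst a" by (rule future_cone_fst_pos[OF assms])
  then have "(1 / fst a) *\<^sub>R a \<in> future_cone p t" by (intro future_cone_scaleR assms) simp
  moreover have "(1 / fst a) *\<^sub>R a = (1, snd a /\<^sub>R fst a)"
    using \<open>0 < fst a\<close> by (simp add: prod_eq_iff divide_inverse)
  ultimately show ?thesis by (simp del: scaleR_Pair)
qed

lemma convex_subluminal: "convex (subluminal p t)"
  unfolding convex_alt
proof (intro ballI allI impI)
  fix u v r assume uv: "u \<in> subluminal p t" "v \<in> subluminal p t" and r: "0 \<le> r \<and> r \<le> (1::real)"
  have "spatial_norm p t ((1 - r) *\<^sub>R u + r *\<^sub>R v)
      \<le> (1 - r) * spatial_norm p t u + r * spatial_norm p t v"
    using spatial_norm_add[of p t "(1 - r) *\<^sub>R u" "r *\<^sub>R v"] r by (simp add: spatial_norm_scaleR)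
  also have "\<dots> < 1"
    by (rule convex_bound_lt) (use uv r in \<open>auto simp: subluminal_def\<close>)
  finally show "(1 - r) *\<^sub>R u + r *\<^sub>R v \<in> subluminal p t" by (simp add: subluminal_def)
qed

lemma mem_kasner_M_iff: "z \<in> kasner_M \<longleftrightarrow> 0 < fst z"
  by (simp add: kasner_M_def)

lemma open_kasner_M: "open (kasner_M :: 'n::finite spt set)"
  unfolding kasner_M_def by (intro open_Collect_less continuous_intros)

lemma kasner_exponent_abs_less_1:
  fixes p :: "'n::finite \<Rightarrow> real"
  assumes sum: "(\<Sum>i\<in>UNIV. p i) = 1" and sum_sq: "(\<Sum>i\<in>UNIV. (p i)\<^sup>2) = 1" and neg: "p j < 0"
  shows "\<bar>p i\<bar> < 1"
proof (rule ccontr)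
  assume "\<not> \<bar>p i\<bar> < 1"
  then have "1 \<le> (p i)\<^sup>2" by (simp add: abs_square_less_1 flip: linorder_not_less)
  moreover have "(\<Sum>k\<in>UNIV. (p k)\<^sup>2) = (p i)\<^sup>2 + (\<Sum>k\<in>UNIV - {i}. (p k)\<^sup>2)" by (simp add: sum.remove)
  ultimately have "(\<Sum>k\<in>UNIV - {i}. (p k)\<^sup>2) = 0"
    using sum_sq sum_nonneg[of "UNIV - {i}" "\<lambda>k. (p k)\<^sup>2"] by simp
  then have zero: "p k = 0" if "k \<noteq> i" for k
    using that by (subst (asm) sum_nonneg_eq_0_iff) auto
  have "(\<Sum>k\<in>UNIV. p k) = p i + (\<Sum>k\<in>UNIV - {i}. p k)" by (simp add: sum.remove)
  also have "(\<Sum>k\<in>UNIV - {i}. p k) = 0" by (rule sum.neutral) (use zero in auto)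
  finally have "p i = 1" using sum by simp
  then show False using neg zero[of j] by (cases "j = i") auto
qed

text \<open>Since all exponents are below one, \<open>t powr (- p i)\<close> has the primitive
  \<open>t powr (1 - p i) / (1 - p i)\<close>, which bounds the coordinate displacement along causal curves.\<close>
definition causal_bound :: "('n::finite \<Rightarrow> real) \<Rightarrow> 'n spt \<Rightarrow> 'n spt \<Rightarrow> bool" where
  "causal_bound p z z' \<longleftrightarrow> fst z \<le> fst z' \<and>
     (\<forall>i. \<bar>snd z' $ i - snd z $ i\<bar> \<le> (fst z' powr (1 - p i) - fst z powr (1 - p i)) / (1 - p i))"

lemma light_coordinate_has_derivative:
  fixes z :: "'n::finite spt"
  assumes "0 < fst z" "q \<noteq> 0"
  shows "((\<lambda>z. fst z powr q / q + e * snd z $ i) has_derivative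
      (\<lambda>a. fst z powr (q - 1) * fst a + e * snd a $ i)) (at z)"
proof -
  have "((\<lambda>t. t powr q / q) has_real_derivative fst z powr (q - 1)) (at (fst z))"
    using DERIV_cdivide[OF has_real_derivative_powr[OF assms(1), of q], of q] assms(2) by simp
  from DERIV_compose_FDERIV[OF this bounded_linear_imp_has_derivative[OF bounded_linear_fst]]
  have "((\<lambda>z. fst z powr q / q) has_derivative (\<lambda>a. fst z powr (q - 1) * fst a)) (at z)"
    by (simp add: mult.commute)
  moreover have "((\<lambda>z. e * snd z $ i) has_derivative (\<lambda>a. e * snd a $ i)) (at z)"
    by (intro has_derivative_mult_right bounded_linear_imp_has_derivative
        bounded_linear_compose[OF bounded_linear_vec_nth bounded_linear_snd])
  ultimately show ?thesis by (rule has_derivative_add)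
qed

lemma causal_bound_along_curve:
  fixes c :: "real \<Rightarrow> 'n::finite spt"
  assumes p: "\<And>i. p i < 1" and ab: "a \<le> b"
    and c: "velocity_in (\<lambda>t. future_cone p (fst (c t))) a b c"
    and pos: "\<And>t. t \<in> {a..b} \<Longrightarrow> 0 < fst (c t)"
  shows "causal_bound p (c a) (c b)"
  unfolding causal_bound_def
proof (intro conjI allI)
  have "velocity_in (\<lambda>t. fst ` future_cone p (fst (c t))) a b (\<lambda>t. fst (c t))"
    by (rule velocity_in_compose[OF c]) (intro bounded_linear_imp_has_derivative bounded_linear_fst)
  then show "fst (c a) \<le> fst (c b)"
    by (rule velocity_in_positive_mono[OF ab]) (auto dest: future_cone_fst_pos)
  fix i
  define q where "q = 1 - p i"
  have q: "0 < q" using p[of i] by (simp add: q_def)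
  have mono: "fst (c a) powr q / q + e * snd (c a) $ i \<le> fst (c b) powr q / q + e * snd (c b) $ i"
    if e: "\<bar>e\<bar> = 1" for e
  proof -
    have "velocity_in (\<lambda>t. (\<lambda>v. fst (c t) powr (q - 1) * fst v + e * snd v $ i)
        ` future_cone p (fst (c t))) a b
        (\<lambda>t. fst (c t) powr q / q + e * snd (c t) $ i)"
      by (rule velocity_in_compose[OF c light_coordinate_has_derivative]) (use pos q in auto)
    then show ?thesis
    proof (rule velocity_in_positive_mono[OF ab], intro image_subsetI)
      fix t v assume t: "t \<in> {a..<b}" and v: "v \<in> future_cone p (fst (c t))"
      have ct: "0 < fst (c t)" using pos t by simp
      have "fst (c t) powr p i * \<bar>snd v $ i\<bar> < fst v"
        using component_le_spatial_norm[of "fst (c t)" p i "snd v"] v by (simp add: future_cone_def)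
      then have "\<bar>snd v $ i\<bar> < fst (c t) powr (q - 1) * fst v"
        using ct by (simp add: q_def powr_minus field_simps)
      then show "fst (c t) powr (q - 1) * fst v + e * snd v $ i \<in> {0<..}"
        using e by (cases "e = 1") (auto simp: abs_if split: if_splits)
    qed
  qed
  from mono[of 1] mono[of "-1"]
  show "\<bar>snd (c b) $ i - snd (c a) $ i\<bar>
      \<le> (fst (c b) powr (1 - p i) - fst (c a) powr (1 - p i)) / (1 - p i)"
    by (simp add: q_def diff_divide_distrib)
qed

lemma causal_bound_along_graph:
  assumes p: "\<And>i. p i < 1" and y: "velocity_in (subluminal p) a b y" and ab: "0 < a" "a \<le> b"
  shows "causal_bound p (a, y a) (b, y b)"
proof -
  have "velocity_in (\<lambda>t. future_cone p (fst (t, y t))) a b (\<lambda>t. (t, y t))"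
    by (rule velocity_in_mono[OF velocity_in_graph[OF y]]) auto
  from causal_bound_along_curve[OF p ab(2) this] show ?thesis using ab by simp
qed

definition spatial_radius :: "('n::finite \<Rightarrow> real) \<Rightarrow> real \<Rightarrow> real" where
  "spatial_radius p t = (\<Sum>i\<in>UNIV. t powr (1 - p i) / (1 - p i))"

lemma spatial_radius_tendsto_0:
  assumes "\<And>i. p i < 1"
  shows "(spatial_radius p \<longlongrightarrow> 0) (at_right 0)"
proof -
  have "(spatial_radius p \<longlongrightarrow> (\<Sum>i\<in>UNIV. 0 powr (1 - p i) / (1 - p i))) (at_right 0)"
    unfolding spatial_radius_def using assms
    by (intro tendsto_intros tendsto_powr')
      (auto simp: eventually_at_right_less less_imp_le eventually_at_filter less_le)
  then show ?thesis by simp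
qed

lemma causal_bound_dist_le:
  assumes p: "\<And>i. p i < 1" and z: "causal_bound p z z'" "0 < fst z" "fst z' \<le> T"
  shows "dist (snd z) (snd z') \<le> spatial_radius p T"
proof -
  have "dist (snd z) (snd z') \<le> (\<Sum>i\<in>UNIV. \<bar>(snd z' - snd z) $ i\<bar>)"
    using norm_le_l1_cart[of "snd z' - snd z"] by (simp add: dist_norm norm_minus_commute)
  also have "\<dots> \<le> spatial_radius p T"
    unfolding spatial_radius_def
  proof (rule sum_mono)
    fix i
    have q: "0 < 1 - p i" using p[of i] by simp
    have "\<bar>(snd z' - snd z) $ i\<bar> \<le> (fst z' powr (1 - p i) - fst z powr (1 - p i)) / (1 - p i)"
      using z by (simp add: causal_bound_def)
    also have "\<dots> \<le> T powr (1 - p i) / (1 - p i)"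
    proof (rule divide_right_mono)
      have "fst z' powr (1 - p i) \<le> T powr (1 - p i)"
        by (rule powr_mono2) (use q z in \<open>auto simp: causal_bound_def\<close>)
      then show "fst z' powr (1 - p i) - fst z powr (1 - p i) \<le> T powr (1 - p i)"
        using powr_ge_zero[of "fst z" "1 - p i"] by linarith
    qed (use q in simp)
    finally show "\<bar>(snd z' - snd z) $ i\<bar> \<le> T powr (1 - p i) / (1 - p i)" .
  qed
  finally show ?thesis .
qed

definition future_box :: "('n::finite \<Rightarrow> real) \<Rightarrow> 'n spt \<Rightarrow> real \<Rightarrow> 'n spt set" where
  "future_box p z T = {fst z..T} \<times> cball (snd z) (spatial_radius p T)"

lemma compact_future_box: "compact (future_box p z T)"
  by (auto simp: future_box_def intro: compact_Times)

lemma future_box_subset_kasner_M: "0 < fst z \<Longrightarrow> future_box p z T \<subseteq> kasner_M"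
  by (auto simp: future_box_def mem_kasner_M_iff)

lemma causal_bound_imp_mem_future_box:
  assumes "\<And>i. p i < 1" "causal_bound p z z'" "0 < fst z" "fst z' \<le> T"
  shows "z' \<in> future_box p z T"
  using causal_bound_dist_le[OF assms] assms
  by (auto simp: future_box_def mem_Times_iff causal_bound_def)

lemma waiting_translated_graph:
  assumes p: "\<And>i. p i < 1" and c: "velocity_in (subluminal p) m T c" and t: "0 < m" "m \<le> t" "t < T"
  obtains k where "velocity_in (subluminal p) m T k" "k m = c m" "k t = c m"
    "dist (c T) (k T) \<le> spatial_radius p t"
proof -
  define d where "d = c t - c m"
  define k where "k = (\<lambda>s. if s < t then c m else c s - d)"
  show thesis
  proof (rule that[of k])
    show "velocity_in (subluminal p) m T k" unfolding k_def
      by (intro velocity_in_join velocity_in_const velocity_in_diff_const velocity_in_subinterval[OF c])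
        (use t in \<open>auto simp: d_def\<close>)
    show "k m = c m" "k t = c m" using t by (auto simp: k_def d_def)
    have "causal_bound p (m, c m) (t, c t)"
      by (rule causal_bound_along_graph[OF p velocity_in_subinterval[OF c] t(1,2)]) (use t in auto)
    from causal_bound_dist_le[OF p this, of t] have "dist (c m) (c t) \<le> spatial_radius p t"
      using t by simp
    then show "dist (c T) (k T) \<le> spatial_radius p t"
      using t by (simp add: k_def d_def dist_norm norm_minus_commute)
  qed
qed

section \<open>Delayed curves\<close>

definition slack :: "real \<Rightarrow> real \<Rightarrow> real \<Rightarrow> real \<Rightarrow> real" where
  "slack m a b c = (b powr (1 + m) - a powr (1 + m)) / (c powr (1 + m) - a powr (1 + m))"

lemma slack_bounds:
  assumes "0 < a" "a < b" "b < c" "0 \<le> m"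
  shows "0 < slack m a b c" "slack m a b c < 1"
    "(b powr (1 + m) - a powr (1 + m)) / c powr (1 + m) \<le> slack m a b c"
proof -
  have "0 < a powr (1 + m)" "a powr (1 + m) < b powr (1 + m)" "b powr (1 + m) < c powr (1 + m)"
    using assms by (auto intro: powr_less_mono2)
  moreover from this have "0 < c powr (1 + m)" by linarith
  ultimately show "0 < slack m a b c" "slack m a b c < 1"
    "(b powr (1 + m) - a powr (1 + m)) / c powr (1 + m) \<le> slack m a b c"
    by (simp_all add: slack_def divide_left_mono)
qed

text \<open>In the time variable \<open>t powr (1 + m)\<close> the reparametrization is affine with slope \<open>1 - e\<close> and
  fixes \<open>c\<close>.\<close>
definition delay :: "real \<Rightarrow> real \<Rightarrow> real \<Rightarrow> real \<Rightarrow> real" where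
  "delay m e c t = ((1 - e) * t powr (1 + m) + e * c powr (1 + m)) powr (1 / (1 + m))"

lemma delay_slack:
  assumes "0 < a" "a < b" "b < c" "0 \<le> m"
  shows "delay m (slack m a b c) c a = b"
proof -
  define e where "e = slack m a b c"
  have "e * (c powr (1 + m) - a powr (1 + m)) = b powr (1 + m) - a powr (1 + m)"
    using powr_less_mono2[of "1 + m" a c] assms by (simp add: e_def slack_def)
  then have "(1 - e) * a powr (1 + m) + e * c powr (1 + m) = b powr (1 + m)"
    by (simp add: algebra_simps)
  then show ?thesis using assms by (simp add: delay_def e_def powr_powr)
qed

lemma delay_fixed: "0 < c \<Longrightarrow> 0 \<le> m \<Longrightarrow> delay m e c c = c"
  by (simp add: delay_def powr_powr flip: distrib_right)

lemma delay_less: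
  assumes "0 < s" "s < t" "0 < c" "0 \<le> m" "0 < e" "e < 1"
  shows "delay m e c s < delay m e c t"
  unfolding delay_def
proof (rule powr_less_mono2)
  show "(1 - e) * s powr (1 + m) + e * c powr (1 + m) < (1 - e) * t powr (1 + m) + e * c powr (1 + m)"
    using assms by (simp add: powr_less_mono2)
qed (use assms in auto)

lemma delay_mono:
  assumes "0 < s" "s \<le> t" "0 < c" "0 \<le> m" "0 < e" "e < 1"
  shows "delay m e c s \<le> delay m e c t"
  using delay_less[of s t c m e] assms by (cases "s = t") auto

lemma delay_ge:
  assumes "0 < t" "t \<le> c" "0 \<le> m" "0 < e"
  shows "t \<le> delay m e c t"
proof -
  have "e * t powr (1 + m) \<le> e * c powr (1 + m)" using assms by (auto intro!: mult_left_mono powr_mono2)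
  then have "t powr (1 + m) \<le> (1 - e) * t powr (1 + m) + e * c powr (1 + m)"
    by (simp add: algebra_simps)
  then have "(t powr (1 + m)) powr (1 / (1 + m)) \<le> delay m e c t"
    unfolding delay_def by (intro powr_mono2) (use assms in auto)
  then show ?thesis using assms by (simp add: powr_powr)
qed

lemma delay_has_derivative:
  assumes t: "0 < t" "0 < c" and m: "0 \<le> m" and e: "0 < e" "e < 1"
  shows "(delay m e c has_real_derivative (1 - e) * (t powr m * delay m e c t powr (- m))) (at t)"
proof -
  define M where "M = 1 + m"
  define \<beta> where "\<beta> t = (1 - e) * t powr M + e * c powr M" for t
  have M: "0 < M" using m by (simp add: M_def)
  have \<beta>: "0 < \<beta> t" using t e by (simp add: \<beta>_def add_pos_pos)
  have "(\<beta> has_real_derivative (1 - e) * (M * t powr (M - 1))) (at t)"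
    unfolding \<beta>_def using t by (auto intro!: derivative_eq_intros simp: powr_diff)
  from DERIV_chain2[OF has_real_derivative_powr[OF \<beta>, of "1 / M"] this]
  have "(delay m e c
      has_real_derivative 1 / M * \<beta> t powr (1 / M - 1) * ((1 - e) * (M * t powr (M - 1)))) (at t)"
    unfolding delay_def \<beta>_def M_def .
  moreover have "1 / M - 1 = 1 / M * (- m)" using M by (simp add: M_def field_simps)
  then have "\<beta> t powr (1 / M - 1) = delay m e c t powr (- m)"
    by (simp add: delay_def \<beta>_def M_def powr_powr)
  ultimately show ?thesis using M by (simp add: M_def mult_ac)
qed

lemma spatial_norm_rescale_le:
  assumes "0 < t" "t \<le> s" and m: "\<And>i. - p i \<le> m"
  shows "spatial_norm p t ((t powr m * s powr (- m)) *\<^sub>R v) \<le> spatial_norm p s v"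
proof (rule spatial_norm_mono)
  fix i
  have "t powr (p i + m) * s powr (- m) \<le> s powr (p i + m) * s powr (- m)"
    by (intro mult_right_mono powr_mono2) (use assms(1,2) m[of i] in auto)
  also have "\<dots> = s powr p i" by (simp flip: powr_add)
  finally have "(t powr p i * (t powr m * s powr (- m))) * \<bar>v $ i\<bar> \<le> s powr p i * \<bar>v $ i\<bar>"
    by (intro mult_right_mono) (simp_all add: powr_add mult_ac)
  then show "t powr p i * \<bar>((t powr m * s powr (- m)) *\<^sub>R v) $ i\<bar> \<le> s powr p i * \<bar>v $ i\<bar>"
    by (simp add: abs_mult mult_ac)
qed

lemma delayed_graph_slow:
  fixes y :: "real \<Rightarrow> real ^ 'n::finite"
  assumes t: "0 < a" "a < b" "b < c" and m: "0 \<le> m" "\<And>i. - p i \<le> m"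
    and y: "velocity_in (subluminal p) b c y"
  defines "e \<equiv> slack m a b c"
  shows "velocity_in (\<lambda>t. {v. spatial_norm p t v \<le> 1 - e}) a c (\<lambda>t. y (delay m e c t))"
proof -
  have e: "0 < e" "e < 1" using slack_bounds[OF t m(1)] by (simp_all add: e_def)
  have ends: "delay m e c a = b" "delay m e c c = c"
    using delay_slack[OF t m(1)] delay_fixed[of c m] t m by (simp_all add: e_def)
  have "velocity_in (\<lambda>s. (*\<^sub>R) ((1 - e) * (s powr m * delay m e c s powr (- m)))
      ` subluminal p (delay m e c s))
      a c (\<lambda>s. y (delay m e c s))"
  proof (rule velocity_in_reparametrize[OF y])
    show "delay m e c s \<in> {b..c}" if "s \<in> {a..c}" for s
      using delay_mono[of a s c m e] delay_mono[of s c c m e] that t m e by (simp add: ends)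
    show "delay m e c s < c" if "s \<in> {a..<c}" for s
      using delay_less[of s c c m e] that t m e by (simp add: ends)
    show "mono_on {a..} (delay m e c)"
      using t m e by (intro mono_onI delay_mono) auto
    show "(delay m e c has_real_derivative (1 - e) * (s powr m * delay m e c s powr (- m))) (at s)"
      if "s \<in> {a..c}" for s
      using that t m e by (intro delay_has_derivative) auto
  qed
  then show ?thesis
  proof (rule velocity_in_mono, intro image_subsetI CollectI)
    fix s v assume s: "s \<in> {a..<c}" and v: "v \<in> subluminal p (delay m e c s)"
    define r where "r = s powr m * delay m e c s powr (- m)"
    have "spatial_norm p s (((1 - e) * r) *\<^sub>R v) = (1 - e) * spatial_norm p s (r *\<^sub>R v)"
      using e by (simp add: spatial_norm_scaleR abs_mult)
    also have "\<dots> \<le> (1 - e) * spatial_norm p (delay m e c s) v"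
      unfolding r_def using s t e m by (intro mult_left_mono spatial_norm_rescale_le delay_ge) auto
    also have "\<dots> \<le> (1 - e) * 1"
      using v e by (intro mult_left_mono) (auto simp: subluminal_def)
    finally show "spatial_norm p s (((1 - e) * (s powr m * delay m e c s powr (- m))) *\<^sub>R v) \<le> 1 - e"
      by (simp add: r_def)
  qed
qed

section \<open>Splittings into height and horizontal part\<close>

locale vertical_splitting =
  fixes height :: "'v::euclidean_space \<Rightarrow> real" and w :: 'v
  assumes bounded_linear_height: "bounded_linear height" and height_w [simp]: "height w = 1"
begin

sublocale height: bounded_linear height
  by (rule bounded_linear_height)

definition hor :: "'v \<Rightarrow> 'v" where
  "hor v = v - height v *\<^sub>R w"

lemma bounded_linear_hor: "bounded_linear hor"
  unfolding hor_def
  by (intro bounded_linear_sub bounded_linear_ident bounded_linear_scaleR_const bounded_linear_height)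

sublocale hor: bounded_linear hor
  by (rule bounded_linear_hor)

lemma hor_w [simp]: "hor w = 0"
  by (simp add: hor_def)

lemma height_hor [simp]: "height (hor v) = 0"
  by (simp add: hor_def height.diff height.scaleR)

lemma hor_eq: "height v = 0 \<Longrightarrow> hor v = v"
  by (simp add: hor_def)

lemma hor_hor [simp]: "hor (hor v) = hor v"
  by (simp add: hor_eq)

lemma hor_add_height: "hor v + height v *\<^sub>R w = v"
  by (simp add: hor_def)

lemma splitting_eqI: "hor x = hor y \<Longrightarrow> height x = height y \<Longrightarrow> x = y"
  by (metis hor_add_height)

lemmas splitting_simps =
  height.add height.diff height.scaleR height.zero height.neg hor.add hor.diff hor.scaleR hor.zero
      hor.neg

lemma continuous_on_height [continuous_intros]: "continuous_on S f \<Longrightarrow> continuous_on S (\<lambda>x. height (f x))"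
  by (rule height.continuous_on)

lemma continuous_on_hor [continuous_intros]: "continuous_on S f \<Longrightarrow> continuous_on S (\<lambda>x. hor (f x))"
  by (rule hor.continuous_on)

lemma norm_le_height_hor: "norm x \<le> \<bar>height x\<bar> * norm w + norm (hor x)"
  using norm_triangle_ineq[of "hor x" "height x *\<^sub>R w"] by (simp add: hor_add_height)

definition cone :: "real \<Rightarrow> 'v set" where
  "cone k = {v. norm (hor v) \<le> k * height v}"

lemma closed_cone: "closed (cone k)"
  unfolding cone_def by (intro closed_Collect_le continuous_intros)

lemma convex_cone_cone: "convex_cone (cone k)"
  unfolding convex_cone_iff
proof (intro conjI ballI allI impI)
  fix x y c assume x: "x \<in> cone k"
  show "x + y \<in> cone k" if "y \<in> cone k"
    using x that norm_triangle_ineq[of "hor x" "hor y"]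
    by (simp add: cone_def splitting_simps distrib_left)
  show "c *\<^sub>R x \<in> cone k" if "0 \<le> c"
    using x mult_left_mono[OF _ that, of "norm (hor x)" "k * height x"] that
    by (simp add: cone_def splitting_simps mult_ac)
qed (simp add: cone_def splitting_simps)

lemma mem_interior_cone:
  assumes "norm (hor v) < k * height v"
  shows "v \<in> interior (cone k)"
proof (rule interiorI)
  show "open {v. norm (hor v) < k * height v}" by (intro open_Collect_less continuous_intros)
qed (use assms in \<open>auto simp: cone_def\<close>)

lemma cone_height_nonneg: "0 < k \<Longrightarrow> v \<in> cone k \<Longrightarrow> 0 \<le> height v"
  using order_trans[OF norm_ge_zero, of "hor v" "k * height v"] by (simp add: cone_def zero_le_mult_iff)

definition cylinder :: "real \<Rightarrow> 'v set" where
  "cylinder r = {x. \<bar>height x\<bar> < r \<and> norm (hor x) < r}"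

lemma open_cylinder: "open (cylinder r)"
  unfolding cylinder_def by (intro open_Collect_conj open_Collect_less continuous_intros)

lemma cylinder_subset_ball: "cylinder r \<subseteq> ball 0 (r * (norm w + 1))"
proof
  fix x assume x: "x \<in> cylinder r"
  have "\<bar>height x\<bar> * norm w \<le> r * norm w"
    using x by (intro mult_right_mono) (auto simp: cylinder_def)
  then have "norm x < r * (norm w + 1)"
    using norm_le_height_hor[of x] x by (simp add: cylinder_def distrib_left)
  then show "x \<in> ball 0 (r * (norm w + 1))" by simp
qed

definition slab :: "real \<Rightarrow> real \<Rightarrow> real \<Rightarrow> 'v set" where
  "slab a b r = {x. a \<le> height x \<and> height x \<le> b \<and> norm (hor x) \<le> r}"

lemma compact_slab: "compact (slab a b r)"
  unfolding compact_eq_bounded_closed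
proof
  show "closed (slab a b r)"
    unfolding slab_def by (intro closed_Collect_conj closed_Collect_le continuous_intros)
  show "bounded (slab a b r)"
  proof (rule boundedI)
    fix x assume x: "x \<in> slab a b r"
    have "\<bar>height x\<bar> * norm w \<le> (\<bar>a\<bar> + \<bar>b\<bar>) * norm w"
      using x by (intro mult_right_mono) (auto simp: slab_def)
    then show "norm x \<le> (\<bar>a\<bar> + \<bar>b\<bar>) * norm w + r"
      using norm_le_height_hor[of x] x by (simp add: slab_def)
  qed
qed

definition truncated_cone :: "real \<Rightarrow> 'v \<Rightarrow> real \<Rightarrow> 'v set" where
  "truncated_cone k x L = {y. y - x \<in> cone k \<and> height y \<le> L}"

lemma truncated_cone_subset_slab:
  assumes "0 < k"
  shows "truncated_cone k x L \<subseteq> slab (height x) L (norm (hor x) + k * (L - height x))"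
proof
  fix y assume y: "y \<in> truncated_cone k x L"
  then have "height x \<le> height y" "height y \<le> L" "norm (hor y - hor x) \<le> k * (height y - height x)"
    using cone_height_nonneg[OF assms, of "y - x"]
    by (auto simp: truncated_cone_def cone_def splitting_simps)
  moreover have "k * (height y - height x) \<le> k * (L - height x)"
    using assms calculation by (intro mult_left_mono) auto
  ultimately show "y \<in> slab (height x) L (norm (hor x) + k * (L - height x))"
    using norm_triangle_sub[of "hor y" "hor x"] by (simp add: slab_def)
qed

lemma truncated_cone_subset_cylinder:
  assumes "0 < k" "- r < height x" "L < r" "norm (hor x) + k * (L - height x) < r"
  shows "truncated_cone k x L \<subseteq> cylinder r"
  using truncated_cone_subset_slab[OF assms(1), of x L] assms by (force simp: slab_def cylinder_def)

lemma compact_truncated_cone: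
  assumes "0 < k"
  shows "compact (truncated_cone k x L)"
proof -
  have "closed (truncated_cone k x L)"
    unfolding truncated_cone_def cone_def mem_Collect_eq
    by (intro closed_Collect_conj closed_Collect_le continuous_intros)
  then show ?thesis
    using compact_Int_closed[OF compact_slab] truncated_cone_subset_slab[OF assms]
    by (metis Int_absorb1)
qed

definition pinched :: "real \<Rightarrow> ('v \<Rightarrow> real) \<Rightarrow> bool" where
  "pinched b Q \<longleftrightarrow> (\<forall>v. (norm (hor v))\<^sup>2 / b - b * (height v)\<^sup>2 \<le> Q v \<and>
     Q v \<le> b * (norm (hor v))\<^sup>2 - (height v)\<^sup>2 / b)"

lemma pinched_perturb:
  assumes b: "1 \<le> b" and Q: "pinched b Q"
    and Q': "\<And>v. \<bar>Q' v - Q v\<bar> \<le> e * (norm v)\<^sup>2"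
    and e: "4 * b * e \<le> 1" "4 * b * e * (norm w)\<^sup>2 \<le> 1" "0 \<le> e"
  shows "pinched (2 * b) Q'"
  unfolding pinched_def
proof (rule allI)
  fix v
  define r where "r = (norm (hor v))\<^sup>2"
  define s where "s = (height v)\<^sup>2"
  have rs: "0 \<le> r" "0 \<le> s" by (simp_all add: r_def s_def)
  have "(norm v)\<^sup>2 \<le> (\<bar>height v\<bar> * norm w + norm (hor v))\<^sup>2"
    by (intro power_mono norm_le_height_hor) simp
  also have "\<dots> \<le> 2 * (\<bar>height v\<bar> * norm w)\<^sup>2 + 2 * (norm (hor v))\<^sup>2"
    using sum_squares_bound[of "\<bar>height v\<bar> * norm w" "norm (hor v)"] by (simp add: power2_sum)
  finally have "e * (norm v)\<^sup>2 \<le> e * (2 * ((norm w)\<^sup>2 * s) + 2 * r)"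
    using e(3) by (intro mult_left_mono) (simp_all add: power_mult_distrib r_def s_def mult.commute)
  also have "\<dots> = (4 * b * e * (norm w)\<^sup>2 * s + 4 * b * e * r) / (2 * b)"
    using b by (simp add: field_simps)
  also have "\<dots> \<le> (1 * s + 1 * r) / (2 * b)"
    using b rs e by (intro divide_right_mono add_mono mult_right_mono) auto
  finally have diff: "\<bar>Q' v - Q v\<bar> \<le> (s + r) / (2 * b)" using Q'[of v] by simp
  have "r / b - b * s \<le> Q v" "Q v \<le> b * r - s / b" using Q by (auto simp: pinched_def r_def s_def)
  moreover have "r / b - b * s - (s + r) / (2 * b) \<ge> r / (2 * b) - 2 * b * s"
    "b * r - s / b + (s + r) / (2 * b) \<le> 2 * b * r - s / (2 * b)"
  proof -
    have "1 * 1 \<le> b * (2 * b)" by (rule mult_mono) (use b in auto)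
    then have "x / (2 * b) \<le> b * x" if "0 \<le> x" for x
      using mult_right_mono[of 1 "b * (2 * b)" x] b that by (simp add: field_simps)
    then have "s / (2 * b) \<le> b * s" "r / (2 * b) \<le> b * r" using rs by simp_all
    then show "r / b - b * s - (s + r) / (2 * b) \<ge> r / (2 * b) - 2 * b * s"
      "b * r - s / b + (s + r) / (2 * b) \<le> 2 * b * r - s / (2 * b)"
      using b by (simp_all add: add_divide_distrib)
  qed
  ultimately have "r / (2 * b) - 2 * b * s \<le> Q' v" "Q' v \<le> 2 * b * r - s / (2 * b)"
    using diff by linarith+
  then show "(norm (hor v))\<^sup>2 / (2 * b) - 2 * b * (height v)\<^sup>2 \<le> Q' v \<and>
      Q' v \<le> 2 * b * (norm (hor v))\<^sup>2 - (height v)\<^sup>2 / (2 * b)"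
    by (simp add: r_def s_def)
qed

lemma sign_change:
  assumes \<sigma>: "\<bar>\<sigma>\<bar> = 1"
  shows "vertical_splitting (\<lambda>v. \<sigma> * height v) (\<sigma> *\<^sub>R w)"
    and "vertical_splitting.cylinder (\<lambda>v. \<sigma> * height v) (\<sigma> *\<^sub>R w) = cylinder"
    and "vertical_splitting.pinched (\<lambda>v. \<sigma> * height v) (\<sigma> *\<^sub>R w) = pinched"
proof -
  have \<sigma>2: "\<sigma> * \<sigma> = 1" using \<sigma> by (auto simp: abs_if split: if_splits)
  interpret neg: vertical_splitting "\<lambda>v. \<sigma> * height v" "\<sigma> *\<^sub>R w"
    by (rule vertical_splitting.intro[OF bounded_linear_const_mult[OF bounded_linear_height]])
      (simp add: height.scaleR \<sigma>2)
  show "vertical_splitting (\<lambda>v. \<sigma> * height v) (\<sigma> *\<^sub>R w)" by (rule neg.vertical_splitting_axioms)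
  have hor: "neg.hor v = hor v" for v
    using \<sigma>2 by (simp add: neg.hor_def hor_def mult.commute mult.left_commute)
  have height: "\<bar>\<sigma> * height v\<bar> = \<bar>height v\<bar>" "(\<sigma> * height v)\<^sup>2 = (height v)\<^sup>2" for v
    using \<sigma> \<sigma>2 by (simp_all add: abs_mult power2_eq_square)
  show "neg.cylinder = cylinder" by (simp add: fun_eq_iff neg.cylinder_def cylinder_def hor height)
  show "neg.pinched = pinched" by (simp add: fun_eq_iff neg.pinched_def pinched_def hor height)
qed

end

section \<open>A chart around a boundary point\<close>

text \<open>The map \<open>\<Psi>\<close> is the embedding read in a chart of the extension, translated such that the
  boundary point under consideration is 0. The vector \<open>w\<close> is timelike for the extended metric at 0,
  and \<open>height\<close> is the coefficient of \<open>w\<close> in the orthogonal splitting with respect to that metric. The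
  set \<open>W\<close> may be smaller than the preimage of the cylinder: it contains only the points where \<open>w\<close> and
  the Kasner time direction have the same time orientation.\<close>
locale kasner_chart = vertical_splitting height w
  for height :: "'n::finite spt \<Rightarrow> real" and w :: "'n spt" +
  fixes p :: "'n \<Rightarrow> real" and W :: "'n spt set"
    and \<Psi> :: "'n spt \<Rightarrow> 'n spt" and \<Psi>' :: "'n spt \<Rightarrow> 'n spt \<Rightarrow> 'n spt" and h b :: real
  assumes abs_exponent_less_1: "\<bar>p i\<bar> < 1"
    and open_W: "open W" and W_subset: "W \<subseteq> kasner_M"
    and inj_\<Psi>: "inj_on \<Psi> W"
    and \<Psi>_has_derivative: "z \<in> W \<Longrightarrow> (\<Psi> has_derivative \<Psi>' z) (at z)"
    and inj_\<Psi>': "z \<in> W \<Longrightarrow> inj (\<Psi>' z)"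
    and h_pos: "0 < h" and b_ge_1: "1 \<le> b"
    and \<Psi>_in_cylinder: "z \<in> W \<Longrightarrow> \<Psi> z \<in> cylinder h"
    and zero_notin_image: "0 \<notin> \<Psi> ` W"
    and limit_in_W: "\<lbrakk>\<And>k::nat. Z k \<in> W; Z \<longlonglongrightarrow> z; z \<in> kasner_M;
        (\<lambda>k. \<Psi> (Z k)) \<longlonglongrightarrow> y; y \<in> cylinder h\<rbrakk> \<Longrightarrow> z \<in> W"
    and pinched_metric: "z \<in> W \<Longrightarrow> pinched b (\<lambda>v. kasner_g p z (inv (\<Psi>' z) v) (inv (\<Psi>' z) v))"
    and orientation: "z \<in> W \<Longrightarrow> 0 < height (\<Psi>' z (1, 0))"
begin

definition region :: "'n spt set" where
  "region = \<Psi> ` W"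

definition \<Phi> :: "'n spt \<Rightarrow> 'n spt" where
  "\<Phi> = inv_into W \<Psi>"

definition \<Phi>' :: "'n spt \<Rightarrow> 'n spt \<Rightarrow> 'n spt" where
  "\<Phi>' x = inv (\<Psi>' (\<Phi> x))"

lemma b_pos: "0 < b"
  using b_ge_1 by simp

lemma exponent_less_1: "p i < 1"
  using abs_exponent_less_1[of i] by simp

lemma continuous_on_\<Psi>: "continuous_on W \<Psi>"
  by (rule has_derivative_continuous_on[OF has_derivative_at_withinI[OF \<Psi>_has_derivative]])

lemma open_region: "open region"
  unfolding region_def by (rule invariance_of_domain[OF continuous_on_\<Psi> open_W inj_\<Psi>])

lemma \<Phi>_in_W: "x \<in> region \<Longrightarrow> \<Phi> x \<in> W"
  by (simp add: region_def \<Phi>_def inv_into_into)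

lemma \<Psi>_\<Phi>: "x \<in> region \<Longrightarrow> \<Psi> (\<Phi> x) = x"
  by (simp add: region_def \<Phi>_def f_inv_into_f)

lemma \<Phi>_\<Psi>: "z \<in> W \<Longrightarrow> \<Phi> (\<Psi> z) = z"
  by (simp add: \<Phi>_def inj_\<Psi>)

lemma \<Psi>_in_region: "z \<in> W \<Longrightarrow> \<Psi> z \<in> region"
  by (simp add: region_def)

lemma region_subset_cylinder: "region \<subseteq> cylinder h"
  using \<Psi>_in_cylinder by (auto simp: region_def)

lemma zero_notin_region: "0 \<notin> region"
  using zero_notin_image by (simp add: region_def)

lemma zero_in_cylinder: "0 \<in> cylinder h"
  using h_pos by (simp add: cylinder_def splitting_simps)

lemma time_pos: "z \<in> W \<Longrightarrow> 0 < fst z"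
  using W_subset by (auto simp: mem_kasner_M_iff)

lemma linear_\<Psi>': "z \<in> W \<Longrightarrow> linear (\<Psi>' z)"
  by (rule has_derivative_linear[OF \<Psi>_has_derivative])

lemma \<Psi>'_\<Phi>': "x \<in> region \<Longrightarrow> \<Psi>' (\<Phi> x) (\<Phi>' x v) = v"
  unfolding \<Phi>'_def
  by (rule surj_f_inv_f[OF linear_inj_imp_surj[OF linear_\<Psi>' inj_\<Psi>']]) (simp_all add: \<Phi>_in_W)

lemma \<Phi>_has_derivative:
  assumes "x \<in> region"
  shows "(\<Phi> has_derivative \<Phi>' x) (at x)"
proof -
  note z = \<Phi>_in_W[OF assms]
  from inv_into_has_derivative[OF open_W inj_\<Psi> \<Psi>_has_derivative z inj_\<Psi>'[OF z]]
  show ?thesis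
    unfolding \<Phi>_def[symmetric] \<Phi>'_def[symmetric] \<Psi>_\<Phi>[OF assms] .
qed

lemma continuous_on_\<Phi>: "continuous_on region \<Phi>"
  by (rule has_derivative_continuous_on[OF has_derivative_at_withinI[OF \<Phi>_has_derivative]])

lemma kasner_g_pinched:
  assumes "z \<in> W"
  shows "(norm (hor (\<Psi>' z a)))\<^sup>2 / b - b * (height (\<Psi>' z a))\<^sup>2 \<le> kasner_g p z a a"
    "kasner_g p z a a \<le> b * (norm (hor (\<Psi>' z a)))\<^sup>2 - (height (\<Psi>' z a))\<^sup>2 / b"
proof -
  have "inv (\<Psi>' z) (\<Psi>' z a) = a" by (rule inv_f_f[OF inj_\<Psi>'[OF assms]])
  then show "(norm (hor (\<Psi>' z a)))\<^sup>2 / b - b * (height (\<Psi>' z a))\<^sup>2 \<le> kasner_g p z a a"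
    "kasner_g p z a a \<le> b * (norm (hor (\<Psi>' z a)))\<^sup>2 - (height (\<Psi>' z a))\<^sup>2 / b"
    using pinched_metric[OF assms] unfolding pinched_def by metis+
qed

lemma height_\<Psi>'_nonzero:
  assumes "z \<in> W" "a \<in> future_cone p (fst z)"
  shows "height (\<Psi>' z a) \<noteq> 0"
proof
  assume "height (\<Psi>' z a) = 0"
  then have "(norm (hor (\<Psi>' z a)))\<^sup>2 / b \<le> kasner_g p z a a"
    using kasner_g_pinched(1)[OF assms(1), of a] by simp
  moreover have "kasner_g p z a a < 0" using assms(2) by (simp add: kasner_g_neg_iff)
  moreover have "0 \<le> (norm (hor (\<Psi>' z a)))\<^sup>2 / b" using b_pos by simp
  ultimately show False by linarith
qed

lemma height_\<Psi>'_pos: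
  assumes z: "z \<in> W" and a: "a \<in> future_cone p (fst z)"
  shows "0 < height (\<Psi>' z a)"
proof (rule ccontr)
  assume "\<not> 0 < height (\<Psi>' z a)"
  then have neg: "height (\<Psi>' z a) < 0" using height_\<Psi>'_nonzero[OF z a] by simp
  define c where "c = height (\<Psi>' z (1, 0)) *\<^sub>R a + (- height (\<Psi>' z a)) *\<^sub>R (1, 0)"
  have "c \<in> future_cone p (fst z)"
    unfolding c_def using neg orientation[OF z] a by (intro future_cone_add future_cone_scaleR) auto
  moreover have "height (\<Psi>' z c) = 0"
    unfolding c_def linear_add[OF linear_\<Psi>'[OF z]] linear_scale[OF linear_\<Psi>'[OF z]]
    by (simp add: splitting_simps)
  ultimately show False using height_\<Psi>'_nonzero[OF z] by blast
qed

lemma \<Psi>'_future_cone: "z \<in> W \<Longrightarrow> \<Psi>' z ` future_cone p (fst z) \<subseteq> interior (cone b)"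
proof (rule image_subsetI, rule mem_interior_cone)
  fix a assume z: "z \<in> W" and a: "a \<in> future_cone p (fst z)"
  have "(norm (hor (\<Psi>' z a)))\<^sup>2 / b - b * (height (\<Psi>' z a))\<^sup>2 < 0"
    using order_le_less_trans[OF kasner_g_pinched(1)[OF z]] a kasner_g_neg_iff by blast
  then have "(norm (hor (\<Psi>' z a)))\<^sup>2 < (b * height (\<Psi>' z a))\<^sup>2"
    using b_pos by (simp add: field_simps power2_eq_square)
  then show "norm (hor (\<Psi>' z a)) < b * height (\<Psi>' z a)"
    by (rule power2_less_imp_less) (use height_\<Psi>'_pos[OF z a] b_pos in simp)
qed

definition \<kappa> :: real where
  "\<kappa> = 1 / (2 * b)"

lemma \<kappa>_bounds: "0 < \<kappa>" "\<kappa> \<le> 1"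
  using b_ge_1 by (simp_all add: \<kappa>_def)

definition steep :: "'n spt set" where
  "steep = {v. norm (hor v) \<le> \<kappa> * height v \<and> 0 < height v}"

lemma w_steep: "w \<in> steep"
  using \<kappa>_bounds by (simp add: steep_def)

lemma \<Phi>'_steep: "x \<in> region \<Longrightarrow> \<Phi>' x ` steep \<subseteq> future_cone p (fst (\<Phi> x))"
proof (rule image_subsetI)
  fix v assume x: "x \<in> region" and v: "v \<in> steep"
  define a where "a = \<Phi>' x v"
  have z: "\<Phi> x \<in> W" and a: "\<Psi>' (\<Phi> x) a = v" using x by (simp_all add: \<Phi>_in_W a_def \<Psi>'_\<Phi>')
  have "(norm (hor v))\<^sup>2 \<le> (\<kappa> * height v)\<^sup>2" by (rule power_mono) (use v in \<open>auto simp: steep_def\<close>)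
  then have "b * (norm (hor v))\<^sup>2 \<le> b * (\<kappa> * height v)\<^sup>2" using b_pos by simp
  also have "\<dots> = (height v)\<^sup>2 / (4 * b)" using b_pos by (simp add: \<kappa>_def field_simps power2_eq_square)
  also have "\<dots> < (height v)\<^sup>2 / b" using b_pos v by (simp add: steep_def field_simps)
  finally have "kasner_g p (\<Phi> x) a a < 0" using kasner_g_pinched(2)[OF z, of a] by (simp add: a)
  moreover have "- a \<notin> future_cone p (fst (\<Phi> x))"
    using height_\<Psi>'_pos[OF z, of "- a"] v
    by (auto simp: steep_def linear_neg linear_\<Psi>'[OF z] a height.neg)
  ultimately show "\<Phi>' x v \<in> future_cone p (fst (\<Phi> x))" by (simp add: kasner_g_neg_iff a_def)
qed

lemma limit_in_region:
  assumes x: "\<And>k::nat. x k \<in> region" "x \<longlonglongrightarrow> y" "y \<in> cylinder h"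
    and C: "compact C" "C \<subseteq> kasner_M" "\<And>k. \<Phi> (x k) \<in> C"
  shows "y \<in> region"
proof -
  obtain r z where r: "z \<in> C" "strict_mono r" "((\<lambda>k. \<Phi> (x k)) \<circ> r) \<longlonglongrightarrow> z"
    using C(1,3) unfolding compact_def by meson
  have lim: "(\<lambda>k. \<Psi> (\<Phi> (x (r k)))) \<longlonglongrightarrow> y"
    using LIMSEQ_subseq_LIMSEQ[OF x(2) r(2)] by (simp add: \<Psi>_\<Phi> x o_def)
  have z: "z \<in> W"
    by (rule limit_in_W[of "\<lambda>k. \<Phi> (x (r k))", OF _ _ _ lim])
      (use r C x in \<open>auto simp: \<Phi>_in_W o_def\<close>)
  have "(\<lambda>k. \<Psi> (\<Phi> (x (r k)))) \<longlonglongrightarrow> \<Psi> z"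
    by (rule continuous_on_tendsto_compose[OF continuous_on_\<Psi>]) (use r z x in \<open>auto simp: \<Phi>_in_W o_def\<close>)
  then have "y = \<Psi> z" using lim LIMSEQ_unique by blast
  then show ?thesis using z by (simp add: region_def)
qed

lemma limit_in_W_compact:
  assumes Z: "\<And>k::nat. Z k \<in> W" "Z \<longlonglongrightarrow> z" "z \<in> kasner_M"
    and C: "compact C" "C \<subseteq> cylinder h" "\<And>k. \<Psi> (Z k) \<in> C"
  shows "z \<in> W"
proof -
  obtain r y where r: "y \<in> C" "strict_mono r" "((\<lambda>k. \<Psi> (Z k)) \<circ> r) \<longlonglongrightarrow> y"
    using C(1,3) unfolding compact_def by meson
  show ?thesis
    by (rule limit_in_W[of "Z \<circ> r" z y])
      (use r Z C LIMSEQ_subseq_LIMSEQ[OF Z(2) r(2)] in \<open>auto simp: o_def\<close>)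
qed

lemma causal_bound_along_steep_curve:
  assumes "s \<le> s'" and c: "velocity_in (\<lambda>_. steep) s s' c" and region: "\<And>t. t \<in> {s..s'} \<Longrightarrow> c t \<in> region"
  shows "causal_bound p (\<Phi> (c s)) (\<Phi> (c s'))"
proof (rule causal_bound_along_curve[OF exponent_less_1 assms(1)])
  have "velocity_in (\<lambda>t. \<Phi>' (c t) ` steep) s s' (\<lambda>t. \<Phi> (c t))"
    by (rule velocity_in_compose[OF c]) (intro \<Phi>_has_derivative region)
  then show "velocity_in (\<lambda>t. future_cone p (fst (\<Phi> (c t)))) s s' (\<lambda>t. \<Phi> (c t))"
    by (rule velocity_in_mono) (intro \<Phi>'_steep region, simp)
qed (simp add: region \<Phi>_in_W time_pos)

lemma velocity_in_vertical: "velocity_in (\<lambda>_. steep) 0 T (\<lambda>s. a + s *\<^sub>R w)"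
  by (rule velocity_inI_differentiable, intro bexI[OF _ w_steep]) (auto intro!: derivative_eq_intros)

lemma causal_bound_along_vertical:
  assumes "0 \<le> T" "\<And>s. s \<in> {0..T} \<Longrightarrow> a + s *\<^sub>R w \<in> region"
  shows "causal_bound p (\<Phi> a) (\<Phi> (a + T *\<^sub>R w))"
  using causal_bound_along_steep_curve[OF assms(1) velocity_in_vertical assms(2)] by simp

lemma graph_lift_in_cone:
  assumes t: "t1 \<le> t2" and y: "velocity_in (subluminal p) t1 t2 y"
    and W: "\<And>t. t \<in> {t1..t2} \<Longrightarrow> (t, y t) \<in> W"
  shows "\<Psi> (t2, y t2) - \<Psi> (t1, y t1) \<in> cone b"
proof (rule velocity_in_cone_increment[OF closed_cone convex_cone_cone t])
  show "velocity_in (\<lambda>t. \<Psi>' (t, y t) ` Pair 1 ` subluminal p t) t1 t2 (\<lambda>t. \<Psi> (t, y t))"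
    by (rule velocity_in_compose[OF velocity_in_graph[OF y]]) (intro \<Psi>_has_derivative W)
  show "\<Psi>' (t, y t) ` Pair 1 ` subluminal p t \<subseteq> interior (cone b)" if "t \<in> {t1..<t2}" for t
    using \<Psi>'_future_cone[OF W, of t] that by auto
qed

lemma graph_height_mono:
  assumes "t1 \<le> t2" "velocity_in (subluminal p) t1 t2 y" "\<And>t. t \<in> {t1..t2} \<Longrightarrow> (t, y t) \<in> W"
  shows "height (\<Psi> (t1, y t1)) \<le> height (\<Psi> (t2, y t2))"
  using cone_height_nonneg[OF b_pos graph_lift_in_cone[OF assms]] by (simp add: height.diff)

lemma graph_lift_in_truncated_cone:
  assumes y: "velocity_in (subluminal p) t1 t2 y" and W: "\<And>t. t \<in> {t1..t2} \<Longrightarrow> (t, y t) \<in> W"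
    and L: "height (\<Psi> (t2, y t2)) \<le> L" and s: "s \<in> {t1..t2}"
  shows "\<Psi> (s, y s) \<in> truncated_cone b (\<Psi> (t1, y t1)) L"
proof -
  have "\<Psi> (s, y s) - \<Psi> (t1, y t1) \<in> cone b"
    by (rule graph_lift_in_cone[OF _ velocity_in_subinterval[OF y]]) (use s W in auto)
  moreover have "height (\<Psi> (s, y s)) \<le> height (\<Psi> (t2, y t2))"
    by (rule graph_height_mono[OF _ velocity_in_subinterval[OF y]]) (use s W in auto)
  ultimately show ?thesis using L by (simp add: truncated_cone_def)
qed

lemma velocity_in_steep_parabola:
  assumes u: "height u = 0" "T * norm u \<le> \<kappa>" and r: "r \<in> {0..1}" and s: "0 \<le> s" "s' \<le> T"
  shows "velocity_in (\<lambda>_. steep) s s' (\<lambda>x. a + x *\<^sub>R w + (r * (x * (T - x))) *\<^sub>R u)"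
proof (rule velocity_inI_differentiable)
  fix x assume x: "x \<in> {s..s'}"
  have "\<bar>r * (T - 2 * x)\<bar> \<le> 1 * T" unfolding abs_mult by (rule mult_mono) (use r s x in auto)
  then have "\<bar>r * (T - 2 * x)\<bar> * norm u \<le> T * norm u" by (intro mult_right_mono) auto
  then have "w + (r * (T - 2 * x)) *\<^sub>R u \<in> steep"
    using u by (simp add: steep_def splitting_simps hor_eq)
  moreover have "((\<lambda>x. a + x *\<^sub>R w + (r * (x * (T - x))) *\<^sub>R u) has_vector_derivative
      w + (r * (T - 2 * x)) *\<^sub>R u) (at x)"
    by (auto intro!: derivative_eq_intros simp: algebra_simps)
  ultimately show "\<exists>v\<in>steep. ((\<lambda>x. a + x *\<^sub>R w + (r * (x * (T - x))) *\<^sub>R u)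
      has_vector_derivative v) (at x)"
    by blast
qed

text \<open>The Kasner images of the parabolas in the homotopy have common endpoints, hence stay in a
  compact set; so a limit of such curves cannot meet the boundary.\<close>
lemma steep_parabola_in_region:
  assumes T: "0 < T" and seg: "\<And>s. s \<in> {0..T} \<Longrightarrow> a + s *\<^sub>R w \<in> region"
    and u: "height u = 0" "T * norm u \<le> \<kappa>"
    and cyl: "\<And>r s. r \<in> {0..1} \<Longrightarrow> s \<in> {0..T} \<Longrightarrow> a + s *\<^sub>R w + (r * (s * (T - s))) *\<^sub>R u \<in> cylinder h"
    and s: "s \<in> {0..T}"
  shows "a + s *\<^sub>R w + (s * (T - s)) *\<^sub>R u \<in> region"
proof -
  define H where "H r s = a + s *\<^sub>R w + (r * (s * (T - s))) *\<^sub>R u" for r s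
  have steep: "velocity_in (\<lambda>_. steep) s s' (H r)" if "r \<in> {0..1}" "0 \<le> s" "s' \<le> T" for r s s'
    unfolding H_def by (rule velocity_in_steep_parabola[OF u that])
  have "H 1 s \<in> region"
  proof (rule homotopy_remains_in_open[OF compact_Icc open_region _ _ _ s])
    show "continuous_on (UNIV \<times> {0..T}) (\<lambda>(r, s). H r s)"
      by (auto simp: H_def case_prod_unfold intro!: continuous_intros)
    show "H 0 s \<in> region" if "s \<in> {0..T}" for s using seg[OF that] by (simp add: H_def)
    fix X r s
    assume X: "\<And>n. X n \<in> {0..1}" and in_region: "\<And>n s. s \<in> {0..T} \<Longrightarrow> H (X n) s \<in> region"
      and lim: "X \<longlonglongrightarrow> r" and r: "r \<in> {0..1}" and s: "s \<in> {0..T}"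
    have a: "a \<in> region" using seg[of 0] T by simp
    have time_a: "0 < fst (\<Phi> a)" using a by (simp add: \<Phi>_in_W time_pos)
    show "H r s \<in> region"
    proof (rule limit_in_region[OF in_region[OF s] _ _ compact_future_box
        future_box_subset_kasner_M[OF time_a]])
      show "(\<lambda>n. H (X n) s) \<longlonglongrightarrow> H r s" unfolding H_def by (intro tendsto_intros lim)
      show "H r s \<in> cylinder h" using cyl r s by (simp add: H_def)
      fix n
      have "causal_bound p (\<Phi> (H (X n) 0)) (\<Phi> (H (X n) s))"
        by (rule causal_bound_along_steep_curve[OF _ steep]) (use s X in_region in auto)
      then have "causal_bound p (\<Phi> a) (\<Phi> (H (X n) s))" by (simp add: H_def)
      moreover have "causal_bound p (\<Phi> (H (X n) s)) (\<Phi> (H (X n) T))"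
        by (rule causal_bound_along_steep_curve[OF _ steep]) (use s X in_region in auto)
      then have "fst (\<Phi> (H (X n) s)) \<le> fst (\<Phi> (a + T *\<^sub>R w))" by (simp add: H_def causal_bound_def)
      ultimately show "\<Phi> (H (X n) s) \<in> future_box p (\<Phi> a) (fst (\<Phi> (a + T *\<^sub>R w)))"
        by (intro causal_bound_imp_mem_future_box exponent_less_1 time_a)
    qed
  qed
  then show ?thesis by (simp add: H_def)
qed

lemma diamond_subset_region:
  assumes T: "0 < T" and seg: "\<And>s. s \<in> {0..T} \<Longrightarrow> a + s *\<^sub>R w \<in> region"
    and x: "0 < height (x - a)" "height (x - a) < T"
      "T * norm (hor (x - a)) \<le> \<kappa> * (height (x - a) * (T - height (x - a)))"
    and wide: "norm (hor a) + \<kappa> * T < h"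
  shows "x \<in> region"
proof -
  define s where "s = height (x - a)"
  define q where "q = s * (T - s)"
  define u where "u = hor (x - a) /\<^sub>R q"
  have q: "0 < q" using x by (simp add: q_def s_def)
  have "height u = 0" by (simp add: u_def splitting_simps)
  moreover have "norm u = norm (hor (x - a)) / q" using q by (simp add: u_def divide_inverse_commute)
  then have "T * norm u \<le> \<kappa>"
    using x(3) q by (simp add: q_def[symmetric] s_def[symmetric] pos_divide_le_eq)
  ultimately have u: "height u = 0" "T * norm u \<le> \<kappa>" .
  have "a + s *\<^sub>R w + (s * (T - s)) *\<^sub>R u \<in> region"
  proof (rule steep_parabola_in_region[OF T seg u])
    fix r s' assume r: "r \<in> {0..1::real}" and s': "s' \<in> {0..T}"
    have "a \<in> cylinder h" "a + T *\<^sub>R w \<in> cylinder h"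
      using seg[of 0] seg[of T] T region_subset_cylinder by auto
    then have height: "\<bar>height a + s'\<bar> < h" using s' by (auto simp: cylinder_def splitting_simps)
    have "r * (s' * (T - s')) \<le> 1 * (T * T)"
      by (intro mult_mono) (use r s' in auto)
    then have "\<bar>r * (s' * (T - s'))\<bar> * norm u \<le> T * T * norm u"
      using r s' by (intro mult_right_mono) auto
    also have "\<dots> \<le> \<kappa> * T" using u(2) T by (simp add: mult.assoc mult.commute[of \<kappa>])
    finally have "norm (hor a + (r * (s' * (T - s'))) *\<^sub>R u) < h"
      using wide norm_triangle_ineq[of "hor a" "(r * (s' * (T - s'))) *\<^sub>R u"] by simp
    with height show "a + s' *\<^sub>R w + (r * (s' * (T - s'))) *\<^sub>R u \<in> cylinder h"
      by (simp add: cylinder_def splitting_simps u(1) hor_eq)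
  qed (use x in \<open>auto simp: s_def\<close>)
  moreover have "(s * (T - s)) *\<^sub>R u = hor (x - a)" using q by (simp add: u_def q_def[symmetric])
  ultimately show ?thesis by (simp add: s_def hor_def)
qed

lemma graph_deformation_in_W:
  assumes t: "0 < t1" "t1 \<le> t2"
    and c: "velocity_in (subluminal p) t1 t2 c" and k: "velocity_in (subluminal p) t1 t2 k"
    and start: "c t1 = k t1" and c_in_W: "\<And>t. t \<in> {t1..t2} \<Longrightarrow> (t, c t) \<in> W"
    and final: "\<And>y. y \<in> closed_segment (c t2) (k t2) \<Longrightarrow> (t2, y) \<in> W \<and> height (\<Psi> (t2, y)) \<le> L"
    and trunc: "truncated_cone b (\<Psi> (t1, c t1)) L \<subseteq> cylinder h"
    and s: "s \<in> {t1..t2}"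
  shows "(s, k s) \<in> W"
proof -
  define y where "y r t = (1 - r) *\<^sub>R c t + r *\<^sub>R k t" for r t
  have "(s, y 1 s) \<in> W"
  proof (rule homotopy_remains_in_open[OF compact_Icc open_W _ _ _ s, where H = "\<lambda>r t. (t, y r t)"])
    have "continuous_on (UNIV \<times> {t1..t2}) (\<lambda>x. c (snd x))"
        "continuous_on (UNIV \<times> {t1..t2}) (\<lambda>x. k (snd x))"
      using c k by (auto simp: velocity_in_def intro!: continuous_on_compose2[of "{t1..t2}" _ _ snd]
        continuous_intros)
    then show "continuous_on (UNIV \<times> {t1..t2}) (\<lambda>(r, t). (t, y r t))"
      by (auto simp: y_def case_prod_unfold intro!: continuous_intros)
    show "(t, y 0 t) \<in> W" if "t \<in> {t1..t2}" for t using c_in_W[OF that] by (simp add: y_def)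
    fix X r s
    assume X: "\<And>n. X n \<in> {0..1}" and in_W: "\<And>n t. t \<in> {t1..t2} \<Longrightarrow> (t, y (X n) t) \<in> W"
      and lim: "X \<longlonglongrightarrow> r" and s: "s \<in> {t1..t2}"
    show "(s, y r s) \<in> W"
    proof (rule limit_in_W_compact[OF in_W[OF s] _ _ compact_truncated_cone[OF b_pos] trunc])
      show "(\<lambda>n. (s, y (X n) s)) \<longlonglongrightarrow> (s, y r s)" unfolding y_def by (intro tendsto_intros lim)
      show "(s, y r s) \<in> kasner_M" using s t by (simp add: mem_kasner_M_iff)
      fix n
      have yn: "velocity_in (subluminal p) t1 t2 (y (X n))"
        unfolding y_def using X[of n]
        by (intro velocity_in_convex_combination c k convex_subluminal) auto
      have "y (X n) t2 \<in> closed_segment (c t2) (k t2)"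
        unfolding y_def in_segment using X[of n] by auto
      then have "height (\<Psi> (t2, y (X n) t2)) \<le> L" using final by blast
      moreover have "y (X n) t1 = c t1" using start by (simp add: y_def algebra_simps)
      ultimately show "\<Psi> (s, y (X n) s) \<in> truncated_cone b (\<Psi> (t1, c t1)) L"
        using graph_lift_in_truncated_cone[OF yn in_W _ s] by simp
    qed
  qed
  then show ?thesis by (simp add: y_def)
qed

lemma open_vertical_interval:
  assumes "0 \<le> T" "\<And>s. s \<in> {0..T} \<Longrightarrow> a + s *\<^sub>R w \<in> region"
  obtains S where "open S" "is_interval S" "{0..T} \<subseteq> S" "(\<lambda>s. a + s *\<^sub>R w) ` S \<subseteq> region"
proof -
  define S where "S = connected_component_set {s. a + s *\<^sub>R w \<in> region} 0"
  have "open {s. a + s *\<^sub>R w \<in> region}"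
    by (intro open_vimage[OF open_region, unfolded vimage_def] continuous_intros)
  then have "open S" "is_interval S"
    by (simp_all add: S_def open_connected_component is_interval_connected_1)
  moreover have "{0..T} \<subseteq> S"
    unfolding S_def by (rule connected_component_maximal) (use assms in auto)
  moreover have "(\<lambda>s. a + s *\<^sub>R w) ` S \<subseteq> region"
    using connected_component_subset[of "{s. a + s *\<^sub>R w \<in> region}" 0] by (auto simp: S_def)
  ultimately show thesis by (rule that)
qed

lemma vertical_has_vector_derivative:
  assumes "a + s *\<^sub>R w \<in> region"
  shows "((\<lambda>s. \<Phi> (a + s *\<^sub>R w)) has_vector_derivative \<Phi>' (a + s *\<^sub>R w) w) (at s)"
proof -
  have "((\<lambda>s. a + s *\<^sub>R w) has_vector_derivative w) (at s)" by (auto intro!: derivative_eq_intros)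
  from vector_derivative_diff_chain_within[OF this
      has_derivative_at_withinI[OF \<Phi>_has_derivative[OF assms]]]
  show ?thesis by (simp add: o_def)
qed

lemma vertical_graph:
  assumes T: "0 < T" and seg: "\<And>s. s \<in> {0..T} \<Longrightarrow> a + s *\<^sub>R w \<in> region"
  defines "t1 \<equiv> fst (\<Phi> a)" and "t2 \<equiv> fst (\<Phi> (a + T *\<^sub>R w))"
  obtains y where "t1 < t2" "velocity_in (subluminal p) t1 t2 y"
    "\<And>t. t \<in> {t1..t2} \<Longrightarrow> \<exists>s\<in>{0..T}. \<Phi> (a + s *\<^sub>R w) = (t, y t)"
    "y t1 = snd (\<Phi> a)" "y t2 = snd (\<Phi> (a + T *\<^sub>R w))"
proof -
  define c where "c = (\<lambda>s. \<Phi> (a + s *\<^sub>R w))"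
  define c' where "c' s = \<Phi>' (a + s *\<^sub>R w) w" for s
  obtain S where S: "open S" "is_interval S" "{0..T} \<subseteq> S" and "(\<lambda>s. a + s *\<^sub>R w) ` S \<subseteq> region"
    by (rule open_vertical_interval[OF less_imp_le[OF T] seg])
  then have S_region: "a + s *\<^sub>R w \<in> region" if "s \<in> S" for s using that by blast
  have c: "(c has_vector_derivative c' s) (at s)" if "s \<in> S" for s
    unfolding c_def c'_def by (rule vertical_has_vector_derivative[OF S_region[OF that]])
  have future: "c' s \<in> future_cone p (fst (c s))" if "s \<in> S" for s
    using \<Phi>'_steep[OF S_region[OF that]] w_steep by (auto simp: c_def c'_def)
  obtain y where mono: "strict_mono_on S (\<lambda>s. fst (c s))" and y: "\<And>s. s \<in> S \<Longrightarrow> y (fst (c s)) = snd (c s)"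
    and y': "\<And>s. s \<in> S \<Longrightarrow> (y has_vector_derivative snd (c' s) /\<^sub>R fst (c' s)) (at (fst (c s)))"
    using reparametrize_by_first_component[OF S(1,2) c future_cone_fst_pos[OF future]] by blast
  have ends: "0 \<in> S" "T \<in> S" "t1 = fst (c 0)" "t2 = fst (c T)"
    using S(3) T by (auto simp: t1_def t2_def c_def)
  have "continuous_on {0..T} (\<lambda>s. fst (c s))"
    by (intro continuous_intros continuous_at_imp_continuous_on ballI
      has_vector_derivative_continuous[OF c])
      (use S(3) in blast)
  then have attained: "\<exists>s\<in>{0..T}. fst (c s) = t" if "t \<in> {t1..t2}" for t
    using IVT'[of "\<lambda>s. fst (c s)" 0 t T] that T by (auto simp: ends)
  show thesis
  proof (rule that[of y])
    show "t1 < t2" using strict_mono_onD[OF mono ends(1,2) T] by (simp add: ends)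
    show "y t1 = snd (\<Phi> a)" "y t2 = snd (\<Phi> (a + T *\<^sub>R w))"
      using y[OF ends(1)] y[OF ends(2)] by (simp_all add: t1_def t2_def c_def)
    show "\<exists>s\<in>{0..T}. \<Phi> (a + s *\<^sub>R w) = (t, y t)" if "t \<in> {t1..t2}" for t
      using attained[OF that] y S(3) by (fastforce simp: c_def prod_eq_iff)
    show "velocity_in (subluminal p) t1 t2 y"
    proof (rule velocity_inI_differentiable)
      fix t assume "t \<in> {t1..t2}"
      then obtain s where "s \<in> S" "fst (c s) = t" using attained S(3) by blast
      then show "\<exists>v\<in>subluminal p t. (y has_vector_derivative v) (at t)"
        using y'[of s] future_cone_direction_subluminal[OF future, of s] by auto
    qed
  qed
qed

lemma vertical_time_less:
  assumes "0 < T" "\<And>s. s \<in> {0..T} \<Longrightarrow> a + s *\<^sub>R w \<in> region"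
  shows "fst (\<Phi> a) < fst (\<Phi> (a + T *\<^sub>R w))"
  using vertical_graph[OF assms] by blast

end

section \<open>No boundary points towards the future\<close>

lemma slack_time_estimate:
  assumes t: "0 < a" "a < c" "c < t" "2 * a \<le> t" and m: "0 \<le> m" and b: "0 < b"
    and H: "sqrt (slack m a c t / b) / 2 * (t - a) \<le> H"
  shows "(c powr (1 + m) - a powr (1 + m)) * t powr (1 - m) \<le> 16 * b * H\<^sup>2"
proof -
  define D where "D = c powr (1 + m) - a powr (1 + m)"
  have D: "0 < D" using t m by (simp add: D_def powr_less_mono2)
  have "sqrt (D / t powr (1 + m) / b) / 2 * (t / 2) \<le> sqrt (slack m a c t / b) / 2 * (t - a)"
    using slack_bounds(1,3)[OF t(1-3) m] t b
    by (intro mult_mono divide_right_mono real_sqrt_le_mono) (auto simp: D_def)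
  also have "\<dots> \<le> H" by (rule H)
  finally have "(sqrt (D / t powr (1 + m) / b) * t / 4)\<^sup>2 \<le> H\<^sup>2"
    using D t b by (intro power_mono) auto
  then have "D * t\<^sup>2 / t powr (1 + m) \<le> 16 * b * H\<^sup>2"
    using D b t by (simp add: power_mult_distrib power_divide field_simps)
  moreover have "t\<^sup>2 = t powr (1 - m) * t powr (1 + m)" using t by (simp flip: powr_add)
  ultimately show ?thesis using t by (simp add: D_def)
qed

context kasner_chart
begin

lemma exponents_uniformly_bounded:
  obtains m where "0 \<le> m" "m < 1" "\<And>i. \<bar>p i\<bar> \<le> m"
proof
  show "Max (range (\<lambda>i. \<bar>p i\<bar>)) < 1"
    by (subst Max_less_iff) (auto simp: abs_exponent_less_1)
  show bound: "\<bar>p i\<bar> \<le> Max (range (\<lambda>i. \<bar>p i\<bar>))" for i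
    by (rule Max_ge) auto
  show "0 \<le> Max (range (\<lambda>i. \<bar>p i\<bar>))"
    using bound[of undefined] by linarith
qed

lemma slow_graph_height_gain:
  assumes ac: "a \<le> c" and e: "0 < e"
    and k: "velocity_in (\<lambda>t. {v. spatial_norm p t v \<le> 1 - e}) a c k"
    and W: "\<And>t. t \<in> {a..c} \<Longrightarrow> (t, k t) \<in> W"
  shows "sqrt (e / b) / 2 * (c - a) \<le> height (\<Psi> (c, k c)) - height (\<Psi> (a, k a))"
proof -
  define \<sigma> where "\<sigma> = sqrt (e / b) / 2"
  have \<sigma>: "\<sigma> < sqrt (e / b)" using e b_pos by (simp add: \<sigma>_def)
  have gain: "\<sigma> < height (\<Psi>' (t, k t) (1, v))" if t: "t \<in> {a..c}"
      and v: "spatial_norm p t v \<le> 1 - e" for t v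
  proof -
    have "(spatial_norm p t v)\<^sup>2 \<le> (spatial_norm p t v) * 1"
      unfolding power2_eq_square using v e by (intro mult_left_mono) auto
    then have "kasner_g p (t, k t) (1, v) (1, v) \<le> - e" using v by (simp add: kasner_g_diag)
    then have "(norm (hor (\<Psi>' (t, k t) (1, v))))\<^sup>2 / b + e \<le> b * (height (\<Psi>' (t, k t) (1, v)))\<^sup>2"
      using kasner_g_pinched(1)[OF W[OF t], of "(1, v)"] by simp
    moreover have "0 \<le> (norm (hor (\<Psi>' (t, k t) (1, v))))\<^sup>2 / b" using b_pos by simp
    ultimately have "e \<le> b * (height (\<Psi>' (t, k t) (1, v)))\<^sup>2" by linarith
    then have "e / b \<le> (height (\<Psi>' (t, k t) (1, v)))\<^sup>2"
      using b_pos by (simp add: pos_divide_le_eq mult.commute)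
    then have "sqrt (e / b) \<le> \<bar>height (\<Psi>' (t, k t) (1, v))\<bar>"
      using real_sqrt_le_mono by fastforce
    moreover have "0 < height (\<Psi>' (t, k t) (1, v))"
      using v e by (intro height_\<Psi>'_pos W t) (simp add: subluminal_def)
    ultimately show ?thesis using \<sigma> by simp
  qed
  have "height (\<Psi> (a, k a)) - \<sigma> * fst (a, k a) \<le> height (\<Psi> (c, k c)) - \<sigma> * fst (c, k c)"
  proof (rule velocity_in_positive_mono[OF ac])
    show "velocity_in (\<lambda>t. (\<lambda>v. height (\<Psi>' (t, k t) v) - \<sigma> * fst v) ` Pair 1
        ` {v. spatial_norm p t v \<le> 1 - e}) a c
        (\<lambda>t. height (\<Psi> (t, k t)) - \<sigma> * fst (t, k t))"
      by (rule velocity_in_compose[OF velocity_in_graph[OF k]])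
        (intro has_derivative_diff height.has_derivative \<Psi>_has_derivative W has_derivative_mult_right
          bounded_linear_imp_has_derivative bounded_linear_fst)
    show "(\<lambda>v. height (\<Psi>' (t, k t) v) - \<sigma> * fst v) ` Pair 1 ` {v. spatial_norm p t v \<le> 1 - e} \<subseteq> {0<..}"
      if "t \<in> {a..<c}" for t
      using gain[of t] that by auto
  qed
  then show ?thesis by (simp add: \<sigma>_def algebra_simps diff_divide_distrib)
qed

lemma time_unbounded_below_boundary:
  assumes s0: "0 < s0" and axis: "\<And>s. 0 < s \<Longrightarrow> s \<le> s0 \<Longrightarrow> - (s *\<^sub>R w) \<in> region"
  obtains s where "0 < s" "s < s0" "T < fst (\<Phi> (- (s *\<^sub>R w)))"
proof -
  have "\<exists>s. 0 < s \<and> s < s0 \<and> T < fst (\<Phi> (- (s *\<^sub>R w)))"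
  proof (rule ccontr)
    assume "\<not> ?thesis"
    then have bounded: "fst (\<Phi> (- (s *\<^sub>R w))) \<le> T" if "0 < s" "s < s0" for s using that by force
    define q where "q = - (s0 *\<^sub>R w)"
    define s where "s = (\<lambda>k. s0 / real (k + 2))"
    have s: "0 < s k" "s k < s0" for k
      using s0 mult_strict_left_mono[of 1 "real (k + 2)" s0] by (simp_all add: s_def divide_less_eq)
    have time_q: "0 < fst (\<Phi> q)" using axis[of s0] s0 by (simp add: q_def \<Phi>_in_W time_pos)
    have "0 \<in> region"
    proof (rule limit_in_region[OF _ _ zero_in_cylinder compact_future_box
        future_box_subset_kasner_M[OF time_q]])
      show "- (s k *\<^sub>R w) \<in> region" for k using axis s[of k] by simp
      have "s \<longlonglongrightarrow> 0"
        using LIMSEQ_ignore_initial_segment[OF lim_const_over_n[of s0], of 2] by (simp add: s_def)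
      then have "(\<lambda>k. - (s k *\<^sub>R w)) \<longlonglongrightarrow> - (0 *\<^sub>R w)" by (intro tendsto_intros)
      then show "(\<lambda>k. - (s k *\<^sub>R w)) \<longlonglongrightarrow> 0" by simp
      fix k
      have "causal_bound p (\<Phi> q) (\<Phi> (q + (s0 - s k) *\<^sub>R w))"
      proof (rule causal_bound_along_vertical)
        fix r assume "r \<in> {0..s0 - s k}"
        then show "q + r *\<^sub>R w \<in> region"
          using axis[of "s0 - r"] s[of k] by (simp add: q_def algebra_simps)
      qed (use s[of k] in simp)
      moreover have "q + (s0 - s k) *\<^sub>R w = - (s k *\<^sub>R w)" by (simp add: q_def algebra_simps)
      ultimately show "\<Phi> (- (s k *\<^sub>R w)) \<in> future_box p (\<Phi> q) T"
        using bounded[OF s] by (intro causal_bound_imp_mem_future_box exponent_less_1 time_q) simp_all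
    qed
    then show False using zero_notin_region by simp
  qed
  then show thesis using that by blast
qed

lemma earlier_start:
  assumes x: "x \<in> region" and V: "open V" "x \<in> V"
  obtains a where "0 < a" "a < fst (\<Phi> x)"
    "\<And>t. t \<in> {a..fst (\<Phi> x)} \<Longrightarrow> (t, snd (\<Phi> x)) \<in> W \<and> \<Psi> (t, snd (\<Phi> x)) \<in> V"
proof -
  have "open (W \<inter> \<Psi> -` V)"
    by (rule continuous_open_preimage[OF continuous_on_\<Psi> open_W V(1)])
  moreover have "\<Phi> x \<in> W \<inter> \<Psi> -` V" using V(2) x by (simp add: \<Phi>_in_W \<Psi>_\<Phi>)
  ultimately obtain e where e: "0 < e" "ball (\<Phi> x) e \<subseteq> W \<inter> \<Psi> -` V" using open_contains_ball by blast
  have near: "(t, snd (\<Phi> x)) \<in> W \<inter> \<Psi> -` V" if "t \<in> {fst (\<Phi> x) - e / 2..fst (\<Phi> x)}" for t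
  proof -
    have "dist (\<Phi> x) (t, snd (\<Phi> x)) = dist (fst (\<Phi> x)) t"
      by (simp add: dist_prod_def)
    also have "\<dots> < e" using that e by (simp add: dist_real_def)
    finally show ?thesis using e(2) by auto
  qed
  then have "0 < fst (\<Phi> x) - e / 2" using time_pos[of "(fst (\<Phi> x) - e / 2, snd (\<Phi> x))"] e(1) by simp
  then show thesis
    by (rule that) (use near e(1) in auto)
qed

lemma waiting_vertical_graph:
  assumes T: "0 < T" and seg: "\<And>s. s \<in> {0..T} \<Longrightarrow> q + s *\<^sub>R w \<in> region"
    and a: "a < fst (\<Phi> q)" "\<And>t. t \<in> {a..fst (\<Phi> q)} \<Longrightarrow> (t, snd (\<Phi> q)) \<in> W"
  defines "t0 \<equiv> fst (\<Phi> q)" and "t1 \<equiv> fst (\<Phi> (q + T *\<^sub>R w))"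
  obtains c where "t0 < t1" "velocity_in (subluminal p) a t1 c" "\<And>t. t \<in> {a..t1} \<Longrightarrow> (t, c t) \<in> W"
    "c a = snd (\<Phi> q)" "c t0 = snd (\<Phi> q)" "(t1, c t1) = \<Phi> (q + T *\<^sub>R w)"
proof -
  obtain y where t01: "t0 < t1" and y: "velocity_in (subluminal p) t0 t1 y"
    and y_vertical: "\<And>t. t \<in> {t0..t1} \<Longrightarrow> \<exists>s\<in>{0..T}. \<Phi> (q + s *\<^sub>R w) = (t, y t)"
    and y_ends: "y t0 = snd (\<Phi> q)" "y t1 = snd (\<Phi> (q + T *\<^sub>R w))"
    using vertical_graph[OF T seg, folded t0_def t1_def] by blast
  have a0: "a < t0" using a(1) by (simp add: t0_def)
  define c where "c = (\<lambda>t. if t < t0 then snd (\<Phi> q) else y t)"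
  show thesis
  proof (rule that[OF t01, of c])
    show "velocity_in (subluminal p) a t1 c"
      unfolding c_def by (intro velocity_in_join velocity_in_const y) (use a0 t01 y_ends in auto)
    show "(t, c t) \<in> W" if t: "t \<in> {a..t1}" for t
    proof (cases "t < t0")
      case True
      then show ?thesis using a(2)[of t] t by (simp add: c_def t0_def)
    next
      case False
      then obtain s where "s \<in> {0..T}" "\<Phi> (q + s *\<^sub>R w) = (t, y t)" using y_vertical[of t] t by auto
      then show ?thesis using \<Phi>_in_W[OF seg[of s]] False by (simp add: c_def)
    qed
    show "(t1, c t1) = \<Phi> (q + T *\<^sub>R w)" using t01 y_ends(2) by (simp add: c_def) (simp add: t1_def)
  qed (use a0 y_ends in \<open>simp_all add: c_def\<close>)
qed

text \<open>Starting earlier, at time \<open>a\<close>, a curve with the same endpoints as the vertical segment can be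
  slower than light by a definite amount, so its lift gains height in proportion to the elapsed time.\<close>
lemma vertical_elapsed_time:
  assumes T: "0 < T" and seg: "\<And>s. s \<in> {0..T} \<Longrightarrow> q + s *\<^sub>R w \<in> region"
    and a: "0 < a" "a < fst (\<Phi> q)" "\<And>t. t \<in> {a..fst (\<Phi> q)} \<Longrightarrow> (t, snd (\<Phi> q)) \<in> W"
    and m: "0 \<le> m" "\<And>i. \<bar>p i\<bar> \<le> m"
    and trunc: "truncated_cone b (\<Psi> (a, snd (\<Phi> q))) (height q + T) \<subseteq> cylinder h"
  defines "t0 \<equiv> fst (\<Phi> q)" and "t1 \<equiv> fst (\<Phi> (q + T *\<^sub>R w))"
  shows "sqrt (slack m a t0 t1 / b) / 2 * (t1 - a) \<le> height q + T - height (\<Psi> (a, snd (\<Phi> q)))"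
proof -
  obtain c where t01: "t0 < t1"
      and c: "velocity_in (subluminal p) a t1 c" "\<And>t. t \<in> {a..t1} \<Longrightarrow> (t, c t) \<in> W"
    and c_ends: "c a = snd (\<Phi> q)" "c t0 = snd (\<Phi> q)" "(t1, c t1) = \<Phi> (q + T *\<^sub>R w)"
    using waiting_vertical_graph[OF T seg a(2,3), folded t0_def t1_def] by blast
  have a0: "a < t0" using a by (simp add: t0_def)
  define e where "e = slack m a t0 t1"
  have e: "0 < e" unfolding e_def by (rule slack_bounds(1)[OF a(1) a0 t01 m(1)])
  define k where "k = (\<lambda>t. c (delay m e t1 t))"
  have k_ends: "k a = snd (\<Phi> q)" "k t1 = c t1"
    using delay_slack[OF a(1) a0 t01 m(1)] delay_fixed[of t1 m e] a(1) a0 t01 m(1) c_ends(2)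
    by (simp_all add: k_def e_def)
  have "- p i \<le> m" for i using m(2)[of i] by linarith
  then have slow: "velocity_in (\<lambda>t. {v. spatial_norm p t v \<le> 1 - e}) a t1 k"
    unfolding k_def e_def using a0
    by (intro delayed_graph_slow a(1) t01 m(1) velocity_in_subinterval[OF c(1)]) auto
  then have k: "velocity_in (subluminal p) a t1 k"
    by (rule velocity_in_mono) (use e in \<open>auto simp: subluminal_def\<close>)
  have top: "q + T *\<^sub>R w \<in> region" using seg[of T] T by simp
  have "(t, k t) \<in> W" if t: "t \<in> {a..t1}" for t
  proof (rule graph_deformation_in_W[OF a(1) _ c(1) k _ c(2) _ _ t])
    show "(t1, x) \<in> W \<and> height (\<Psi> (t1, x)) \<le> height q + T" if "x \<in> closed_segment (c t1) (k t1)" for x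
      using that top by (simp add: k_ends c_ends(3) \<Phi>_in_W \<Psi>_\<Phi> splitting_simps)
    show "truncated_cone b (\<Psi> (a, c a)) (height q + T) \<subseteq> cylinder h"
      using trunc by (simp add: c_ends)
  qed (use a0 t01 c_ends k_ends in auto)
  then have "sqrt (e / b) / 2 * (t1 - a) \<le> height (\<Psi> (t1, k t1)) - height (\<Psi> (a, k a))"
    using slow_graph_height_gain[OF _ e slow] a0 t01 by simp
  also have "\<Psi> (t1, k t1) = q + T *\<^sub>R w" unfolding k_ends c_ends(3) by (rule \<Psi>_\<Phi>[OF top])
  finally show ?thesis by (simp add: splitting_simps k_ends e_def)
qed

lemma early_start_below_boundary:
  assumes s0: "0 < s0" and axis: "\<And>s. 0 < s \<Longrightarrow> s \<le> s0 \<Longrightarrow> - (s *\<^sub>R w) \<in> region"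
  obtains s a where "0 < s" "s \<le> s0" "0 < a" "a < fst (\<Phi> (- (s *\<^sub>R w)))"
    "\<And>t. t \<in> {a..fst (\<Phi> (- (s *\<^sub>R w)))} \<Longrightarrow> (t, snd (\<Phi> (- (s *\<^sub>R w)))) \<in> W"
    "- h < height (\<Psi> (a, snd (\<Phi> (- (s *\<^sub>R w)))))"
    "truncated_cone b (\<Psi> (a, snd (\<Phi> (- (s *\<^sub>R w))))) 0 \<subseteq> cylinder h"
proof -
  define s where "s = min s0 (h / (5 * b))"
  have s: "0 < s" "s \<le> s0" using s0 h_pos b_pos by (auto simp: s_def)
  have "b * s \<le> b * (h / (5 * b))" using b_pos by (intro mult_left_mono) (auto simp: s_def)
  then have b_s: "b * s \<le> h / 5" using b_pos by simp
  then have s_h: "s \<le> h / 5" using mult_right_mono[OF b_ge_1, of s] s by linarith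
  define q where "q = - (s *\<^sub>R w)"
  have q: "q \<in> region" using axis s by (simp add: q_def)
  define V where "V = {x. - 2 * s < height x \<and> norm (hor x) < h / 5}"
  have V: "open V" unfolding V_def
    by (intro open_Collect_conj open_Collect_less continuous_intros)
  have q_V: "q \<in> V" using s h_pos by (simp add: V_def q_def splitting_simps)
  obtain a where a: "0 < a" "a < fst (\<Phi> q)" "\<And>t. t \<in> {a..fst (\<Phi> q)} \<Longrightarrow> (t, snd (\<Phi> q)) \<in> W"
    and a_V: "\<And>t. t \<in> {a..fst (\<Phi> q)} \<Longrightarrow> \<Psi> (t, snd (\<Phi> q)) \<in> V"
    by (rule earlier_start[OF q V q_V]) blast
  define x where "x = \<Psi> (a, snd (\<Phi> q))"
  have x: "- 2 * s < height x" "norm (hor x) < h / 5" using a_V[of a] a(2) by (auto simp: V_def x_def)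
  have "b * (0 - height x) \<le> b * (2 * s)" using x(1) b_pos by (intro mult_left_mono) auto
  then have "truncated_cone b x 0 \<subseteq> cylinder h"
    using x b_s s_h h_pos by (intro truncated_cone_subset_cylinder b_pos) linarith+
  moreover have "- h < height x" using x(1) s_h h_pos by linarith
  ultimately show thesis
    using that[of s a] s a unfolding q_def x_def by blast
qed

lemma no_future_boundary:
  assumes s0: "0 < s0" and axis: "\<And>s. 0 < s \<Longrightarrow> s \<le> s0 \<Longrightarrow> - (s *\<^sub>R w) \<in> region"
  shows False
proof -
  obtain s1 a where s1: "0 < s1" "s1 \<le> s0"
    and a: "0 < a" "a < fst (\<Phi> (- (s1 *\<^sub>R w)))"
      "\<And>t. t \<in> {a..fst (\<Phi> (- (s1 *\<^sub>R w)))} \<Longrightarrow> (t, snd (\<Phi> (- (s1 *\<^sub>R w)))) \<in> W"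
    and start: "- h < height (\<Psi> (a, snd (\<Phi> (- (s1 *\<^sub>R w)))))"
      "truncated_cone b (\<Psi> (a, snd (\<Phi> (- (s1 *\<^sub>R w))))) 0 \<subseteq> cylinder h"
    by (rule early_start_below_boundary[OF s0 axis]) blast+
  define t0 where "t0 = fst (\<Phi> (- (s1 *\<^sub>R w)))"
  obtain m where m: "0 \<le> m" "m < 1" "\<And>i. \<bar>p i\<bar> \<le> m" using exponents_uniformly_bounded by blast
  define D where "D = t0 powr (1 + m) - a powr (1 + m)"
  have D: "0 < D" using a m by (simp add: D_def t0_def powr_less_mono2)
  define C where "C = 16 * b * h\<^sup>2 / D + 1"
  have C: "0 < C" using D b_pos by (simp add: C_def add_nonneg_pos)
  have axis_s1: "- (s *\<^sub>R w) \<in> region" if "0 < s" "s \<le> s1" for s using axis that s1(2) by simp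
  obtain s where s: "0 < s" "s < s1"
    and late: "max (2 * t0) (C powr (1 / (1 - m))) < fst (\<Phi> (- (s *\<^sub>R w)))"
    using time_unbounded_below_boundary[OF s1(1) axis_s1] by blast
  define t where "t = fst (\<Phi> (- (s *\<^sub>R w)))"
  have T: "- (s1 *\<^sub>R w) + (s1 - s) *\<^sub>R w = - (s *\<^sub>R w)" "height (- (s1 *\<^sub>R w)) + (s1 - s) = - s"
    by (simp_all add: algebra_simps splitting_simps)
  have "sqrt (slack m a t0 t / b) / 2 * (t - a) \<le> - s - height (\<Psi> (a, snd (\<Phi> (- (s1 *\<^sub>R w)))))"
  proof (rule vertical_elapsed_time[OF _ _ a m(1,3), of "s1 - s", unfolded T, folded t_def t0_def])
    show "- (s1 *\<^sub>R w) + s' *\<^sub>R w \<in> region" if "s' \<in> {0..s1 - s}" for s'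
      using axis_s1[of "s1 - s'"] that s by (simp add: algebra_simps)
    show "truncated_cone b (\<Psi> (a, snd (\<Phi> (- (s1 *\<^sub>R w))))) (- s) \<subseteq> cylinder h"
      using start(2) s(1) by (auto simp: truncated_cone_def)
  qed (use s in simp)
  also have "\<dots> \<le> h" using start s by linarith
  finally have "D * t powr (1 - m) \<le> 16 * b * h\<^sup>2"
    unfolding D_def using a m late b_pos by (intro slack_time_estimate) (auto simp: t_def t0_def)
  then have "t powr (1 - m) < C" using D by (simp add: C_def field_simps)
  moreover have "C \<le> t powr (1 - m)"
    using powr_mono2[of "1 - m" "C powr (1 / (1 - m))" t] late m C by (simp add: t_def powr_powr)
  ultimately show False by simp
qed

end

section \<open>No boundary points towards the past\<close>

locale past_boundary_chart = kasner_chart height w p W \<Psi> \<Psi>' h b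
  for height :: "'n::finite spt \<Rightarrow> real" and w p W \<Psi> \<Psi>' h b +
  fixes \<eta> r :: real
  assumes \<eta>_pos: "0 < \<eta>" and \<eta>_small: "6 * (b * \<eta>) < h" and r_pos: "0 < r" and r_small: "2 * r \<le> \<kappa> * \<eta>"
    and slab_subset_region: "slab \<eta> (2 * \<eta>) r \<subseteq> region"
    and axis_in_region: "0 < s \<Longrightarrow> s \<le> 2 * \<eta> \<Longrightarrow> s *\<^sub>R w \<in> region"
begin

lemma r_le: "2 * r \<le> \<eta>"
  using r_small mult_right_mono[OF \<kappa>_bounds(2), of \<eta>] \<eta>_pos by linarith

lemma \<eta>_less: "6 * \<eta> < h"
  using \<eta>_small mult_right_mono[OF b_ge_1, of \<eta>] \<eta>_pos by linarith

definition visible :: "'n spt set" where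
  "visible = {x. norm (hor x) < r \<and> height x < 2 * \<eta> \<and>
     (\<forall>s\<in>{height x..2 * \<eta>}. hor x + s *\<^sub>R w \<in> region)}"

lemma visible_bounds: "x \<in> visible \<Longrightarrow> norm (hor x) < r" "x \<in> visible \<Longrightarrow> height x < 2 * \<eta>"
  by (simp_all add: visible_def)

lemma visible_vertical:
  assumes "x \<in> visible" "0 \<le> s" "height x + s \<le> 2 * \<eta>"
  shows "x + s *\<^sub>R w \<in> region"
proof -
  have "hor x + (height x + s) *\<^sub>R w \<in> region" using assms by (simp add: visible_def)
  then show ?thesis by (simp add: hor_def algebra_simps)
qed

lemma visible_subset_region: "visible \<subseteq> region"
  using visible_vertical[of _ 0] visible_bounds(2) by fastforce

lemma visible_time_pos: "x \<in> visible \<Longrightarrow> 0 < fst (\<Phi> x)"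
  using visible_subset_region by (auto intro: time_pos \<Phi>_in_W)

lemma visible_down:
  assumes x: "x \<in> visible" and s: "0 \<le> s" "\<And>s'. s' \<in> {0..s} \<Longrightarrow> x - s' *\<^sub>R w \<in> region"
  shows "x - s *\<^sub>R w \<in> visible"
proof -
  have "hor x + s' *\<^sub>R w \<in> region" if s': "height x - s \<le> s'" "s' \<le> 2 * \<eta>" for s'
  proof (cases "height x \<le> s'")
    case True
    then show ?thesis using x s' by (simp add: visible_def)
  next
    case False
    then have "x - (height x - s') *\<^sub>R w \<in> region" using s(2)[of "height x - s'"] s' by simp
    then show ?thesis by (simp add: hor_def algebra_simps)
  qed
  then show ?thesis using x s by (auto simp: visible_def splitting_simps)
qed

lemma visible_height_lower:
  assumes x: "x \<in> visible"
  shows "- \<eta> < height x"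
proof (rule ccontr)
  assume "\<not> - \<eta> < height x"
  then have le: "height x \<le> - \<eta>" by simp
  define a where "a = hor x - \<eta> *\<^sub>R w"
  have a: "height a = - \<eta>" "hor a = hor x" by (simp_all add: a_def splitting_simps)
  have "0 \<in> region"
  proof (rule diamond_subset_region[of "2 * \<eta>" a])
    fix s assume s: "s \<in> {0..2 * \<eta>}"
    have "hor x + (s - \<eta>) *\<^sub>R w \<in> region" using x le s \<eta>_pos by (simp add: visible_def)
    then show "a + s *\<^sub>R w \<in> region" by (simp add: a_def algebra_simps)
  next
    have "(2 * norm (hor x)) * \<eta> \<le> (\<kappa> * \<eta>) * \<eta>"
      using visible_bounds(1)[OF x] r_small \<eta>_pos by (intro mult_right_mono) auto
    then show "2 * \<eta> * norm (hor (0 - a)) \<le> \<kappa> * (height (0 - a) * (2 * \<eta> - height (0 - a)))"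
      by (simp add: splitting_simps a mult_ac)
    have "\<kappa> * (2 * \<eta>) \<le> 1 * (2 * \<eta>)" by (rule mult_right_mono[OF \<kappa>_bounds(2)]) (use \<eta>_pos in simp)
    then show "norm (hor a) + \<kappa> * (2 * \<eta>) < h"
      using visible_bounds(1)[OF x] r_le \<eta>_less \<eta>_pos unfolding a by linarith
  qed (use \<eta>_pos a in \<open>auto simp: splitting_simps\<close>)
  then show False using zero_notin_region by simp
qed

lemma visible_in_slab: "x \<in> visible \<Longrightarrow> x \<in> slab (- \<eta>) (2 * \<eta>) r"
  using visible_height_lower[of x] visible_bounds[of x] by (simp add: slab_def)

lemma slab_subset_cylinder: "slab (- \<eta>) (2 * \<eta>) r \<subseteq> cylinder h"
  using \<eta>_less \<eta>_pos r_le r_pos by (auto simp: slab_def cylinder_def)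

lemma open_visible: "open visible"
proof -
  define S where "S = {x. \<forall>q\<in>{0..1}. hor x + ((1 - q) * height x + q * (2 * \<eta>)) *\<^sub>R w \<in> region}"
  have "open S" unfolding S_def
    by (rule open_Collect_Ball_compact[OF compact_Icc open_region])
      (auto simp: case_prod_unfold intro!: continuous_intros)
  moreover have "open {x. norm (hor x) < r \<and> height x < 2 * \<eta>}"
    by (intro open_Collect_conj open_Collect_less continuous_intros)
  moreover have "x \<in> visible \<longleftrightarrow> norm (hor x) < r \<and> height x < 2 * \<eta> \<and> x \<in> S" for x
  proof (cases "height x < 2 * \<eta>")
    case True
    then have "{height x..2 * \<eta>} = (\<lambda>q. (1 - q) * height x + q * (2 * \<eta>)) ` {0..1}"
      using closed_segment_eq_real_ivl1[of "height x" "2 * \<eta>"]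
      by (simp add: closed_segment_image_interval)
    then show ?thesis by (simp add: visible_def S_def)
  qed (simp add: visible_def)
  then have "visible = {x. norm (hor x) < r \<and> height x < 2 * \<eta>} \<inter> S" by auto
  ultimately show ?thesis by (simp add: open_Int)
qed

lemma visible_diamond:
  assumes a: "a \<in> visible"
    and x: "0 < \<rho>" "\<rho> \<le> height (x - a)" "height x \<le> \<eta>" "3 * norm (hor (x - a)) \<le> \<kappa> * \<rho>"
  shows "x \<in> region"
proof (rule diamond_subset_region[of "2 * \<eta> - height a" a])
  define T where "T = 2 * \<eta> - height a"
  have T: "0 < T" "T \<le> 3 * \<eta>"
    using visible_height_lower[OF a] visible_bounds(2)[OF a] by (simp_all add: T_def)
  then show "0 < 2 * \<eta> - height a" by (simp add: T_def)
  show "a + s *\<^sub>R w \<in> region" if "s \<in> {0..2 * \<eta> - height a}" for s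
    using visible_vertical[OF a] that by simp
  show "0 < height (x - a)" "height (x - a) < 2 * \<eta> - height a"
    using x \<eta>_pos by (auto simp: height.diff)
  have "T * norm (hor (x - a)) \<le> 3 * \<eta> * norm (hor (x - a))" using T by (intro mult_right_mono) auto
  also have "\<dots> \<le> \<kappa> * (\<rho> * \<eta>)" using mult_left_mono[OF x(4), of \<eta>] \<eta>_pos by (simp add: mult_ac)
  also have "\<dots> \<le> \<kappa> * (height (x - a) * (T - height (x - a)))"
    using x \<eta>_pos \<kappa>_bounds by (intro mult_left_mono mult_mono) (auto simp: T_def height.diff)
  finally show "(2 * \<eta> - height a) * norm (hor (x - a))
      \<le> \<kappa> * (height (x - a) * (2 * \<eta> - height a - height (x - a)))"
    by (simp add: T_def)
  have "\<kappa> * T \<le> 1 * T" by (rule mult_right_mono[OF \<kappa>_bounds(2)]) (use T in simp)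
  then show "norm (hor a) + \<kappa> * (2 * \<eta> - height a) < h"
    using visible_bounds(1)[OF a] r_le \<eta>_less T \<eta>_pos unfolding T_def[symmetric] by linarith
qed

lemma above_visible_limit_in_region:
  assumes a: "\<forall>\<^sub>F n in sequentially. a n \<in> visible" "a \<longlonglongrightarrow> a'"
    and x: "hor x = hor a'" "height a' < height x" "height x \<le> \<eta>"
  shows "x \<in> region"
proof -
  define \<rho> where "\<rho> = (height x - height a') / 2"
  have \<rho>: "0 < \<rho>" using x(2) by (simp add: \<rho>_def)
  have "\<forall>\<^sub>F n in sequentially. dist (hor (a n)) (hor a') < \<kappa> * \<rho> / 3"
    by (rule tendstoD[OF hor.tendsto[OF a(2)]]) (use \<rho> \<kappa>_bounds in simp)
  moreover have "\<forall>\<^sub>F n in sequentially. dist (height (a n)) (height a') < \<rho>"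
    by (rule tendstoD[OF height.tendsto[OF a(2)] \<rho>])
  ultimately have "\<forall>\<^sub>F n in sequentially. a n \<in> visible \<and> dist (hor (a n)) (hor a') < \<kappa> * \<rho> / 3 \<and>
      dist (height (a n)) (height a') < \<rho>"
    using a(1) by (intro eventually_conj)
  then obtain n where n: "a n \<in> visible" "dist (hor (a n)) (hor a') < \<kappa> * \<rho> / 3"
      "dist (height (a n)) (height a') < \<rho>"
    using eventually_happens by force
  show ?thesis
  proof (rule visible_diamond[OF n(1) \<rho> _ x(3)])
    have "2 * \<rho> = height x - height a'" by (simp add: \<rho>_def)
    then show "\<rho> \<le> height (x - a n)" using n(3) unfolding dist_real_def height.diff by linarith
    show "3 * norm (hor (x - a n)) \<le> \<kappa> * \<rho>"
      using n(2) by (simp add: hor.diff x(1) dist_norm norm_minus_commute)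
  qed
qed

lemma vertical_descent_near:
  assumes "x \<in> region"
  obtains d U where "0 < d" "open U" "x \<in> U" "\<And>y s. y \<in> U \<Longrightarrow> s \<in> {0..d} \<Longrightarrow> y - s *\<^sub>R w \<in> region"
proof -
  have "open {s. x - s *\<^sub>R w \<in> region}"
    by (intro open_vimage[OF open_region, unfolded vimage_def] continuous_intros)
  moreover have "0 \<in> {s. x - s *\<^sub>R w \<in> region}" using assms by simp
  ultimately obtain d where d: "0 < d" "cball 0 d \<subseteq> {s. x - s *\<^sub>R w \<in> region}"
    using open_contains_cball by blast
  show thesis
  proof (rule that[OF d(1)])
    show "open {y. \<forall>s\<in>{0..d}. y - s *\<^sub>R w \<in> region}"
      by (rule open_Collect_Ball_compact[OF compact_Icc open_region])
        (auto simp: case_prod_unfold intro!: continuous_intros)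
    show "x \<in> {y. \<forall>s\<in>{0..d}. y - s *\<^sub>R w \<in> region}" using d(2) by (auto simp: subset_eq)
  qed simp
qed

lemma visible_closed_in_region:
  assumes X: "\<And>n::nat. X n \<in> visible" "X \<longlonglongrightarrow> x"
    and x: "x \<in> region" "norm (hor x) < r" "height x < 2 * \<eta>"
  shows "x \<in> visible"
proof -
  obtain d U where d: "0 < d" and U: "open U" "x \<in> U"
    and descent: "\<And>y s. y \<in> U \<Longrightarrow> s \<in> {0..d} \<Longrightarrow> y - s *\<^sub>R w \<in> region"
    by (rule vertical_descent_near[OF x(1)]) blast
  have "\<forall>\<^sub>F n in sequentially. X n \<in> U" by (rule topological_tendstoD[OF X(2) U])
  then have below: "\<forall>\<^sub>F n in sequentially. X n - d *\<^sub>R w \<in> visible"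
  proof eventually_elim
    case (elim n)
    show ?case by (rule visible_down[OF X(1)]) (use d descent[OF elim] in auto)
  qed
  have lim: "(\<lambda>n. X n - d *\<^sub>R w) \<longlonglongrightarrow> x - d *\<^sub>R w" by (intro tendsto_intros X)
  have "hor x + s *\<^sub>R w \<in> region" if s: "s \<in> {height x..2 * \<eta>}" for s
  proof (cases "\<eta> \<le> s")
    case True
    then have "hor x + s *\<^sub>R w \<in> slab \<eta> (2 * \<eta>) r" using s x by (simp add: slab_def splitting_simps)
    then show ?thesis using slab_subset_region by blast
  next
    case False
    then show ?thesis
      using s d by (intro above_visible_limit_in_region[OF below lim]) (simp_all add: splitting_simps)
  qed
  then show ?thesis using x by (simp add: visible_def)
qed

lemma compact_\<Phi>_slab: "compact (\<Phi> ` slab \<eta> (2 * \<eta>) r)"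
  by (rule compact_continuous_image[OF continuous_on_subset[OF continuous_on_\<Phi> slab_subset_region]
    compact_slab])

lemma slab_time_lower_bound:
  obtains \<tau> where "0 < \<tau>" "\<And>x. x \<in> slab \<eta> (2 * \<eta>) r \<Longrightarrow> \<tau> \<le> fst (\<Phi> x)"
proof -
  define S where "S = fst ` \<Phi> ` slab \<eta> (2 * \<eta>) r"
  have compact: "compact S" unfolding S_def
    by (intro compact_continuous_image compact_\<Phi>_slab continuous_intros)
  have "\<eta> *\<^sub>R w \<in> slab \<eta> (2 * \<eta>) r" using \<eta>_pos r_pos by (simp add: slab_def splitting_simps)
  then have "S \<noteq> {}" by (auto simp: S_def)
  from compact_attains_inf[OF compact this] obtain \<tau> where \<tau>: "\<tau> \<in> S" "\<And>t. t \<in> S \<Longrightarrow> \<tau> \<le> t"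
    by blast
  show thesis
  proof (rule that[of \<tau>])
    obtain x where "x \<in> slab \<eta> (2 * \<eta>) r" "\<tau> = fst (\<Phi> x)" using \<tau>(1) by (auto simp: S_def)
    then show "0 < \<tau>" using slab_subset_region by (auto simp: time_pos \<Phi>_in_W)
  qed (use \<tau>(2) in \<open>simp add: S_def\<close>)
qed

lemma visible_limit_in_region:
  assumes X: "\<And>n::nat. X n \<in> visible" "X \<longlonglongrightarrow> x" "x \<in> cylinder h" and t: "0 < t" "\<And>n. t \<le> fst (\<Phi> (X n))"
  shows "x \<in> region"
proof -
  obtain B where B: "\<And>z. z \<in> \<Phi> ` slab \<eta> (2 * \<eta>) r \<Longrightarrow> norm z \<le> B"
    using compact_imp_bounded[OF compact_\<Phi>_slab] unfolding bounded_iff by blast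
  define A where "A = B + spatial_radius p B"
  show ?thesis
  proof (rule limit_in_region[OF _ X(2,3), of "{t..B} \<times> cball 0 A"])
    show "X n \<in> region" for n using X(1) visible_subset_region by blast
    show "compact ({t..B} \<times> cball (0 :: real ^ 'n) A)"
      by (intro compact_Times compact_Icc compact_cball)
    show "{t..B} \<times> cball (0 :: real ^ 'n) A \<subseteq> kasner_M" using t(1) by (auto simp: mem_kasner_M_iff)
    fix n
    define y where "y = X n + (2 * \<eta> - height (X n)) *\<^sub>R w"
    have "y \<in> slab \<eta> (2 * \<eta>) r"
      using visible_bounds(1)[OF X(1), of n] \<eta>_pos by (simp add: y_def slab_def splitting_simps)
    then have y: "norm (\<Phi> y) \<le> B" by (intro B) blast
    have causal: "causal_bound p (\<Phi> (X n)) (\<Phi> y)"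
      unfolding y_def
      by (rule causal_bound_along_vertical)
        (use visible_vertical[OF X(1)] visible_bounds(2)[OF X(1), of n] in auto)
    have y_bounds: "fst (\<Phi> y) \<le> B" "norm (snd (\<Phi> y)) \<le> B"
      using y norm_fst_le[of "fst (\<Phi> y)" "snd (\<Phi> y)"] norm_snd_le[of "snd (\<Phi> y)" "fst (\<Phi> y)"]
      by simp_all
    have "dist (snd (\<Phi> (X n))) (snd (\<Phi> y)) \<le> spatial_radius p B"
      by (rule causal_bound_dist_le[OF exponent_less_1 causal visible_time_pos[OF X(1)] y_bounds(1)])
    then have "norm (snd (\<Phi> (X n))) \<le> A"
      using y_bounds(2) norm_triangle_sub[of "snd (\<Phi> (X n))" "snd (\<Phi> y)"] by (simp add: A_def dist_norm)
    then show "\<Phi> (X n) \<in> {t..B} \<times> cball 0 A"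
      using t(2)[of n] causal y_bounds(1) by (auto simp: mem_Times_iff causal_bound_def)
  qed
qed

lemma visible_time_small_near_0:
  assumes t: "0 < t"
  obtains e where "0 < e" "\<And>x. x \<in> visible \<Longrightarrow> norm x < e \<Longrightarrow> fst (\<Phi> x) < t"
proof -
  have "\<exists>e>0. \<forall>x. x \<in> visible \<and> norm x < e \<longrightarrow> fst (\<Phi> x) < t"
  proof (rule ccontr)
    assume neg: "\<not> ?thesis"
    have "\<exists>x. x \<in> visible \<and> norm x < 1 / real (Suc n) \<and> t \<le> fst (\<Phi> x)" for n
    proof -
      have "1 / real (Suc n) > 0" by simp
      with neg show ?thesis by (meson linorder_not_less)
    qed
    then obtain X where
      X: "\<And>n. X n \<in> visible" "\<And>n. norm (X n) < 1 / real (Suc n)" "\<And>n. t \<le> fst (\<Phi> (X n))"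
      by metis
    have "X \<longlonglongrightarrow> 0" by (rule LIMSEQ_norm_0[OF X(2)])
    then have "0 \<in> region" by (rule visible_limit_in_region[OF X(1) _ zero_in_cylinder t X(3)])
    then show False using zero_notin_region by simp
  qed
  then show thesis using that by blast
qed

lemma visible_slice_point_exists:
  assumes \<tau>: "0 < \<tau>" "\<And>x. x \<in> slab \<eta> (2 * \<eta>) r \<Longrightarrow> \<tau> \<le> fst (\<Phi> x)"
    and u: "height u = 0" "norm u < r"
  obtains x where "x \<in> visible" "hor x = u" "fst (\<Phi> x) = \<tau>"
proof -
  define c where "c s = u + (\<eta> - s) *\<^sub>R w" for s
  have c: "height (c s) = \<eta> - s" "hor (c s) = u" for s
    using u by (simp_all add: c_def splitting_simps hor_eq)
  have cont_c: "continuous_on S c" for S unfolding c_def by (intro continuous_intros)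
  have "u + s *\<^sub>R w \<in> region" if "s \<in> {\<eta>..2 * \<eta>}" for s
    using that u slab_subset_region by (auto simp: slab_def splitting_simps hor_eq)
  then have start: "c 0 \<in> visible" using u \<eta>_pos by (simp add: visible_def c)
  have exit: "c (2 * \<eta>) \<notin> visible" using visible_height_lower[of "c (2 * \<eta>)"] by (auto simp: c)
  obtain s where s: "0 < s" "s \<le> 2 * \<eta>" "c s \<notin> visible" and before: "\<And>t. 0 \<le> t \<Longrightarrow> t < s \<Longrightarrow> c t \<in> visible"
    by (rule first_exit_time[OF cont_c open_visible start exit]) (use \<eta>_pos in auto)
  have "\<exists>t\<in>{0..<s}. fst (\<Phi> (c t)) \<le> \<tau>"
  proof (rule ccontr)
    assume "\<not> ?thesis"
    then have late: "\<tau> \<le> fst (\<Phi> (c t))" if "t \<in> {0..<s}" for t using that by force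
    have "s \<in> closure {0..<s}" using s(1) by simp
    then obtain S where S: "\<And>n. S n \<in> {0..<s}" "S \<longlonglongrightarrow> s" by (auto simp: closure_sequential)
    have S_visible: "c (S n) \<in> visible" for n using before S(1)[of n] by simp
    have lim: "(\<lambda>n. c (S n)) \<longlonglongrightarrow> c s" unfolding c_def by (intro tendsto_intros S)
    have "c s \<in> cylinder h"
      using s u \<eta>_pos slab_subset_cylinder by (auto simp: slab_def c)
    then have "c s \<in> region" by (rule visible_limit_in_region[OF S_visible lim _ \<tau>(1) late[OF S(1)]])
    then have "c s \<in> visible"
      by (rule visible_closed_in_region[OF S_visible lim]) (use s u \<eta>_pos in \<open>auto simp: c\<close>)
    with s(3) show False by simp
  qed
  then obtain t where t: "t \<in> {0..<s}" "fst (\<Phi> (c t)) \<le> \<tau>" by blast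
  have "continuous_on {0..t} (\<lambda>s. fst (\<Phi> (c s)))"
    using before t(1) visible_subset_region
    by (intro continuous_on_fst continuous_on_compose2[OF continuous_on_\<Phi> cont_c]) auto
  moreover have "\<tau> \<le> fst (\<Phi> (c 0))" using u \<eta>_pos by (intro \<tau>(2)) (simp add: slab_def c)
  ultimately obtain t' where "t' \<in> {0..t}" "fst (\<Phi> (c t')) = \<tau>"
    using IVT2'[of "\<lambda>s. fst (\<Phi> (c s))" t \<tau> 0] t by auto
  then show thesis using before[of t'] t c by (intro that[of "c t'"]) auto
qed

text \<open>Vectors tangent to a slice of constant \<open>t\<close> are spacelike, so the metric bounds their Kasner
  length by the chart length of their horizontal part.\<close>
lemma slice_tangent_bound:
  assumes x: "x \<in> region" and v: "fst (\<Phi>' x v) = 0"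
  shows "\<bar>snd (\<Phi>' x v) $ j\<bar> \<le> sqrt b * norm (hor v) * fst (\<Phi> x) powr (- p j)"
proof -
  define t where "t = fst (\<Phi> x)"
  have t: "0 < t" using x by (simp add: t_def time_pos \<Phi>_in_W)
  have "(spatial_norm p t (snd (\<Phi>' x v)))\<^sup>2 = kasner_g p (\<Phi> x) (\<Phi>' x v) (\<Phi>' x v)"
    by (simp add: kasner_g_diag v t_def)
  also have "\<dots> \<le> b * (norm (hor v))\<^sup>2 - (height v)\<^sup>2 / b"
    using kasner_g_pinched(2)[OF \<Phi>_in_W[OF x], of "\<Phi>' x v"] by (simp add: \<Psi>'_\<Phi>'[OF x])
  also have "\<dots> \<le> (sqrt b * norm (hor v))\<^sup>2" using b_pos by (simp add: power_mult_distrib)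
  finally have "spatial_norm p t (snd (\<Phi>' x v)) \<le> sqrt b * norm (hor v)"
    by (rule power2_le_imp_le) (use b_pos in simp)
  with component_le_spatial_norm[of t p j "snd (\<Phi>' x v)"]
  have "t powr p j * \<bar>snd (\<Phi>' x v) $ j\<bar> \<le> sqrt b * norm (hor v)" by (rule order_trans)
  then show ?thesis using t by (simp add: t_def[symmetric] powr_minus field_simps)
qed

definition slice_coordinates :: "'n spt \<Rightarrow> 'n spt" where
  "slice_coordinates x = hor x + fst (\<Phi> x) *\<^sub>R w"

lemma inj_on_slice_coordinates: "inj_on slice_coordinates visible"
proof (rule inj_onI)
  fix x y assume x: "x \<in> visible" and y: "y \<in> visible"
      and eq: "slice_coordinates x = slice_coordinates y"
  have hor: "hor x = hor y"
    using arg_cong[OF eq, of hor] by (simp add: slice_coordinates_def splitting_simps)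
  have time: "fst (\<Phi> x) = fst (\<Phi> y)"
    using arg_cong[OF eq, of height] by (simp add: slice_coordinates_def splitting_simps)
  have less: "fst (\<Phi> x) < fst (\<Phi> y)"
    if xy: "x \<in> visible" "y \<in> visible" "hor x = hor y" "height x < height y" for x y
  proof -
    have "x + (height y - height x) *\<^sub>R w = y"
      by (rule splitting_eqI) (simp_all add: splitting_simps xy(3))
    then show ?thesis
      using vertical_time_less[of "height y - height x" x] visible_vertical[OF xy(1)]
        visible_bounds(2)[OF xy(2)] xy(4)
      by simp
  qed
  have "height x = height y"
    using less[OF x y hor] less[OF y x hor[symmetric]] time by linarith
  with hor show "x = y" by (rule splitting_eqI)
qed

definition slice_coordinates' :: "'n spt \<Rightarrow> 'n spt \<Rightarrow> 'n spt" where
  "slice_coordinates' x v = hor v + fst (\<Phi>' x v) *\<^sub>R w"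

lemma slice_coordinates'_splitting:
  "height (slice_coordinates' x v) = fst (\<Phi>' x v)" "hor (slice_coordinates' x v) = hor v"
  by (simp_all add: slice_coordinates'_def splitting_simps)

lemma slice_coordinates_has_derivative:
  "x \<in> region \<Longrightarrow> (slice_coordinates has_derivative slice_coordinates' x) (at x)"
  unfolding slice_coordinates_def slice_coordinates'_def
  by (intro has_derivative_add hor.has_derivative[OF has_derivative_ident]
      bounded_linear.has_derivative[OF bounded_linear_scaleR_left]
      bounded_linear.has_derivative[OF bounded_linear_fst] \<Phi>_has_derivative)

lemma inj_slice_coordinates':
  assumes x: "x \<in> region"
  shows "inj (slice_coordinates' x)"
  unfolding linear_injective_0[OF has_derivative_linear[OF slice_coordinates_has_derivative[OF x]]]
proof (intro allI impI)
  fix v assume "slice_coordinates' x v = 0"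
  then have v: "fst (\<Phi>' x v) = 0" "hor v = 0"
    using slice_coordinates'_splitting[of x v] by (simp_all add: splitting_simps)
  then have v_w: "v = height v *\<^sub>R w" using hor_add_height[of v] by simp
  then have "\<Phi>' x v = height v *\<^sub>R \<Phi>' x w"
    by (metis has_derivative_linear[OF \<Phi>_has_derivative[OF x]] linear_scale)
  moreover have "0 < fst (\<Phi>' x w)"
    using \<Phi>'_steep[OF x] w_steep by (auto intro: future_cone_fst_pos)
  ultimately have "height v = 0" using v by simp
  then show "v = 0" using v_w by simp
qed

definition slice_point :: "'n spt \<Rightarrow> 'n spt" where
  "slice_point = inv_into visible slice_coordinates"

lemma slice_point_slice_coordinates: "x \<in> visible \<Longrightarrow> slice_point (slice_coordinates x) = x"
  by (simp add: slice_point_def inv_into_f_f inj_on_slice_coordinates)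

lemma slice_line_component_derivative:
  assumes x: "x \<in> visible"
    and c: "c q = slice_coordinates x" "(c has_vector_derivative u) (at q within S)"
    and u: "height u = 0"
  shows "\<exists>d. ((\<lambda>q. snd (\<Phi> (slice_point (c q))) $ j) has_real_derivative d) (at q within S) \<and>
    \<bar>d\<bar> \<le> sqrt b * norm u * fst (\<Phi> x) powr (- p j)"
proof -
  have x_region: "x \<in> region" using x visible_subset_region by blast
  have derivative: "(slice_coordinates has_derivative slice_coordinates' y) (at y)"
      if "y \<in> visible" for y
    using that visible_subset_region by (intro slice_coordinates_has_derivative) blast
  define v where "v = inv (slice_coordinates' x) u"
  have "surj (slice_coordinates' x)"
    by (rule linear_inj_imp_surj[OF has_derivative_linear[OF derivative[OF x]]
      inj_slice_coordinates'[OF x_region]])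
  then have "slice_coordinates' x v = u" by (simp add: v_def surj_f_inv_f)
  then have v: "fst (\<Phi>' x v) = 0" "norm (hor v) = norm u"
    using slice_coordinates'_splitting[of x v] u by (simp_all add: hor_eq)
  have "(slice_point has_derivative inv (slice_coordinates' x)) (at (c q))"
    unfolding slice_point_def c(1)
    by (rule inv_into_has_derivative[OF open_visible inj_on_slice_coordinates derivative x
          inj_slice_coordinates'[OF x_region]])
  from vector_derivative_diff_chain_within[OF c(2) has_derivative_at_withinI[OF this]]
  have "(slice_point \<circ> c has_vector_derivative v) (at q within S)" by (simp add: v_def)
  moreover have "(\<Phi> has_derivative \<Phi>' x) (at ((slice_point \<circ> c) q) within (slice_point \<circ> c) ` S)"
    using has_derivative_at_withinI[OF \<Phi>_has_derivative[OF x_region]] x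
    by (simp add: c(1) slice_point_slice_coordinates)
  ultimately have "(\<Phi> \<circ> (slice_point \<circ> c) has_vector_derivative \<Phi>' x v) (at q within S)"
    by (rule vector_derivative_diff_chain_within)
  from bounded_linear.has_vector_derivative[OF bounded_linear_compose[OF
      bounded_linear_vec_nth[of j] bounded_linear_snd] this]
  have "((\<lambda>q. snd (\<Phi> (slice_point (c q))) $ j) has_real_derivative snd (\<Phi>' x v) $ j) (at q within S)"
    by (simp add: o_def has_real_derivative_iff_has_vector_derivative)
  then show ?thesis using slice_tangent_bound[OF x_region v(1), of j] v(2) by auto
qed

lemma slice_component_bound:
  assumes \<tau>: "0 < \<tau>" "\<And>x. x \<in> slab \<eta> (2 * \<eta>) r \<Longrightarrow> \<tau> \<le> fst (\<Phi> x)"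
    and x: "x \<in> visible" "fst (\<Phi> x) = \<tau>" and y: "y \<in> visible" "fst (\<Phi> y) = \<tau>"
  shows "\<bar>snd (\<Phi> y) $ j - snd (\<Phi> x) $ j\<bar> \<le> sqrt b * (2 * r) * \<tau> powr (- p j)"
proof -
  define B where "B = sqrt b * (2 * r) * \<tau> powr (- p j)"
  define u where "u = hor y - hor x"
  define c where "c q = hor x + q *\<^sub>R u + \<tau> *\<^sub>R w" for q
  define f where "f q = snd (\<Phi> (slice_point (c q))) $ j" for q
  have u: "height u = 0" by (simp add: u_def splitting_simps)
  have "norm u \<le> 2 * r"
    using norm_triangle_ineq4[of "hor y" "hor x"] visible_bounds(1)[OF x(1)] visible_bounds(1)[OF y(1)]
    by (simp add: u_def)
  then have u_B: "sqrt b * norm u * \<tau> powr (- p j) \<le> B"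
    unfolding B_def using b_pos by (intro mult_right_mono mult_left_mono) auto
  have "\<exists>d. (f has_real_derivative d) (at q within {0..1}) \<and> \<bar>d\<bar> \<le> B" if q: "q \<in> {0..1}" for q
  proof -
    have "(1 - q) *\<^sub>R hor x + q *\<^sub>R hor y \<in> ball 0 r"
      by (rule convexD[OF convex_ball])
        (use q visible_bounds(1)[OF x(1)] visible_bounds(1)[OF y(1)] in auto)
    then have "norm (hor x + q *\<^sub>R u) < r" by (simp add: u_def algebra_simps)
    then obtain z where z: "z \<in> visible" "hor z = hor x + q *\<^sub>R u" "fst (\<Phi> z) = \<tau>"
      using visible_slice_point_exists[OF \<tau>, of "hor x + q *\<^sub>R u"] u by (auto simp: splitting_simps)
    have "c q = slice_coordinates z" by (simp add: c_def slice_coordinates_def z)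
    moreover have "(c has_vector_derivative u) (at q within {0..1})"
      unfolding c_def by (auto intro!: derivative_eq_intros)
    ultimately show ?thesis
      using slice_line_component_derivative[OF z(1) _ _ u, of c q "{0..1}" j] u_B z(3)
      unfolding f_def by fastforce
  qed
  then obtain d where d: "\<And>q. q \<in> {0..1} \<Longrightarrow> (f has_real_derivative d q) (at q within {0..1})"
    "\<And>q. q \<in> {0..1} \<Longrightarrow> \<bar>d q\<bar> \<le> B" by metis
  have "norm (f 1 - f 0) \<le> B * norm (1 - 0 :: real)"
    by (rule field_differentiable_bound[of "{0..1}" f d]) (use d in auto)
  moreover have "c 0 = slice_coordinates x" "c 1 = slice_coordinates y"
    by (simp_all add: c_def slice_coordinates_def u_def x y)
  ultimately show ?thesis by (simp add: f_def B_def slice_point_slice_coordinates x(1) y(1))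
qed

definition comoving_visible :: "'n spt \<Rightarrow> real \<Rightarrow> bool" where
  "comoving_visible x s \<longleftrightarrow> (s, snd (\<Phi> x)) \<in> W \<and> \<Psi> (s, snd (\<Phi> x)) \<in> visible"

lemma comoving_visible_limit:
  assumes x: "x \<in> visible" and \<rho>: "\<rho> < r" and m: "0 < m" "m < fst (\<Phi> x)"
    and above: "\<And>s. s \<in> {m<..fst (\<Phi> x)} \<Longrightarrow> comoving_visible x s \<and> norm (hor (\<Psi> (s, snd (\<Phi> x)))) < \<rho>"
  shows "comoving_visible x m" "norm (hor (\<Psi> (m, snd (\<Phi> x)))) \<le> \<rho>"
proof -
  define T where "T = fst (\<Phi> x)"
  define y where "y = snd (\<Phi> x)"
  have near: "(s, y) \<in> W" "\<Psi> (s, y) \<in> visible" "norm (hor (\<Psi> (s, y))) < \<rho>" if "s \<in> {m<..T}" for s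
    using above[of s] that by (auto simp: comoving_visible_def T_def y_def)
  have "x \<in> region" using x visible_subset_region by blast
  then have "\<Psi> (T, y) = x" by (simp add: T_def y_def \<Psi>_\<Phi>)
  then have below_x: "height (\<Psi> (s, y)) \<le> height x" if "s \<in> {m<..T}" for s
    using graph_height_mono[OF _ velocity_in_const[of "subluminal p"], of s T y] near(1) that by auto
  have "m \<in> closure {m<..T}" using m by (simp add: T_def)
  then obtain S where S: "\<And>n. S n \<in> {m<..T}" "S \<longlonglongrightarrow> m" by (auto simp: closure_sequential)
  have lim: "(\<lambda>n. (S n, y)) \<longlonglongrightarrow> (m, y)" by (intro tendsto_intros S)
  have m_W: "(m, y) \<in> W"
    by (rule limit_in_W_compact[OF near(1)[OF S(1)] lim _ compact_slab slab_subset_cylinder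
          visible_in_slab[OF near(2)[OF S(1)]]])
      (use m in \<open>simp add: mem_kasner_M_iff\<close>)
  have lim_\<Psi>: "(\<lambda>n. \<Psi> (S n, y)) \<longlonglongrightarrow> \<Psi> (m, y)"
    by (rule continuous_on_tendsto_compose[OF continuous_on_\<Psi> lim m_W]) (simp add: near(1)[OF S(1)])
  have hor_le: "norm (hor (\<Psi> (m, y))) \<le> \<rho>"
    by (rule LIMSEQ_le_const2[OF tendsto_norm[OF hor.tendsto[OF lim_\<Psi>]]])
      (use near(3)[OF S(1)] less_imp_le in blast)
  then show "norm (hor (\<Psi> (m, snd (\<Phi> x)))) \<le> \<rho>" by (simp add: y_def)
  have "height (\<Psi> (m, y)) \<le> height x"
    by (rule LIMSEQ_le_const2[OF height.tendsto[OF lim_\<Psi>]]) (use below_x[OF S(1)] in blast)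
  then have "\<Psi> (m, y) \<in> visible"
    using hor_le \<rho> visible_bounds(2)[OF x]
    by (intro visible_closed_in_region[OF near(2)[OF S(1)] lim_\<Psi> \<Psi>_in_region[OF m_W]]) auto
  then show "comoving_visible x m" using m_W by (simp add: comoving_visible_def y_def)
qed

lemma comoving_exit:
  assumes x: "x \<in> visible" "norm (hor x) < \<rho>" and \<rho>: "\<rho> < r"
    and t: "0 < t" "t \<le> fst (\<Phi> x)" "\<not> comoving_visible x t"
  obtains m where "m \<le> fst (\<Phi> x)" "\<And>s. s \<in> {m..fst (\<Phi> x)} \<Longrightarrow> comoving_visible x s"
    "norm (hor (\<Psi> (m, snd (\<Phi> x)))) = \<rho>"
proof -
  define T where "T = fst (\<Phi> x)"
  define y where "y = snd (\<Phi> x)"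
  define V where "V = W \<inter> \<Psi> -` (visible \<inter> {x. norm (hor x) < \<rho>})"
  define c where "c s = (T - s, y)" for s
  have c_V: "c s \<in> V \<longleftrightarrow> comoving_visible x (T - s) \<and> norm (hor (\<Psi> (T - s, y))) < \<rho>" for s
    by (auto simp: c_def V_def comoving_visible_def y_def)
  have "x \<in> region" using x visible_subset_region by blast
  then have start: "c 0 \<in> V" using x \<Phi>_in_W \<Psi>_\<Phi> by (simp add: c_def V_def T_def y_def)
  have open_V: "open V" unfolding V_def
    by (intro continuous_open_preimage[OF continuous_on_\<Psi> open_W] open_Int open_visible
      open_Collect_less
        continuous_intros)
  have cont: "continuous_on {0..T - t} c" unfolding c_def by (intro continuous_intros)
  have exit: "c (T - t) \<notin> V" using t(3) by (simp add: c_V)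
  obtain s where s: "0 < s" "s \<le> T - t" "c s \<notin> V" and before: "\<And>s'. 0 \<le> s' \<Longrightarrow> s' < s \<Longrightarrow> c s' \<in> V"
    by (rule first_exit_time[OF cont open_V start exit]) (use t(2) in \<open>auto simp: T_def\<close>)
  define m where "m = T - s"
  have m: "0 < m" "m < T" using s t by (simp_all add: m_def)
  have above: "comoving_visible x s' \<and> norm (hor (\<Psi> (s', snd (\<Phi> x)))) < \<rho>" if "s' \<in> {m<..T}" for s'
    using before[of "T - s'"] that by (simp add: c_V m_def y_def)
  note limit = comoving_visible_limit[OF x(1) \<rho> m(1) m(2)[unfolded T_def] above[unfolded T_def]]
  show thesis
  proof (rule that[of m])
    show "norm (hor (\<Psi> (m, snd (\<Phi> x)))) = \<rho>"
      using s(3) limit by (simp add: c_V m_def y_def)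
    show "comoving_visible x s'" if "s' \<in> {m..fst (\<Phi> x)}" for s'
      using above[of s'] limit(1) that by (cases "s' = m") (auto simp: T_def)
  qed (use m in \<open>simp add: T_def\<close>)
qed

lemma comoving_wall_point:
  assumes x: "x \<in> visible" "norm (hor x) < r / 4" "\<bar>height x\<bar> < r / (16 * b)"
    and t: "0 < t" "t \<le> fst (\<Phi> x)" "\<not> comoving_visible x t"
  obtains z where "z \<in> visible" "snd (\<Phi> z) = snd (\<Phi> x)" "fst (\<Phi> z) \<le> fst (\<Phi> x)"
    "height z < - 3 * (r / (16 * b))"
proof -
  have "norm (hor x) < r / 2" "r / 2 < r" using x(2) r_pos by auto
  then obtain m where m: "m \<le> fst (\<Phi> x)" "\<And>s. s \<in> {m..fst (\<Phi> x)} \<Longrightarrow> comoving_visible x s"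
    and wall: "norm (hor (\<Psi> (m, snd (\<Phi> x)))) = r / 2"
    using comoving_exit[OF x(1) _ _ t, of "r / 2"] by blast
  define z where "z = \<Psi> (m, snd (\<Phi> x))"
  have z: "z \<in> visible" "\<Phi> z = (m, snd (\<Phi> x))"
    using m(2)[of m] m(1) by (simp_all add: z_def comoving_visible_def \<Phi>_\<Psi>)
  have "x \<in> region" using x(1) visible_subset_region by blast
  then have "x - z \<in> cone b"
    using graph_lift_in_cone[OF m(1) velocity_in_const[of "subluminal p"], of "snd (\<Phi> x)"] m(2)
    by (simp add: z_def comoving_visible_def \<Psi>_\<Phi>)
  then have "norm (hor x - hor z) \<le> b * (height x - height z)" by (simp add: cone_def splitting_simps)
  moreover have "norm (hor z) - norm (hor x) \<le> norm (hor x - hor z)"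
    by (metis norm_minus_commute norm_triangle_ineq2)
  ultimately have "r / 4 < b * (height x - height z)" using x(2) wall by (simp add: z_def)
  then have "4 * (r / (16 * b)) < height x - height z" using b_pos by (simp add: field_simps)
  then have "height z < - 3 * (r / (16 * b))" using x(3) by linarith
  with z m(1) show thesis by (intro that[of z]) auto
qed

lemma raised_limit_in_region:
  assumes z: "\<And>n::nat. z n \<in> visible" "\<And>n. height (z n) < - 3 * \<alpha>" and \<alpha>: "0 < \<alpha>"
  obtains q Q where "strict_mono q" "Q \<in> region" "height Q \<le> - 2 * \<alpha>" "(\<lambda>n. z (q n) + \<alpha> *\<^sub>R w) \<longlonglongrightarrow> Q"
proof -
  have "z n \<in> slab (- \<eta>) (- 3 * \<alpha>) r" for n
    using visible_height_lower[OF z(1)] visible_bounds(1)[OF z(1)] z(2)[of n]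
    by (simp add: slab_def less_imp_le)
  then obtain q z' where z': "z' \<in> slab (- \<eta>) (- 3 * \<alpha>) r" and q: "strict_mono q" "(z \<circ> q) \<longlonglongrightarrow> z'"
    using compact_slab[of "- \<eta>" "- 3 * \<alpha>" r] unfolding compact_def by meson
  define Q where "Q = z' + \<alpha> *\<^sub>R w"
  have height_Q: "height Q \<le> - 2 * \<alpha>" using z' by (simp add: Q_def slab_def splitting_simps)
  have "Q \<in> region"
    by (rule above_visible_limit_in_region[OF _ q(2)])
      (use z(1) height_Q \<alpha> \<eta>_pos in \<open>auto simp: Q_def splitting_simps\<close>)
  moreover have "(\<lambda>n. z (q n) + \<alpha> *\<^sub>R w) \<longlonglongrightarrow> Q"
    unfolding Q_def using q(2) by (intro tendsto_intros) (simp add: o_def)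
  ultimately show thesis using q(1) height_Q by (intro that)
qed

text \<open>The vertical segment above \<open>z\<close> is replaced by the comoving line through \<open>z\<close> up to time \<open>t\<close>,
  followed by a translate of the remaining segment. The displacement is at most \<open>spatial_radius p t\<close>.\<close>
lemma comoving_height_less:
  assumes \<alpha>: "0 < \<alpha>" and seg: "\<And>s. s \<in> {0..\<alpha>} \<Longrightarrow> z + s *\<^sub>R w \<in> region"
    and t: "fst (\<Phi> z) \<le> t" "t < fst (\<Phi> (z + \<alpha> *\<^sub>R w))"
    and top: "ball (\<Phi> (z + \<alpha> *\<^sub>R w)) \<delta> \<subseteq> W \<inter> \<Psi> -` {x. height x < L}" "spatial_radius p t < \<delta>"
    and trunc: "truncated_cone b z L \<subseteq> cylinder h"
  shows "height (\<Psi> (t, snd (\<Phi> z))) < L"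
proof -
  define m where "m = fst (\<Phi> z)"
  define y where "y = snd (\<Phi> z)"
  define T where "T = fst (\<Phi> (z + \<alpha> *\<^sub>R w))"
  obtain c where c: "velocity_in (subluminal p) m T c"
    "\<And>t. t \<in> {m..T} \<Longrightarrow> \<exists>s\<in>{0..\<alpha>}. \<Phi> (z + s *\<^sub>R w) = (t, c t)"
    and c_ends: "c m = y" "c T = snd (\<Phi> (z + \<alpha> *\<^sub>R w))"
    using vertical_graph[OF \<alpha> seg] unfolding m_def T_def y_def by blast
  have "z \<in> region" using seg[of 0] \<alpha> by simp
  then have m: "0 < m" "\<Psi> (m, y) = z" by (simp_all add: m_def y_def \<Phi>_in_W time_pos \<Psi>_\<Phi>)
  have mt: "m \<le> t" "t < T" using t by (simp_all add: m_def T_def)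
  obtain k where k: "velocity_in (subluminal p) m T k" "k m = c m" "k t = c m"
    "dist (c T) (k T) \<le> spatial_radius p t"
    by (rule waiting_translated_graph[OF exponent_less_1 c(1) m(1) mt])
  have final: "(T, x) \<in> W \<and> height (\<Psi> (T, x)) < L" if "x \<in> closed_segment (c T) (k T)" for x
  proof -
    have "dist (c T) x \<le> dist (c T) (k T)"
      using dist_in_closed_segment[OF that] by (simp add: dist_commute)
    then have "(T, x) \<in> ball (\<Phi> (z + \<alpha> *\<^sub>R w)) \<delta>"
      using k(4) top(2) by (simp add: dist_prod_def T_def[symmetric] c_ends(2)[symmetric])
    then show ?thesis using top(1) by auto
  qed
  have k_W: "(s, k s) \<in> W" if s: "s \<in> {m..T}" for s
  proof (rule graph_deformation_in_W[OF m(1) _ c(1) k(1) _ _ _ _ s])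
    show "(s, c s) \<in> W" if "s \<in> {m..T}" for s using c(2)[OF that] seg \<Phi>_in_W by metis
    show "truncated_cone b (\<Psi> (m, c m)) L \<subseteq> cylinder h" using trunc by (simp add: c_ends m)
  qed (use mt k(2) final less_imp_le in auto)
  have "height (\<Psi> (t, k t)) \<le> height (\<Psi> (T, k T))"
    by (rule graph_height_mono[OF _ velocity_in_subinterval[OF k(1)]]) (use mt k_W in auto)
  also have "\<dots> < L" using final[of "k T"] by simp
  finally show ?thesis by (simp add: k(3) c_ends(1) y_def)
qed

lemma visible_truncated_cone_subset_cylinder:
  assumes "z \<in> visible" "L \<le> 0"
  shows "truncated_cone b z L \<subseteq> cylinder h"
proof (rule truncated_cone_subset_cylinder[OF b_pos])
  have "b * (L - height z) \<le> b * \<eta>"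
    using visible_height_lower[OF assms(1)] assms(2) b_pos by (intro mult_left_mono) auto
  then show "norm (hor z) + b * (L - height z) < h"
    using visible_bounds(1)[OF assms(1)] r_le \<eta>_less \<eta>_small \<eta>_pos by linarith
qed (use visible_height_lower[OF assms(1)] \<eta>_less \<eta>_pos assms(2) h_pos in linarith)+

lemma comoving_height_less_near:
  assumes Q: "Q \<in> region" "height Q < L" and L: "L \<le> 0" and \<alpha>: "0 < \<alpha>"
  obtains \<epsilon> where "0 < \<epsilon>"
    "\<And>z t. \<lbrakk>z \<in> visible; height z + \<alpha> \<le> 2 * \<eta>; dist (\<Phi> (z + \<alpha> *\<^sub>R w)) (\<Phi> Q) < \<epsilon>; fst (\<Phi> z) \<le> t; t < \<epsilon>\<rbrakk>
      \<Longrightarrow> height (\<Psi> (t, snd (\<Phi> z))) < L"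
proof -
  have "open (W \<inter> \<Psi> -` {x. height x < L})"
    by (intro continuous_open_preimage[OF continuous_on_\<Psi> open_W] open_Collect_less continuous_intros)
  moreover have "\<Phi> Q \<in> W \<inter> \<Psi> -` {x. height x < L}" using Q by (simp add: \<Phi>_in_W \<Psi>_\<Phi>)
  ultimately obtain \<delta> where \<delta>: "0 < \<delta>" "ball (\<Phi> Q) \<delta> \<subseteq> W \<inter> \<Psi> -` {x. height x < L}"
    using open_contains_ball by blast
  define TQ where "TQ = fst (\<Phi> Q)"
  have TQ: "0 < TQ" using Q by (simp add: TQ_def \<Phi>_in_W time_pos)
  have "\<forall>\<^sub>F t in at_right 0. spatial_radius p t < \<delta> / 2"
    by (rule order_tendstoD(2)[OF spatial_radius_tendsto_0[OF exponent_less_1]]) (use \<delta>(1) in simp)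
  then obtain t0 where t0: "0 < t0" "\<And>t. 0 < t \<Longrightarrow> t < t0 \<Longrightarrow> spatial_radius p t < \<delta> / 2"
    by (auto simp: eventually_at_right_field)
  show thesis
  proof (rule that[of "min t0 (min (\<delta> / 2) (TQ / 2))"])
    fix z t
    assume z: "z \<in> visible" "height z + \<alpha> \<le> 2 * \<eta>"
        and t: "fst (\<Phi> z) \<le> t" "t < min t0 (min (\<delta> / 2) (TQ / 2))"
      and near: "dist (\<Phi> (z + \<alpha> *\<^sub>R w)) (\<Phi> Q) < min t0 (min (\<delta> / 2) (TQ / 2))"
    have seg: "z + s *\<^sub>R w \<in> region" if "s \<in> {0..\<alpha>}" for s
      by (rule visible_vertical[OF z(1)]) (use that z(2) in auto)
    have "dist (fst (\<Phi> (z + \<alpha> *\<^sub>R w))) TQ < TQ / 2"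
      using dist_fst_le[of "\<Phi> (z + \<alpha> *\<^sub>R w)" "\<Phi> Q"] near by (simp add: TQ_def)
    then have later: "t < fst (\<Phi> (z + \<alpha> *\<^sub>R w))" using t(2) unfolding dist_real_def by linarith
    have "ball (\<Phi> (z + \<alpha> *\<^sub>R w)) (\<delta> / 2) \<subseteq> ball (\<Phi> Q) \<delta>"
      using near by (subst ball_subset_ball_iff) simp
    then have top: "ball (\<Phi> (z + \<alpha> *\<^sub>R w)) (\<delta> / 2) \<subseteq> W \<inter> \<Psi> -` {x. height x < L}" using \<delta>(2) by blast
    have radius: "spatial_radius p t < \<delta> / 2" using t0(2)[of t] visible_time_pos[OF z(1)] t by simp
    show "height (\<Psi> (t, snd (\<Phi> z))) < L"
      by (rule comoving_height_less[OF \<alpha> seg t(1) later top radius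
            visible_truncated_cone_subset_cylinder[OF z(1) L]])
  qed (use t0(1) \<delta>(1) TQ in simp)
qed

text \<open>If comoving lines starting arbitrarily close to the boundary point 0 descended below a fixed
  negative height, the low points \<open>z\<close> would accumulate at a boundary point with the same past endpoint
  in the Kasner coordinates. A point \<open>Q\<close> slightly above would then be causally above points close to
  0, although its height is negative.\<close>
lemma no_descending_comoving_sequence:
  assumes \<alpha>: "0 < \<alpha>" and x: "\<And>n::nat. x n \<in> visible" "x \<longlonglongrightarrow> 0" "\<And>n. - \<alpha> < height (x n)"
    and z: "\<And>n. z n \<in> visible" "\<And>n. height (z n) < - 3 * \<alpha>"
    and comoving: "\<And>n. snd (\<Phi> (z n)) = snd (\<Phi> (x n))" "\<And>n. fst (\<Phi> (z n)) \<le> fst (\<Phi> (x n))"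
  shows False
proof -
  obtain q Q where q: "strict_mono q" and Q: "Q \<in> region" "height Q \<le> - 2 * \<alpha>"
    and lim: "(\<lambda>n. z (q n) + \<alpha> *\<^sub>R w) \<longlonglongrightarrow> Q"
    by (rule raised_limit_in_region[OF z \<alpha>])
  have Q_low: "height Q < - \<alpha>" "- \<alpha> \<le> 0" using Q(2) \<alpha> by simp_all
  obtain \<epsilon> where \<epsilon>: "0 < \<epsilon>" "\<And>z t. \<lbrakk>z \<in> visible; height z + \<alpha> \<le> 2 * \<eta>; dist (\<Phi> (z + \<alpha> *\<^sub>R w)) (\<Phi> Q) < \<epsilon>;
      fst (\<Phi> z) \<le> t; t < \<epsilon>\<rbrakk> \<Longrightarrow> height (\<Psi> (t, snd (\<Phi> z))) < - \<alpha>"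
    by (rule comoving_height_less_near[OF Q(1) Q_low \<alpha>]) blast
  obtain e where e: "0 < e" "\<And>x. x \<in> visible \<Longrightarrow> norm x < e \<Longrightarrow> fst (\<Phi> x) < \<epsilon>"
    by (rule visible_time_small_near_0[OF \<epsilon>(1)]) blast
  have z_top: "height (z n) + \<alpha> \<le> 2 * \<eta>" for n using z(2)[of n] \<alpha> \<eta>_pos by linarith
  then have "z n + \<alpha> *\<^sub>R w \<in> region" for n by (intro visible_vertical[OF z(1)]) (use \<alpha> in auto)
  then have "(\<lambda>n. \<Phi> (z (q n) + \<alpha> *\<^sub>R w)) \<longlonglongrightarrow> \<Phi> Q"
    by (intro continuous_on_tendsto_compose[OF continuous_on_\<Phi> lim Q(1)]) simp
  then have "\<forall>\<^sub>F n in sequentially. dist (\<Phi> (z (q n) + \<alpha> *\<^sub>R w)) (\<Phi> Q) < \<epsilon>"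
    by (rule tendstoD[OF _ \<epsilon>(1)])
  moreover have "\<forall>\<^sub>F n in sequentially. norm (x (q n)) < e"
    using tendstoD[OF LIMSEQ_subseq_LIMSEQ[OF x(2) q] e(1)] by (simp add: o_def)
  ultimately have "\<forall>\<^sub>F n in sequentially. dist (\<Phi> (z (q n) + \<alpha> *\<^sub>R w)) (\<Phi> Q) < \<epsilon> \<and> norm (x (q n)) < e"
    by (rule eventually_conj)
  then obtain n where near: "dist (\<Phi> (z (q n) + \<alpha> *\<^sub>R w)) (\<Phi> Q) < \<epsilon>" "norm (x (q n)) < e"
    using eventually_happens by force
  have "height (\<Psi> (fst (\<Phi> (x (q n))), snd (\<Phi> (z (q n))))) < - \<alpha>"
    by (rule \<epsilon>(2)[OF z(1) z_top near(1) comoving(2) e(2)[OF x(1) near(2)]])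
  then show False using x(3)[of "q n"] x(1)[of "q n"] visible_subset_region by (auto simp: comoving \<Psi>_\<Phi>)
qed

lemma comoving_stays_visible:
  obtains e where "0 < e"
    "\<And>x t. x \<in> visible \<Longrightarrow> norm x < e \<Longrightarrow> 0 < t \<Longrightarrow> t \<le> fst (\<Phi> x) \<Longrightarrow> comoving_visible x t"
proof -
  define \<alpha> where "\<alpha> = r / (16 * b)"
  have \<alpha>: "0 < \<alpha>" using r_pos b_pos by (simp add: \<alpha>_def)
  have "open {x. norm (hor x) < r / 4 \<and> \<bar>height x\<bar> < \<alpha>}"
    by (intro open_Collect_conj open_Collect_less continuous_intros)
  moreover have "0 \<in> {x. norm (hor x) < r / 4 \<and> \<bar>height x\<bar> < \<alpha>}"
    using r_pos \<alpha> by (simp add: splitting_simps)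
  ultimately obtain e0 where e0: "0 < e0" "ball 0 e0 \<subseteq> {x. norm (hor x) < r / 4 \<and> \<bar>height x\<bar> < \<alpha>}"
    using open_contains_ball by blast
  have "\<exists>e>0. \<forall>x t. x \<in> visible \<and> norm x < e \<and> 0 < t \<and> t \<le> fst (\<Phi> x) \<longrightarrow> comoving_visible x t"
  proof (rule ccontr)
    assume neg: "\<not> ?thesis"
    have "\<exists>x z. x \<in> visible \<and> norm x < 1 / real (Suc n) \<and> - \<alpha> < height x \<and> z \<in> visible \<and>
        snd (\<Phi> z) = snd (\<Phi> x) \<and> fst (\<Phi> z) \<le> fst (\<Phi> x) \<and> height z < - 3 * \<alpha>" for n
    proof -
      have "0 < min e0 (1 / real (Suc n))" using e0 by simp
      with neg obtain x t where x: "x \<in> visible" "norm x < min e0 (1 / real (Suc n))"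
        and t: "0 < t" "t \<le> fst (\<Phi> x)" "\<not> comoving_visible x t" by meson
      have "x \<in> ball 0 e0" using x by simp
      then have near: "norm (hor x) < r / 4" "\<bar>height x\<bar> < \<alpha>" using e0 by blast+
      from comoving_wall_point[OF x(1) near[unfolded \<alpha>_def] t]
      obtain z where "z \<in> visible" "snd (\<Phi> z) = snd (\<Phi> x)" "fst (\<Phi> z) \<le> fst (\<Phi> x)" "height z < - 3 * \<alpha>"
        unfolding \<alpha>_def by blast
      then show ?thesis using x near(2) by (intro exI[of _ x] exI[of _ z]) (simp add: abs_less_iff)
    qed
    then obtain x z where
      x: "\<And>n. x n \<in> visible" "\<And>n. norm (x n) < 1 / real (Suc n)" "\<And>n. - \<alpha> < height (x n)"
      and z: "\<And>n. z n \<in> visible" "\<And>n. height (z n) < - 3 * \<alpha>"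
        "\<And>n. snd (\<Phi> (z n)) = snd (\<Phi> (x n))" "\<And>n. fst (\<Phi> (z n)) \<le> fst (\<Phi> (x n))"
      by metis
    show False
      by (rule no_descending_comoving_sequence[OF \<alpha> x(1) LIMSEQ_norm_0[OF x(2)] x(3) z])
  qed
  then show thesis using that by blast
qed

lemma comoving_lines_agree:
  assumes x: "x \<in> visible" "\<And>t. 0 < t \<Longrightarrow> t \<le> fst (\<Phi> x) \<Longrightarrow> comoving_visible x t"
    and y: "y \<in> visible" "\<And>t. 0 < t \<Longrightarrow> t \<le> fst (\<Phi> y) \<Longrightarrow> comoving_visible y t"
    and j: "p j < 0"
  shows "snd (\<Phi> y) $ j = snd (\<Phi> x) $ j"
proof -
  define D where "D = \<bar>snd (\<Phi> y) $ j - snd (\<Phi> x) $ j\<bar>"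
  obtain \<tau>0 where \<tau>0: "0 < \<tau>0" "\<And>x. x \<in> slab \<eta> (2 * \<eta>) r \<Longrightarrow> \<tau>0 \<le> fst (\<Phi> x)"
    by (rule slab_time_lower_bound) blast
  have bound: "D \<le> sqrt b * (2 * r) * \<tau> powr (- p j)"
      if \<tau>: "0 < \<tau>" "\<tau> < min \<tau>0 (min (fst (\<Phi> x)) (fst (\<Phi> y)))" for \<tau>
  proof -
    have "comoving_visible x \<tau>" "comoving_visible y \<tau>" using x(2) y(2) \<tau> by simp_all
    then show ?thesis
      using slice_component_bound[OF \<tau>(1) order_trans[OF _ \<tau>0(2)],
          of "\<Psi> (\<tau>, snd (\<Phi> x))" "\<Psi> (\<tau>, snd (\<Phi> y))" j] \<tau>
      by (simp add: comoving_visible_def \<Phi>_\<Psi> D_def)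
  qed
  have "((\<lambda>\<tau>. sqrt b * (2 * r) * \<tau> powr (- p j)) \<longlongrightarrow> sqrt b * (2 * r) * 0 powr (- p j)) (at_right 0)"
    using j by (intro tendsto_intros tendsto_powr') (auto simp: eventually_at_filter)
  moreover have "\<forall>\<^sub>F \<tau> in at_right 0. D \<le> sqrt b * (2 * r) * \<tau> powr (- p j)"
    unfolding eventually_at_right_field
      using bound \<tau>0(1) visible_time_pos[OF x(1)] visible_time_pos[OF y(1)]
    by (intro exI[of _ "min \<tau>0 (min (fst (\<Phi> x)) (fst (\<Phi> y)))"]) auto
  ultimately have "D \<le> sqrt b * (2 * r) * 0 powr (- p j)"
    by (intro tendsto_lowerbound[OF _ _ trivial_limit_at_right_real])
  then show ?thesis by (simp add: D_def)
qed

lemma no_negative_exponent: "0 \<le> p j"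
proof (rule ccontr)
  assume "\<not> 0 \<le> p j"
  then have j: "p j < 0" by simp
  obtain e where e: "0 < e"
      "\<And>x t. x \<in> visible \<Longrightarrow> norm x < e \<Longrightarrow> 0 < t \<Longrightarrow> t \<le> fst (\<Phi> x) \<Longrightarrow> comoving_visible x t"
    by (rule comoving_stays_visible) blast
  have "((\<lambda>s. s *\<^sub>R w) \<longlongrightarrow> 0 *\<^sub>R w) (at_right 0)" by (intro tendsto_intros)
  then have "\<forall>\<^sub>F s in at_right 0. norm (s *\<^sub>R w) < e" using tendstoD[OF _ e(1)] by fastforce
  then obtain d where d: "0 < d" "\<And>s. 0 < s \<Longrightarrow> s < d \<Longrightarrow> norm (s *\<^sub>R w) < e"
    by (auto simp: eventually_at_right_field)
  define x where "x = (min \<eta> (d / 2)) *\<^sub>R w"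
  have norm_x: "norm x < e" unfolding x_def by (rule d(2)) (use \<eta>_pos d(1) in auto)
  have visible_x: "x \<in> visible"
    using \<eta>_pos d(1) r_pos axis_in_region by (auto simp: x_def visible_def splitting_simps)
  then have "x \<in> region" using visible_subset_region by blast
  define V where "V = W \<inter> \<Psi> -` (visible \<inter> ball 0 e)"
  have "open V" unfolding V_def
    by (intro continuous_open_preimage[OF continuous_on_\<Psi> open_W] open_Int open_visible open_ball)
  moreover have "\<Phi> x \<in> V" using visible_x norm_x \<open>x \<in> region\<close> by (simp add: V_def \<Phi>_in_W \<Psi>_\<Phi>)
  ultimately obtain \<delta> where \<delta>: "0 < \<delta>" "ball (\<Phi> x) \<delta> \<subseteq> V" using open_contains_ball by blast
  define z where "z = \<Phi> x + (0, (\<delta> / 2) *\<^sub>R axis j 1)"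
  have "z \<in> ball (\<Phi> x) \<delta>" using \<delta>(1) by (simp add: z_def dist_norm norm_Pair norm_axis_1)
  then have "z \<in> V" using \<delta>(2) by blast
  then have z: "\<Psi> z \<in> visible" "norm (\<Psi> z) < e" "\<Phi> (\<Psi> z) = z" by (auto simp: V_def \<Phi>_\<Psi>)
  have "snd (\<Phi> (\<Psi> z)) $ j = snd (\<Phi> x) $ j"
    by (rule comoving_lines_agree[OF visible_x e(2)[OF visible_x norm_x] z(1) e(2)[OF z(1,2)] j])
  then show False using \<delta>(1) by (simp add: z(3)) (simp add: z_def axis_def)
qed

end

context kasner_chart
begin

lemma no_past_boundary:
  assumes s0: "0 < s0" and axis: "\<And>s. 0 < s \<Longrightarrow> s \<le> s0 \<Longrightarrow> s *\<^sub>R w \<in> region" and j: "p j < 0"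
  shows False
proof -
  define \<eta> where "\<eta> = min (s0 / 2) (h / (7 * b))"
  have \<eta>: "0 < \<eta>" "2 * \<eta> \<le> s0" using s0 h_pos b_pos by (auto simp: \<eta>_def)
  have "b * \<eta> \<le> b * (h / (7 * b))" using b_pos by (intro mult_left_mono) (auto simp: \<eta>_def)
  then have b_\<eta>: "6 * (b * \<eta>) < h" using b_pos h_pos by simp
  define S where "S = (\<lambda>s. s *\<^sub>R w) ` {\<eta>..2 * \<eta>}"
  have "compact S" unfolding S_def by (intro compact_continuous_image continuous_intros compact_Icc)
  moreover have "S \<subseteq> region" using axis \<eta> by (auto simp: S_def)
  ultimately obtain e where e: "0 < e" "(\<Union>x\<in>S. ball x e) \<subseteq> region"
    using compact_subset_open_imp_ball_epsilon_subset[OF _ open_region] by metis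
  define r where "r = min (e / 2) (\<kappa> * \<eta> / 2)"
  have r: "0 < r" "2 * r \<le> \<kappa> * \<eta>" "r < e" using e \<eta> \<kappa>_bounds by (auto simp: r_def)
  have "slab \<eta> (2 * \<eta>) r \<subseteq> region"
  proof
    fix x assume x: "x \<in> slab \<eta> (2 * \<eta>) r"
    have "x \<in> ball (height x *\<^sub>R w) e"
      using x r by (simp add: slab_def dist_norm norm_minus_commute hor_def)
    moreover have "height x *\<^sub>R w \<in> S" using x by (auto simp: S_def slab_def)
    ultimately show "x \<in> region" using e by blast
  qed
  then interpret past_boundary_chart height w p W \<Psi> \<Psi>' h b \<eta> r
    by unfold_locales (use \<eta> b_\<eta> r axis in auto)
  show False using no_negative_exponent[of j] j by simp
qed

end

section \<open>Continuous Lorentzian metrics near a point\<close>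

definition lorentz_height :: "('v::euclidean_space \<Rightarrow> 'v \<Rightarrow> real) \<Rightarrow> 'v \<Rightarrow> 'v \<Rightarrow> real" where
  "lorentz_height B w v = B w v / B w w"

locale timelike_vector =
  fixes B :: "'v::euclidean_space \<Rightarrow> 'v \<Rightarrow> real" and w :: 'v
  assumes lorentz: "lorentz_form B" and timelike: "B w w < 0"
begin

sublocale form: bounded_bilinear B
  using lorentz by (simp add: lorentz_form_def bilinear_conv_bounded_bilinear)

lemma symmetric: "B u v = B v u"
  using lorentz by (simp add: lorentz_form_def)

sublocale vertical_splitting "lorentz_height B w" w
proof (rule vertical_splitting.intro)
  show "bounded_linear (lorentz_height B w)"
    unfolding lorentz_height_def[abs_def]
    by (rule bounded_linear_compose[OF bounded_linear_divide form.bounded_linear_right])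
  show "lorentz_height B w w = 1" using timelike by (simp add: lorentz_height_def)
qed

lemma orthogonal_pos:
  assumes u: "B w u = 0" "u \<noteq> 0"
  shows "0 < B u u"
proof (rule ccontr)
  assume "\<not> 0 < B u u"
  obtain S where S: "subspace S" "dim S = DIM('v) - 1" "\<And>x. x \<in> S \<Longrightarrow> x \<noteq> 0 \<Longrightarrow> 0 < B x x"
    using lorentz by (auto simp: lorentz_form_def)
  have "w \<noteq> 0" using timelike by (auto simp: form.zero_left)
  moreover have "u \<notin> span {w}" using u timelike by (auto simp: span_singleton form.scaleR_right)
  ultimately have "independent {u, w}" by (simp add: independent_insert)
  moreover have "u \<noteq> w" using timelike u by auto
  ultimately have "dim (span {u, w}) = 2" by (simp add: dim_eq_card_independent)
  moreover have "dim {x + y |x y. x \<in> S \<and> y \<in> span {u, w}} + dim (S \<inter> span {u, w})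
      = dim S + dim (span {u, w})"
    by (rule dim_sums_Int[OF S(1) subspace_span])
  moreover have "dim {x + y |x y. x \<in> S \<and> y \<in> span {u, w}} \<le> DIM('v)" by (rule dim_subset_UNIV)
  moreover have "0 < DIM('v)" by simp
  ultimately have "dim (S \<inter> span {u, w}) \<noteq> 0" using S(2) by linarith
  then obtain x where x: "x \<in> S" "x \<in> span {u, w}" "x \<noteq> 0" by (auto simp: dim_eq_0)
  obtain \<alpha> \<beta> where "x = \<alpha> *\<^sub>R u + \<beta> *\<^sub>R w"
    using x(2) by (auto simp: span_insert span_singleton algebra_simps)
  then have "B x x = \<alpha>\<^sup>2 * B u u + \<beta>\<^sup>2 * B w w"
    by (simp add: form.add_left form.add_right form.scaleR_left form.scaleR_right u
      symmetric[of u w] power2_eq_square)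
  also have "\<dots> \<le> 0"
    using \<open>\<not> 0 < B u u\<close> timelike by (intro add_nonpos_nonpos mult_nonneg_nonpos) auto
  finally show False using S(3)[OF x(1,3)] by simp
qed

lemma orthogonal_coercive:
  obtains m where "0 < m" "\<And>u. B w u = 0 \<Longrightarrow> m * (norm u)\<^sup>2 \<le> B u u"
proof -
  define S where "S = {u. B w u = 0} \<inter> sphere 0 1"
  have "closed {u. B w u = 0}" by (intro closed_Collect_eq form.continuous_on continuous_intros)
  then have "compact S" unfolding S_def by (simp add: closed_Int_compact)
  have "\<exists>m>0. \<forall>u\<in>S. m \<le> B u u"
  proof (cases "S = {}")
    case False
    have "continuous_on S (\<lambda>u. B u u)" by (intro form.continuous_on continuous_intros)
    then obtain u where u: "u \<in> S" "\<And>v. v \<in> S \<Longrightarrow> B u u \<le> B v v"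
      using continuous_attains_inf[OF \<open>compact S\<close> False] by blast
    have "0 < B u u" by (rule orthogonal_pos) (use u in \<open>auto simp: S_def\<close>)
    with u show ?thesis by blast
  qed (auto intro: exI[of _ 1])
  then obtain m where m: "0 < m" "\<And>u. u \<in> S \<Longrightarrow> m \<le> B u u" by blast
  have "m * (norm u)\<^sup>2 \<le> B u u" if u: "B w u = 0" for u
  proof (cases "u = 0")
    case False
    have "(1 / norm u) *\<^sub>R u \<in> S" using False u by (simp add: S_def form.scaleR_right)
    from m(2)[OF this] have "m \<le> (1 / norm u) * ((1 / norm u) * B u u)"
      by (simp add: form.scaleR_right form.scaleR_left)
    then show ?thesis using False by (simp add: field_simps power2_eq_square)
  qed (simp add: form.zero_left)
  with m(1) show thesis by (rule that)
qed

lemma form_splitting: "B v v = B (hor v) (hor v) + B w w * (lorentz_height B w v)\<^sup>2"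
  and form_w_hor: "B w (hor v) = 0"
proof -
  show hor: "B w (hor v) = 0"
    using timelike by (simp add: hor_def form.diff_right form.scaleR_right lorentz_height_def)
  have "B v v = B (hor v + lorentz_height B w v *\<^sub>R w) (hor v + lorentz_height B w v *\<^sub>R w)"
    by (simp add: hor_add_height)
  also have "\<dots> = B (hor v) (hor v) + B w w * (lorentz_height B w v)\<^sup>2"
    by (simp add: form.add_left form.add_right form.scaleR_left form.scaleR_right hor
        symmetric[of "hor v" w] power2_eq_square)
  finally show "B v v = B (hor v) (hor v) + B w w * (lorentz_height B w v)\<^sup>2" .
qed

lemma ex_pinched: "\<exists>b\<ge>1. pinched b (\<lambda>v. B v v)"
proof -
  obtain m where m: "0 < m" "\<And>u. B w u = 0 \<Longrightarrow> m * (norm u)\<^sup>2 \<le> B u u"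
    by (rule orthogonal_coercive) blast
  obtain M where M: "0 < M" "\<And>u v. norm (B u v) \<le> norm u * norm v * M" using form.pos_bounded by blast
  define \<beta> where "\<beta> = - B w w"
  have \<beta>: "0 < \<beta>" using timelike by (simp add: \<beta>_def)
  define b where "b = 1 + 1 / m + M + \<beta> + 1 / \<beta>"
  have b: "1 \<le> b" "1 / m \<le> b" "M \<le> b" "\<beta> \<le> b" "1 / \<beta> \<le> b"
    using m(1) M(1) \<beta> by (simp_all add: b_def)
  then have inverse_b: "1 / b \<le> m" "1 / b \<le> \<beta>" using m(1) \<beta> by (simp_all add: field_simps)
  have "pinched b (\<lambda>v. B v v)"
    unfolding pinched_def
  proof (intro allI conjI)
    fix v
    define t where "t = lorentz_height B w v"
    have B_v: "B v v = B (hor v) (hor v) - \<beta> * t\<^sup>2" by (simp add: form_splitting[of v] t_def \<beta>_def)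
    have "(norm (hor v))\<^sup>2 / b \<le> m * (norm (hor v))\<^sup>2"
      using mult_right_mono[OF inverse_b(1), of "(norm (hor v))\<^sup>2"] by simp
    also have "\<dots> \<le> B (hor v) (hor v)" by (rule m(2)[OF form_w_hor])
    finally have lower: "(norm (hor v))\<^sup>2 / b \<le> B (hor v) (hor v)" .
    have "B (hor v) (hor v) \<le> M * (norm (hor v))\<^sup>2"
      using M(2)[of "hor v" "hor v"] by (simp add: power2_eq_square mult_ac)
    also have "\<dots> \<le> b * (norm (hor v))\<^sup>2" by (rule mult_right_mono[OF b(3)]) simp
    finally have upper: "B (hor v) (hor v) \<le> b * (norm (hor v))\<^sup>2" .
    have "\<beta> * t\<^sup>2 \<le> b * t\<^sup>2" "t\<^sup>2 / b \<le> \<beta> * t\<^sup>2"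
      using mult_right_mono[OF b(4), of "t\<^sup>2"] mult_right_mono[OF inverse_b(2), of "t\<^sup>2"] by simp_all
    with lower upper
    show "(norm (hor v))\<^sup>2 / b - b * (lorentz_height B w v)\<^sup>2 \<le> B v v"
      "B v v \<le> b * (norm (hor v))\<^sup>2 - (lorentz_height B w v)\<^sup>2 / b"
      unfolding B_v t_def by linarith+
  qed
  with b(1) show ?thesis by blast
qed

end

lemma bilinear_abs_le_sum_Basis:
  fixes B :: "'v::euclidean_space \<Rightarrow> 'v \<Rightarrow> real"
  assumes "bilinear B"
  shows "\<bar>B u v\<bar> \<le> (\<Sum>i\<in>Basis. \<Sum>j\<in>Basis. \<bar>B i j\<bar>) * norm u * norm v"
proof -
  interpret B: bounded_bilinear B using assms by (simp add: bilinear_conv_bounded_bilinear)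
  have "B u v = B (\<Sum>i\<in>Basis. (u \<bullet> i) *\<^sub>R i) (\<Sum>j\<in>Basis. (v \<bullet> j) *\<^sub>R j)"
    by (simp add: euclidean_representation)
  also have "\<dots> = (\<Sum>i\<in>Basis. \<Sum>j\<in>Basis. (u \<bullet> i) * ((v \<bullet> j) * B i j))"
    unfolding B.sum_left B.sum_right
    by (simp add: B.scaleR_left B.scaleR_right sum_distrib_left)
      (subst sum.swap, simp add: mult.left_commute)
  also have "\<bar>\<dots>\<bar> \<le> (\<Sum>i\<in>Basis. \<Sum>j\<in>Basis. \<bar>(u \<bullet> i) * ((v \<bullet> j) * B i j)\<bar>)"
    by (intro order_trans[OF sum_abs] sum_mono order_refl)
  also have "\<dots> \<le> (\<Sum>i\<in>Basis. \<Sum>j\<in>Basis. norm u * (norm v * \<bar>B i j\<bar>))"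
    by (intro sum_mono) (auto simp: abs_mult Basis_le_norm intro!: mult_mono)
  also have "\<dots> = (\<Sum>i\<in>Basis. \<Sum>j\<in>Basis. \<bar>B i j\<bar>) * norm u * norm v"
    by (simp add: sum_distrib_left sum_distrib_right mult_ac)
  finally show ?thesis .
qed

lemma bilinear_family_uniformly_close:
  fixes G :: "'v::euclidean_space \<Rightarrow> 'v \<Rightarrow> 'v \<Rightarrow> real"
  assumes X: "open X" "q \<in> X" and G: "\<And>x. x \<in> X \<Longrightarrow> bilinear (G x)"
    and cont: "\<And>u v. continuous_on X (\<lambda>x. G x u v)" and e: "0 < e"
  obtains R where "0 < R" "ball q R \<subseteq> X"
    "\<And>x u v. x \<in> ball q R \<Longrightarrow> \<bar>G x u v - G q u v\<bar> \<le> e * norm u * norm v"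
proof -
  define F where "F x = (\<Sum>i\<in>Basis. \<Sum>j\<in>Basis. \<bar>G x i j - G q i j\<bar>)" for x
  have "continuous_on X F" unfolding F_def by (intro continuous_intros cont)
  then have "open (X \<inter> F -` {..<e})" by (rule continuous_open_preimage[OF _ X(1)]) simp
  moreover have "q \<in> X \<inter> F -` {..<e}" using X e by (simp add: F_def)
  ultimately obtain R where R: "0 < R" "ball q R \<subseteq> X \<inter> F -` {..<e}" using open_contains_ball by blast
  have "\<bar>G x u v - G q u v\<bar> \<le> e * norm u * norm v" if "x \<in> ball q R" for x u v
  proof -
    have x: "x \<in> X" "F x < e" using that R(2) by auto
    have "bilinear (\<lambda>u v. G x u v - G q u v)"
      using G[OF x(1)] G[OF X(2)] by (auto simp: bilinear_def intro: linear_compose_sub)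
    from bilinear_abs_le_sum_Basis[OF this, of u v]
    have "\<bar>G x u v - G q u v\<bar> \<le> F x * norm u * norm v" by (simp add: F_def)
    also have "\<dots> \<le> e * norm u * norm v" using x(2) by (intro mult_right_mono) auto
    finally show ?thesis .
  qed
  then show thesis using R by (intro that) auto
qed

locale continuous_lorentz_field =
  fixes X :: "'v::euclidean_space set" and G :: "'v \<Rightarrow> 'v \<Rightarrow> 'v \<Rightarrow> real"
  assumes open_X: "open X" and lorentz_form_G: "x \<in> X \<Longrightarrow> lorentz_form (G x)"
    and continuous_on_G: "continuous_on X (\<lambda>x. G x u v)"
begin

lemma pinched_near:
  assumes q: "q \<in> X" and w: "G q w w < 0"
  obtains R b where "0 < R" "1 \<le> b" "ball q R \<subseteq> X"
    "\<And>x. x \<in> ball q R \<Longrightarrow> vertical_splitting.pinched (lorentz_height (G q) w) w b (\<lambda>v. G x v v)"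
proof -
  interpret timelike_vector "G q" w by unfold_locales (rule lorentz_form_G[OF q], rule w)
  obtain b where b: "1 \<le> b" "pinched b (\<lambda>v. G q v v)" using ex_pinched by blast
  define e where "e = 1 / (4 * b * (1 + (norm w)\<^sup>2))"
  have N: "0 < 1 + (norm w)\<^sup>2" by (simp add: add_pos_nonneg)
  have e: "0 < e" using b(1) N by (simp add: e_def)
  have "4 * b * e = 1 / (1 + (norm w)\<^sup>2)" using b(1) by (simp add: e_def)
  then have small: "4 * b * e \<le> 1" "4 * b * e * (norm w)\<^sup>2 \<le> 1" using N by (simp_all add: divide_le_eq)
  have bilinear: "bilinear (G x)" if "x \<in> X" for x
    using lorentz_form_G[OF that] by (simp add: lorentz_form_def)
  obtain R where R: "0 < R" "ball q R \<subseteq> X"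
    "\<And>x u v. x \<in> ball q R \<Longrightarrow> \<bar>G x u v - G q u v\<bar> \<le> e * norm u * norm v"
    using bilinear_family_uniformly_close[OF open_X q bilinear continuous_on_G e] by blast
  have "pinched (2 * b) (\<lambda>v. G x v v)" if "x \<in> ball q R" for x
    by (rule pinched_perturb[OF b _ small])
      (use R(3)[OF that] e in \<open>auto simp: power2_eq_square mult.assoc\<close>)
  then show thesis using R b(1) by (intro that[of R "2 * b"]) auto
qed

lemma timelike_near:
  assumes q: "q \<in> X" and w: "G q w w < 0"
  obtains R \<rho> where "0 < R" "0 < \<rho>" "ball q R \<subseteq> X"
    "\<And>x v. x \<in> ball q R \<Longrightarrow> v \<in> ball w \<rho> \<Longrightarrow> G x v v < 0"
proof -
  interpret timelike_vector "G q" w by unfold_locales (rule lorentz_form_G[OF q], rule w)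
  obtain R b where R: "0 < R" "ball q R \<subseteq> X" and b: "1 \<le> b"
    and pinched: "\<And>x. x \<in> ball q R \<Longrightarrow> pinched b (\<lambda>v. G x v v)"
    by (rule pinched_near[OF q w]) blast
  define U where "U = {v. b * (norm (hor v))\<^sup>2 < (lorentz_height (G q) w v)\<^sup>2 / b}"
  have "open U" unfolding U_def using b by (intro open_Collect_less continuous_intros) auto
  moreover have "w \<in> U" using b by (simp add: U_def)
  ultimately obtain \<rho> where "0 < \<rho>" "ball w \<rho> \<subseteq> U" using open_contains_ball by blast
  moreover have "G x v v < 0" if "x \<in> ball q R" "v \<in> U" for x v
    using pinched[OF that(1)] that(2) unfolding pinched_def U_def mem_Collect_eq by (smt (verit))
  ultimately show thesis using R by (intro that[of R \<rho>]) auto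
qed

lemma segment_exit:
  assumes V: "open V" "a \<in> V" "a + d *\<^sub>R v \<notin> V" and d: "0 < d"
    and S: "convex S" "S \<subseteq> X" "a \<in> S" "a + d *\<^sub>R v \<in> S" and v: "\<And>x. x \<in> S \<Longrightarrow> G x v v < 0"
  shows "\<exists>q w s0. q \<in> X \<and> q \<notin> V \<and> G q w w < 0 \<and> 0 < s0 \<and> (\<forall>s. 0 < s \<and> s \<le> s0 \<longrightarrow> q - s *\<^sub>R w \<in> V)"
proof -
  obtain s where s: "0 < s" "s \<le> d" "a + s *\<^sub>R v \<notin> V"
    and before: "\<And>t. 0 \<le> t \<Longrightarrow> t < s \<Longrightarrow> a + t *\<^sub>R v \<in> V"
    by (rule first_exit_time[of 0 d "\<lambda>s. a + s *\<^sub>R v" V]) (use V d in \<open>auto intro!: continuous_intros\<close>)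
  have "(1 - s / d) *\<^sub>R a + (s / d) *\<^sub>R (a + d *\<^sub>R v) \<in> S"
    by (rule convexD[OF S(1,3,4)]) (use s d in auto)
  then have "a + s *\<^sub>R v \<in> S" using d by (simp add: algebra_simps)
  moreover have "a + s *\<^sub>R v - t *\<^sub>R v \<in> V" if "0 < t" "t \<le> s" for t
    using before[of "s - t"] that by (simp add: algebra_simps)
  ultimately show ?thesis using S(2) v s by blast
qed

lemma timelike_exit:
  assumes V: "open V" and y: "y \<in> X" "y \<notin> V" "y \<in> closure V"
  shows "\<exists>q w s0. q \<in> X \<and> q \<notin> V \<and> G q w w < 0 \<and> 0 < s0 \<and> (\<forall>s. 0 < s \<and> s \<le> s0 \<longrightarrow> q - s *\<^sub>R w \<in> V)"
proof -
  obtain e where e: "G y e e < 0" using lorentz_form_G[OF y(1)] by (auto simp: lorentz_form_def)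
  obtain R \<rho> where R: "0 < R" and \<rho>: "0 < \<rho>" and R_X: "ball y R \<subseteq> X"
    and timelike: "\<And>x v. x \<in> ball y R \<Longrightarrow> v \<in> ball e \<rho> \<Longrightarrow> G x v v < 0"
    by (rule timelike_near[OF y(1) e]) blast
  define d where "d = R / (norm e + 1)"
  have "0 < norm e + 1" by (simp add: add_nonneg_pos)
  then have d: "0 < d" "d * norm e < R" using R by (simp_all add: d_def pos_divide_less_eq)
  define z where "z = y + d *\<^sub>R e"
  have z: "z \<in> ball y R" using d by (simp add: z_def dist_norm)
  show ?thesis
  proof (cases "z \<in> V")
    case True
    show ?thesis
    proof (rule segment_exit[OF V True _ d(1) convex_ball R_X z])
      fix x assume x: "x \<in> ball y R"
      then have "bilinear (G x)" using R_X lorentz_form_G by (auto simp: lorentz_form_def)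
      then show "G x (- e) (- e) < 0"
        using timelike[OF x, of e] \<rho> by (simp add: bilinear_lneg bilinear_rneg)
    qed (use R y(2) in \<open>simp_all add: z_def\<close>)
  next
    case False
    obtain a where a: "a \<in> V" "dist a y < min R (d * \<rho>)"
      using y(3) R d \<rho> by (metis closure_approachable min_less_iff_conj mult_pos_pos)
    define v where "v = (1 / d) *\<^sub>R (z - a)"
    have end_z: "a + d *\<^sub>R v = z" using d by (simp add: v_def)
    have "v = e + (1 / d) *\<^sub>R (y - a)" using d by (simp add: v_def z_def algebra_simps)
    moreover have "norm ((1 / d) *\<^sub>R (y - a)) < \<rho>"
      using a(2) d by (simp add: dist_norm norm_minus_commute divide_less_eq mult.commute)
    ultimately have v: "v \<in> ball e \<rho>" by (simp add: dist_norm)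
    show ?thesis
    proof (rule segment_exit[OF V a(1) _ d(1) convex_ball R_X])
      show "a + d *\<^sub>R v \<notin> V" "a + d *\<^sub>R v \<in> ball y R" "a \<in> ball y R"
        using False z a(2) by (simp_all add: end_z dist_commute)
    qed (rule timelike[OF _ v])
  qed
qed

end

section \<open>Isometric charts of an extension\<close>

locale isometric_chart = continuous_lorentz_field X G
  for X :: "'v::euclidean_space set" and G +
  fixes M :: "'v set" and g :: "'v \<Rightarrow> 'v \<Rightarrow> 'v \<Rightarrow> real"
    and W :: "'v set" and f :: "'v \<Rightarrow> 'v" and f' :: "'v \<Rightarrow> 'v \<Rightarrow> 'v"
  assumes open_W: "open W" and W_subset: "W \<subseteq> M" and inj_f: "inj_on f W"
    and f_has_derivative: "z \<in> W \<Longrightarrow> (f has_derivative f' z) (at z)"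
    and inj_f': "z \<in> W \<Longrightarrow> inj (f' z)"
    and continuous_on_f': "continuous_on W (\<lambda>z. f' z v)"
    and isometry: "z \<in> W \<Longrightarrow> g z u v = G (f z) (f' z u) (f' z v)"
    and limit_in_W: "\<lbrakk>\<And>k::nat. Z k \<in> W; Z \<longlonglongrightarrow> z; z \<in> M; (\<lambda>k. f (Z k)) \<longlonglongrightarrow> x; x \<in> X\<rbrakk> \<Longrightarrow> z \<in> W"
begin

lemma continuous_on_f: "continuous_on W f"
  by (rule has_derivative_continuous_on[OF has_derivative_at_withinI[OF f_has_derivative]])

lemma open_image_f: "open (f ` W)"
  by (rule invariance_of_domain[OF continuous_on_f open_W inj_f])

end

lemma smooth_on_has_frechet_derivative:
  assumes "smooth_on S f"
  shows "z \<in> S \<Longrightarrow> (f has_derivative frechet_derivative f (at z)) (at z)"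
    and "continuous_on S (\<lambda>z. frechet_derivative f (at z) v)"
proof -
  have "Ck_on (Suc 0) S f" using assms unfolding smooth_on_def by blast
  then show "z \<in> S \<Longrightarrow> (f has_derivative frechet_derivative f (at z)) (at z)"
    "continuous_on S (\<lambda>z. frechet_derivative f (at z) v)"
    by (simp_all flip: frechet_derivative_works)
qed

lemma smooth_manifold_chart:
  assumes "smooth_manifold T A" "(U, \<phi>) \<in> A"
  shows "openin T U" "open (\<phi> ` U)" "homeomorphic_map (subtopology T U) (top_of_set (\<phi> ` U)) \<phi>"
      "inj_on \<phi> U"
proof -
  show U: "openin T U" "open (\<phi> ` U)" and \<phi>: "homeomorphic_map (subtopology T U) (top_of_set (\<phi> ` U)) \<phi>"
    using assms unfolding smooth_manifold_def by blast+
  show "inj_on \<phi> U"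
    using homeomorphic_imp_injective_map[OF \<phi>] openin_subset[OF U(1)] by (simp add: Int_absorb1)
qed

lemma smooth_manifold_chart_preimage_open:
  assumes A: "smooth_manifold T A" "(U, \<phi>) \<in> A" and V: "open V"
  shows "openin T {x \<in> U. \<phi> x \<in> V}"
proof -
  note chart = smooth_manifold_chart[OF A]
  have "openin (subtopology T U) {x \<in> topspace (subtopology T U). \<phi> x \<in> \<phi> ` U \<inter> V}"
    by (rule openin_continuous_map_preimage[OF homeomorphic_imp_continuous_map[OF chart(3)]
      openin_open_Int[OF V]])
  moreover have "{x \<in> topspace (subtopology T U). \<phi> x \<in> \<phi> ` U \<inter> V} = {x \<in> U. \<phi> x \<in> V}"
    using openin_subset[OF chart(1)] by auto
  ultimately show ?thesis using openin_trans_full[OF _ chart(1)] by simp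
qed

lemma smooth_manifold_chart_limit:
  assumes A: "smooth_manifold T A" "(U, \<phi>) \<in> A"
    and c: "\<And>k::nat. c k \<in> U" "limitin T c x sequentially" and y: "(\<lambda>k. \<phi> (c k)) \<longlonglongrightarrow> y" "y \<in> \<phi> ` U"
  shows "x \<in> U"
proof -
  note chart = smooth_manifold_chart[OF A]
  obtain \<psi> where \<psi>: "continuous_map (top_of_set (\<phi> ` U)) (subtopology T U) \<psi>" "\<And>x. x \<in> U \<Longrightarrow> \<psi> (\<phi> x) = x"
    using chart(3) openin_subset[OF chart(1)]
    unfolding homeomorphic_map_maps homeomorphic_maps_def by (auto simp: Int_absorb1)
  have "limitin (top_of_set (\<phi> ` U)) (\<lambda>k. \<phi> (c k)) y sequentially" using y chart(2) by simp
  from continuous_map_limit[OF \<psi>(1) this] have "limitin (subtopology T U) c (\<psi> y) sequentially"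
    using \<psi>(2) c(1) by (simp add: o_def)
  then have lim: "limitin T c (\<psi> y) sequentially" "\<psi> y \<in> U" by (auto simp: limitin_subtopology)
  have "Hausdorff_space T" using A(1) by (simp add: smooth_manifold_def)
  from limitin_Hausdorff_unique[OF c(2) lim(1) _ this] lim(2) show ?thesis by simp
qed

lemma C0_extension_embedding:
  assumes "is_C0_extension M g T A G \<iota>"
  shows "continuous_map (top_of_set M) T \<iota>" "inj_on \<iota> M"
proof -
  have "homeomorphic_map (top_of_set M) (subtopology T (\<iota> ` M)) \<iota>"
    using assms by (simp add: is_C0_extension_def embedding_map_def)
  then show "continuous_map (top_of_set M) T \<iota>" "inj_on \<iota> M"
    using homeomorphic_imp_continuous_map continuous_map_in_subtopology homeomorphic_imp_injective_map
    by fastforce+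
qed

lemma C0_extension_isometric_chart:
  assumes ext: "is_C0_extension M g T A G \<iota>" and M: "open M" and U: "(U, \<phi>) \<in> A"
  shows "isometric_chart (\<phi> ` U) (G (U, \<phi>)) M g (M \<inter> \<iota> -` U) (\<phi> \<circ> \<iota>)
    (\<lambda>z. frechet_derivative (\<phi> \<circ> \<iota>) (at z))"
proof
  have manifold: "smooth_manifold T A" and metric: "continuous_lorentzian_metric T A G"
    using ext by (simp_all add: is_C0_extension_def)
  have smooth: "smooth_on (M \<inter> \<iota> -` U) (\<phi> \<circ> \<iota>)"
    and embedding_chart: "\<And>z. z \<in> M \<inter> \<iota> -` U \<Longrightarrow> inj (frechet_derivative (\<phi> \<circ> \<iota>) (at z)) \<and>
      (\<forall>u v. g z u v = G (U, \<phi>) (\<phi> (\<iota> z))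
        (frechet_derivative (\<phi> \<circ> \<iota>) (at z) u) (frechet_derivative (\<phi> \<circ> \<iota>) (at z) v))"
    using ext U unfolding is_C0_extension_def by fast+
  note chart = smooth_manifold_chart[OF manifold U]
  note \<iota> = C0_extension_embedding[OF ext]
  show "open (\<phi> ` U)" by (rule chart(2))
  show "lorentz_form (G (U, \<phi>) x)" if "x \<in> \<phi> ` U" for x
    using metric U that unfolding continuous_lorentzian_metric_def by blast
  show "continuous_on (\<phi> ` U) (\<lambda>x. G (U, \<phi>) x u v)" for u v
    using metric U unfolding continuous_lorentzian_metric_def by blast
  have "openin (top_of_set M) {z \<in> topspace (top_of_set M). \<iota> z \<in> U}"
    by (rule openin_continuous_map_preimage[OF \<iota>(1) chart(1)])
  then show "open (M \<inter> \<iota> -` U)"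
    using openin_open_trans[OF _ M] by (simp add: vimage_def Int_def)
  show "inj_on (\<phi> \<circ> \<iota>) (M \<inter> \<iota> -` U)"
    using \<iota>(2) chart(4) by (auto simp: inj_on_def)
  show "(\<phi> \<circ> \<iota> has_derivative frechet_derivative (\<phi> \<circ> \<iota>) (at z)) (at z)" if "z \<in> M \<inter> \<iota> -` U" for z
    by (rule smooth_on_has_frechet_derivative(1)[OF smooth that])
  show "continuous_on (M \<inter> \<iota> -` U) (\<lambda>z. frechet_derivative (\<phi> \<circ> \<iota>) (at z) v)" for v
    by (rule smooth_on_has_frechet_derivative(2)[OF smooth])
  show "inj (frechet_derivative (\<phi> \<circ> \<iota>) (at z))"
    "g z u v = G (U, \<phi>) ((\<phi> \<circ> \<iota>) z)
      (frechet_derivative (\<phi> \<circ> \<iota>) (at z) u) (frechet_derivative (\<phi> \<circ> \<iota>) (at z) v)"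
    if "z \<in> M \<inter> \<iota> -` U" for z u v
    using embedding_chart[OF that] by simp_all
  fix Z :: "nat \<Rightarrow> 'a" and z x
  assume Z: "\<And>k. Z k \<in> M \<inter> \<iota> -` U" "Z \<longlonglongrightarrow> z" "z \<in> M" and x: "(\<lambda>k. (\<phi> \<circ> \<iota>) (Z k)) \<longlonglongrightarrow> x" "x \<in> \<phi> ` U"
  have "limitin (top_of_set M) Z z sequentially" using Z M by simp
  from continuous_map_limit[OF \<iota>(1) this] have "limitin T (\<lambda>k. \<iota> (Z k)) (\<iota> z) sequentially"
    by (simp add: o_def)
  from smooth_manifold_chart_limit[OF manifold U _ this _ x(2)] Z x(1)
  show "z \<in> M \<inter> \<iota> -` U" by simp
qed simp

lemma C0_extension_frontier_chart:
  assumes ext: "is_C0_extension M g T A G \<iota>" and M: "open M" and U: "(U, \<phi>) \<in> A"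
    and x: "x \<in> U" "x \<in> T frontier_of (\<iota> ` M)"
  defines "V \<equiv> (\<phi> \<circ> \<iota>) ` (M \<inter> \<iota> -` U)"
  shows "\<phi> x \<notin> V" "\<phi> x \<in> closure V"
proof -
  have manifold: "smooth_manifold T A" using ext by (simp add: is_C0_extension_def)
  interpret isometric_chart "\<phi> ` U" "G (U, \<phi>)" M g "M \<inter> \<iota> -` U" "\<phi> \<circ> \<iota>"
      "\<lambda>z. frechet_derivative (\<phi> \<circ> \<iota>) (at z)"
    by (rule C0_extension_isometric_chart[OF ext M U])
  have x': "x \<in> T closure_of (\<iota> ` M)" "x \<notin> T interior_of (\<iota> ` M)"
    using x(2) by (auto simp: frontier_of_def)
  show "\<phi> x \<notin> V"
  proof
    assume "\<phi> x \<in> V"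
    then have "x \<in> {x \<in> U. \<phi> x \<in> V}" using x(1) by simp
    moreover have "{x \<in> U. \<phi> x \<in> V} \<subseteq> \<iota> ` M"
      using smooth_manifold_chart(4)[OF manifold U] by (auto simp: V_def inj_on_def)
    moreover have "openin T {x \<in> U. \<phi> x \<in> V}"
      using smooth_manifold_chart_preimage_open[OF manifold U open_image_f] by (simp add: V_def)
    ultimately show False using x'(2) interior_of_maximal by blast
  qed
  show "\<phi> x \<in> closure V"
    unfolding closure_approachable
  proof (intro allI impI)
    fix e :: real assume "0 < e"
    then have "x \<in> {x' \<in> U. \<phi> x' \<in> ball (\<phi> x) e}" using x(1) by simp
    moreover have "openin T {x' \<in> U. \<phi> x' \<in> ball (\<phi> x) e}"
      by (rule smooth_manifold_chart_preimage_open[OF manifold U open_ball])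
    moreover have "\<forall>S. x \<in> S \<and> openin T S \<longrightarrow> (\<exists>x'. x' \<in> \<iota> ` M \<and> x' \<in> S)"
      using x'(1) unfolding in_closure_of by (rule conjunct2)
    ultimately obtain x' where "x' \<in> \<iota> ` M" "x' \<in> {x' \<in> U. \<phi> x' \<in> ball (\<phi> x) e}"
      by meson
    then show "\<exists>y\<in>V. dist y (\<phi> x) < e" by (auto simp: V_def dist_commute)
  qed
qed

lemma C0_extension_boundary_chart:
  assumes ext: "is_C0_extension M g T A G \<iota>" and M: "open M"
  shows "\<exists>X G' W f f' y. isometric_chart X G' M g W f f' \<and> y \<in> X \<and> y \<notin> f ` W \<and> y \<in> closure (f ` W)"
proof -
  obtain x where x: "x \<in> T frontier_of (\<iota> ` M)" using ext by (auto simp: is_C0_extension_def)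
  then have "x \<in> topspace T" by (simp add: frontier_of_def in_closure_of)
  moreover have "\<Union> (fst ` A) = topspace T"
    using ext by (simp add: is_C0_extension_def smooth_manifold_def)
  ultimately obtain U \<phi> where U: "(U, \<phi>) \<in> A" "x \<in> U" by fastforce
  show ?thesis
  proof (intro exI conjI)
    show "isometric_chart (\<phi> ` U) (G (U, \<phi>)) M g (M \<inter> \<iota> -` U) (\<phi> \<circ> \<iota>)
        (\<lambda>z. frechet_derivative (\<phi> \<circ> \<iota>) (at z))"
      by (rule C0_extension_isometric_chart[OF ext M U(1)])
    show "\<phi> x \<in> \<phi> ` U" by (rule imageI[OF U(2)])
    show "\<phi> x \<notin> (\<phi> \<circ> \<iota>) ` (M \<inter> \<iota> -` U)" "\<phi> x \<in> closure ((\<phi> \<circ> \<iota>) ` (M \<inter> \<iota> -` U))"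
      by (rule C0_extension_frontier_chart[OF ext M U x])+
  qed
qed

section \<open>Inextendibility\<close>

lemma connected_nonzero_constant_sign:
  fixes f :: "'a::topological_space \<Rightarrow> real"
  assumes "connected S" "continuous_on S f" "\<And>x. x \<in> S \<Longrightarrow> f x \<noteq> 0"
  shows "\<exists>\<sigma>. (\<sigma> = 1 \<or> \<sigma> = -1) \<and> (\<forall>x\<in>S. 0 < \<sigma> * f x)"
proof -
  have "connected (f ` S)" by (rule connected_continuous_image[OF assms(2,1)])
  moreover have "0 \<notin> f ` S" using assms(3) by auto
  ultimately have "(\<forall>y\<in>f ` S. 0 < y) \<or> (\<forall>y\<in>f ` S. y < 0)"
    by (meson connectedD_interval linorder_not_less order_le_less)
  then show ?thesis
  proof
    assume "\<forall>y\<in>f ` S. 0 < y"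
    then show ?thesis by (intro exI[of _ 1]) simp
  next
    assume "\<forall>y\<in>f ` S. y < 0"
    then show ?thesis by (intro exI[of _ "-1"]) simp
  qed
qed

locale kasner_boundary_point = isometric_chart X G kasner_M "kasner_g p" W f f'
  for X :: "'n::finite spt set" and G p W f f' +
  fixes q w :: "'n spt" and R b :: real
  assumes abs_exponent_less_1: "\<bar>p i\<bar> < 1"
    and q_in_X: "q \<in> X" and q_notin_image: "q \<notin> f ` W" and w_timelike: "G q w w < 0"
    and R_pos: "0 < R" and ball_subset_X: "ball q R \<subseteq> X" and b_ge_1: "1 \<le> b"
    and pinched_G: "x \<in> ball q R
        \<Longrightarrow> vertical_splitting.pinched (lorentz_height (G q) w) w b (\<lambda>v. G x v v)"
begin

sublocale timelike_vector "G q" w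
  by unfold_locales (rule lorentz_form_G[OF q_in_X], rule w_timelike)

abbreviation height :: "'n spt \<Rightarrow> real" where
  "height \<equiv> lorentz_height (G q) w"

definition h :: real where
  "h = R / (norm w + 1)"

definition chart_domain :: "'n spt set" where
  "chart_domain = {z \<in> W. f z - q \<in> cylinder h}"

lemma h_pos: "0 < h"
  using R_pos by (simp add: h_def add_nonneg_pos)

lemma cylinder_in_ball:
  assumes "x \<in> cylinder h"
  shows "x + q \<in> ball q R"
proof -
  have "h * (norm w + 1) = R" using norm_ge_zero[of w] by (simp add: h_def add_nonneg_eq_0_iff)
  then show ?thesis using assms cylinder_subset_ball[of h] by (auto simp: dist_norm)
qed

lemma chart_domain_in_ball: "z \<in> chart_domain \<Longrightarrow> f z \<in> ball q R"
  using cylinder_in_ball[of "f z - q"] by (simp add: chart_domain_def)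

lemma open_chart_domain: "open chart_domain"
proof -
  have "chart_domain = W \<inter> (\<lambda>z. f z - q) -` cylinder h" by (auto simp: chart_domain_def)
  moreover have "continuous_on W (\<lambda>z. f z - q)" by (intro continuous_intros continuous_on_f)
  ultimately show ?thesis using continuous_open_preimage[OF _ open_W open_cylinder] by simp
qed

lemma time_direction_height_nonzero:
  assumes z: "z \<in> chart_domain"
  shows "height (f' z (1, 0)) \<noteq> 0"
proof
  define v where "v = f' z (1, 0)"
  assume "height (f' z (1, 0)) = 0"
  moreover have "(norm (hor v))\<^sup>2 / b - b * (height v)\<^sup>2 \<le> G (f z) v v"
    using pinched_G[OF chart_domain_in_ball[OF z]] unfolding pinched_def by blast
  moreover have "G (f z) v v = - 1"
    using isometry[of z "(1, 0)" "(1, 0)"] z by (simp add: v_def chart_domain_def kasner_g_diag)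
  moreover have "0 \<le> (norm (hor v))\<^sup>2 / b" using b_ge_1 by simp
  ultimately show False by (simp add: v_def[symmetric])
qed

lemma continuous_on_time_direction_height: "continuous_on W (\<lambda>z. height (f' z (1, 0)))"
  by (intro continuous_intros continuous_on_f')

lemma oriented_limit_in_domain:
  assumes \<sigma>: "\<bar>\<sigma>\<bar> = 1" and Z: "\<And>k::nat. Z k \<in> chart_domain" "\<And>k. 0 < \<sigma> * height (f' (Z k) (1, 0))"
    and lim: "Z \<longlonglongrightarrow> z" "z \<in> kasner_M" "(\<lambda>k. f (Z k) - q) \<longlonglongrightarrow> x" and x: "x \<in> cylinder h"
  shows "z \<in> chart_domain" "0 < \<sigma> * height (f' z (1, 0))"
proof -
  have ZW: "Z k \<in> W" for k using Z(1) by (simp add: chart_domain_def)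
  have fZ: "(\<lambda>k. f (Z k)) \<longlonglongrightarrow> x + q" using tendsto_add[OF lim(3) tendsto_const[of q]] by simp
  have zW: "z \<in> W"
    by (rule limit_in_W[OF ZW lim(1,2) fZ]) (use cylinder_in_ball[OF x] ball_subset_X in blast)
  have "(\<lambda>k. f (Z k)) \<longlonglongrightarrow> f z"
    by (rule continuous_on_tendsto_compose[OF continuous_on_f lim(1) zW]) (simp add: ZW)
  then have "f z = x + q" using LIMSEQ_unique fZ by blast
  then show z: "z \<in> chart_domain" using zW x by (simp add: chart_domain_def)
  have "(\<lambda>k. \<sigma> * height (f' (Z k) (1, 0))) \<longlonglongrightarrow> \<sigma> * height (f' z (1, 0))"
    by (intro tendsto_intros continuous_on_tendsto_compose[OF continuous_on_time_direction_height
      lim(1) zW])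
      (simp add: ZW)
  then have "0 \<le> \<sigma> * height (f' z (1, 0))"
    by (rule LIMSEQ_le_const) (use Z(2) less_imp_le in blast)
  moreover have "\<sigma> * height (f' z (1, 0)) \<noteq> 0"
    using time_direction_height_nonzero[OF z] \<sigma> by auto
  ultimately show "0 < \<sigma> * height (f' z (1, 0))" by linarith
qed

lemma oriented_kasner_chart:
  assumes \<sigma>: "\<bar>\<sigma>\<bar> = 1"
  defines "W\<sigma> \<equiv> {z \<in> chart_domain. 0 < \<sigma> * height (f' z (1, 0))}"
  shows "kasner_chart (\<lambda>v. \<sigma> * height v) (\<sigma> *\<^sub>R w) p W\<sigma> (\<lambda>z. f z - q) f' h b"
proof (intro kasner_chart.intro kasner_chart_axioms.intro, unfold sign_change(2,3)[OF \<sigma>])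
  show "vertical_splitting (\<lambda>v. \<sigma> * height v) (\<sigma> *\<^sub>R w)" by (rule sign_change(1)[OF \<sigma>])
  have W\<sigma>: "z \<in> W" "z \<in> chart_domain" if "z \<in> W\<sigma>" for z
    using that by (auto simp: W\<sigma>_def chart_domain_def)
  have "continuous_on chart_domain (\<lambda>z. \<sigma> * height (f' z (1, 0)))"
    by (intro continuous_intros continuous_on_subset[OF continuous_on_time_direction_height])
      (auto simp: chart_domain_def)
  from continuous_open_preimage[OF this open_chart_domain open_greaterThan[of 0]]
  show "open W\<sigma>" by (simp add: W\<sigma>_def vimage_def Int_def)
  show "W\<sigma> \<subseteq> kasner_M" using W\<sigma>(1) W_subset by blast
  show "inj_on (\<lambda>z. f z - q) W\<sigma>" using inj_f W\<sigma>(1) by (auto simp: inj_on_def)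
  show "((\<lambda>z. f z - q) has_derivative f' z) (at z)" if "z \<in> W\<sigma>" for z
    using has_derivative_diff[OF f_has_derivative[OF W\<sigma>(1)[OF that]] has_derivative_const[of q]] by simp
  show "inj (f' z)" if "z \<in> W\<sigma>" for z by (rule inj_f'[OF W\<sigma>(1)[OF that]])
  show "f z - q \<in> cylinder h" if "z \<in> W\<sigma>" for z using that by (simp add: W\<sigma>_def chart_domain_def)
  show "0 \<notin> (\<lambda>z. f z - q) ` W\<sigma>" using q_notin_image W\<sigma>(1) by auto
  show "z \<in> W\<sigma>" if "\<And>k::nat. Z k \<in> W\<sigma>" "Z \<longlonglongrightarrow> z" "z \<in> kasner_M" "(\<lambda>k. f (Z k) - q) \<longlonglongrightarrow> x" "x \<in> cylinder h"
    for Z z x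
    using oriented_limit_in_domain[OF \<sigma> _ _ that(2-5)] that(1) by (simp add: W\<sigma>_def)
  show "pinched b (\<lambda>v. kasner_g p z (inv (f' z) v) (inv (f' z) v))" if z: "z \<in> W\<sigma>" for z
  proof -
    have "surj (f' z)"
      by (rule linear_inj_imp_surj[OF has_derivative_linear[OF f_has_derivative] inj_f'])
        (rule W\<sigma>(1)[OF z])+
    then have "f' z (inv (f' z) v) = v" for v by (rule surj_f_inv_f)
    then show ?thesis
      using pinched_G[OF chart_domain_in_ball[OF W\<sigma>(2)[OF z]]] by (simp add: isometry[OF W\<sigma>(1)[OF z]])
  qed
  show "0 < \<sigma> * height (f' z (1, 0))" if "z \<in> W\<sigma>" for z using that by (simp add: W\<sigma>_def)
qed (rule abs_exponent_less_1 h_pos b_ge_1)+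

lemma segment_oriented:
  assumes s0: "0 < s0" "s0 < h" "\<And>s. 0 < s \<Longrightarrow> s \<le> s0 \<Longrightarrow> q - s *\<^sub>R w \<in> f ` W"
  obtains \<sigma> where "\<sigma> = 1 \<or> \<sigma> = -1"
    "\<And>s. 0 < s \<Longrightarrow> s \<le> s0 \<Longrightarrow>
      - (s *\<^sub>R w) \<in> (\<lambda>z. f z - q) ` {z \<in> chart_domain. 0 < \<sigma> * height (f' z (1, 0))}"
proof -
  define c where "c s = inv_into W f (q - s *\<^sub>R w)" for s
  have c: "f (c s) = q - s *\<^sub>R w" "c s \<in> chart_domain" if s: "s \<in> {0<..s0}" for s
  proof -
    have image: "q - s *\<^sub>R w \<in> f ` W" using s0(3) s by simp
    show "f (c s) = q - s *\<^sub>R w" unfolding c_def by (rule f_inv_into_f[OF image])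
    moreover have "- (s *\<^sub>R w) \<in> cylinder h"
      using s s0(2) h_pos by (simp add: cylinder_def splitting_simps)
    ultimately show "c s \<in> chart_domain"
      using inv_into_into[OF image] by (simp add: chart_domain_def c_def)
  qed
  have "continuous_on (f ` W) (inv_into W f)"
    by (rule continuous_on_inverse_open[OF open_W continuous_on_f order_refl inv_into_f_f[OF inj_f]])
  then have "continuous_on {0<..s0} c" unfolding c_def
    by (rule continuous_on_compose2) (use s0(3) in \<open>auto intro!: continuous_intros\<close>)
  then have connected: "connected (c ` {0<..s0})" by (intro connected_continuous_image) auto
  have cont: "continuous_on (c ` {0<..s0}) (\<lambda>z. height (f' z (1, 0)))"
    by (rule continuous_on_subset[OF continuous_on_time_direction_height])
      (use c(2) in \<open>auto simp: chart_domain_def\<close>)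
  have nonzero: "height (f' z (1, 0)) \<noteq> 0" if z: "z \<in> c ` {0<..s0}" for z
  proof -
    obtain s where "z = c s" "s \<in> {0<..s0}" using z by (rule imageE)
    then show ?thesis using time_direction_height_nonzero[OF c(2)] by blast
  qed
  obtain \<sigma> where \<sigma>: "\<sigma> = 1 \<or> \<sigma> = -1" "\<forall>z\<in>c ` {0<..s0}. 0 < \<sigma> * height (f' z (1, 0))"
    using connected_nonzero_constant_sign[OF connected cont nonzero] by metis
  show thesis
  proof (rule that[OF \<sigma>(1)])
    fix s assume "0 < s" "s \<le> s0"
    then have "s \<in> {0<..s0}" by simp
    then show "- (s *\<^sub>R w) \<in> (\<lambda>z. f z - q) ` {z \<in> chart_domain. 0 < \<sigma> * height (f' z (1, 0))}"
      using c \<sigma>(2) by (intro image_eqI[of _ _ "c s"]) simp_all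
  qed
qed

lemma no_timelike_approach:
  assumes s0: "0 < s0" "\<And>s. 0 < s \<Longrightarrow> s \<le> s0 \<Longrightarrow> q - s *\<^sub>R w \<in> f ` W" and j: "p j < 0"
  shows False
proof -
  define s1 where "s1 = min s0 (h / 2)"
  have s1: "0 < s1" "s1 < h" "s1 \<le> s0" using s0(1) h_pos by (auto simp: s1_def)
  obtain \<sigma> where \<sigma>: "\<sigma> = 1 \<or> \<sigma> = -1"
    and segment: "\<And>s. 0 < s \<Longrightarrow> s \<le> s1 \<Longrightarrow>
      - (s *\<^sub>R w) \<in> (\<lambda>z. f z - q) ` {z \<in> chart_domain. 0 < \<sigma> * height (f' z (1, 0))}"
    by (rule segment_oriented[OF s1(1,2)]) (use s0(2) s1(3) in auto)
  interpret chart: kasner_chart "\<lambda>v. \<sigma> * height v" "\<sigma> *\<^sub>R w" p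
    "{z \<in> chart_domain. 0 < \<sigma> * height (f' z (1, 0))}" "\<lambda>z. f z - q" f' h b
    by (rule oriented_kasner_chart) (use \<sigma> in auto)
  have in_region: "- (s *\<^sub>R w) \<in> chart.region" if "0 < s" "s \<le> s1" for s
    unfolding chart.region_def by (rule segment[OF that])
  from \<sigma> show False
  proof
    assume "\<sigma> = 1"
    then show False using chart.no_future_boundary[OF s1(1)] in_region by simp
  next
    assume "\<sigma> = -1"
    then show False using chart.no_past_boundary[OF s1(1) _ j] in_region by simp
  qed
qed

end

theorem theorem4p3:
  fixes p :: "'n::finite \<Rightarrow> real"
  assumes "CARD('n) \<ge> 3"
    and "(\<Sum>i\<in>UNIV. p i) = 1"
    and "(\<Sum>i\<in>UNIV. (p i)^2) = 1"
    and "\<exists>i. p i < 0"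
  shows "\<not> (\<exists>(T :: 'a topology) A G \<iota>. is_C0_extension kasner_M (kasner_g p) T A G \<iota>)"
proof
  obtain j where j: "p j < 0" using assms(4) by blast
  assume "\<exists>(T :: 'a topology) A G \<iota>. is_C0_extension kasner_M (kasner_g p) T A G \<iota>"
  then obtain X G W f f' y where chart: "isometric_chart X G kasner_M (kasner_g p) W f f'"
    and y: "y \<in> X" "y \<notin> f ` W" "y \<in> closure (f ` W)"
    using C0_extension_boundary_chart[OF _ open_kasner_M] by metis
  interpret isometric_chart X G kasner_M "kasner_g p" W f f' by (rule chart)
  obtain q w s0 where q: "q \<in> X" "q \<notin> f ` W" and w: "G q w w < 0"
    and s0: "0 < s0" "\<And>s. 0 < s \<Longrightarrow> s \<le> s0 \<Longrightarrow> q - s *\<^sub>R w \<in> f ` W"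
    using timelike_exit[OF open_image_f y] by blast
  obtain R b where "0 < R" "1 \<le> b" "ball q R \<subseteq> X"
    and "\<And>x. x \<in> ball q R \<Longrightarrow> vertical_splitting.pinched (lorentz_height (G q) w) w b (\<lambda>v. G x v v)"
    by (rule pinched_near[OF q(1) w]) blast
  then interpret kasner_boundary_point X G p W f f' q w R b
    by unfold_locales (use q w kasner_exponent_abs_less_1[OF assms(2,3) j] in auto)
  show False by (rule no_timelike_approach[OF s0 j])
qed

end
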